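(* Let $X$ be a complex Banach space, $\{T_h\}\in C_b((0,1],B(X))$, and let $\Omega\subset\mathbb{C}$ be an open set containing $\bigcup_{h\in(0,1]}Sp(T_h)$. Then for every analytic function $f:\Omega\to\mathbb{C}$, $$Sp(\{f(T_h)\})=f(Sp(\{T_h\})),$$ where $f(T_h)$ is defined by the holomorphic functional calculus.
   Context: $B(X)$ is the algebra of bounded linear operators on $X$; $Sp(T)$ is the usual spectrum of $T\in B(X)$, and for $f$ analytic on an open neighbourhood of $Sp(T)$, $f(T)=\frac{1}{2\pi i}\int_\gamma f(\lambda)(\lambda I-T)^{-1}d\lambda$ with $\gamma$ a contour enclosing $Sp(T)$ in the domain of $f$. $C_b((0,1],B(X))$ denotes the set of families $\{T_h\}_{h\in(0,1]}\subset B(X)$ with $\sup_h\|T_h\|<\infty$. For a family $\{S_h\}$ of bounded operators, its resolvent set is $r(\{S_h\})=\{\lambda\in\mathbb{C}:\ \exists\{\mathcal{R}(\lambda,S_h)\}\in C_b((0,1],B(X))$ with $\lim_{h\to0}\|(\lambda I-S_h)\mathcal{R}(\lambda,S_h)-I\|=\lim_{h\to0}\|\mathcal{R}(\lambda,S_h)(\lambda I-S_h)-I\|=0\}$, and its spectrum is $Sp(\{S_h\})=\mathbb{C}\setminus r(\{S_h\})$.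
   Formalization: The formal theorem additionally assumes that Sp({T_h}) is contained in Ω; without this f(Sp({T_h})) is undefined, e.g. X = ℂ, T_h = h, Ω = ℂ∖{0}, f(z) = 1/z, where Sp({T_h}) = {0}. *)

theory Defs
  imports "HOL-Complex_Analysis.Complex_Analysis"
begin

class complex_banach = banach +
  fixes cscale :: "complex \<Rightarrow> 'a \<Rightarrow> 'a"
  assumes cscale_of_real: "cscale (complex_of_real r) x = r *\<^sub>R x"
    and cscale_add_right: "cscale c (x + y) = cscale c x + cscale c y"
    and cscale_add_left: "cscale (a + b) x = cscale a x + cscale b x"
    and cscale_cscale: "cscale a (cscale b x) = cscale (a * b) x"
    and cscale_one: "cscale 1 x = x"
    and norm_cscale: "norm (cscale c x) = cmod c * norm x"

instantiation complex :: complex_banach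
begin
definition cscale_complex :: "complex \<Rightarrow> complex \<Rightarrow> complex" where
  "cscale_complex c x = c * x"
instance
  by standard (auto simp: cscale_complex_def scaleR_conv_of_real algebra_simps norm_mult)
end

definition bop :: "('a::complex_banach \<Rightarrow> 'a) \<Rightarrow> bool" where
  "bop T \<longleftrightarrow> bounded_linear T \<and> (\<forall>c x. T (cscale c x) = cscale c (T x))"

definition is_resolvent :: "complex \<Rightarrow> ('a::complex_banach \<Rightarrow> 'a) \<Rightarrow> ('a \<Rightarrow> 'a) \<Rightarrow> bool" where
  "is_resolvent l T S \<longleftrightarrow> bop S \<and> (\<forall>x. cscale l (S x) - T (S x) = x) \<and> (\<forall>x. S (cscale l x - T x) = x)"

definition sp :: "('a::complex_banach \<Rightarrow> 'a) \<Rightarrow> complex set" where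
  "sp T = {l. \<not> (\<exists>S. is_resolvent l T S)}"

definition resolv :: "complex \<Rightarrow> ('a::complex_banach \<Rightarrow> 'a) \<Rightarrow> ('a \<Rightarrow> 'a)" where
  "resolv l T = (SOME S. is_resolvent l T S)"

definition admissible_cycle :: "complex set \<Rightarrow> complex set \<Rightarrow> (real \<Rightarrow> complex) list \<Rightarrow> bool" where
  "admissible_cycle Om K \<Gamma> \<longleftrightarrow>
     (\<forall>g\<in>set \<Gamma>. valid_path g \<and> pathfinish g = pathstart g \<and> path_image g \<subseteq> Om - K) \<and>
     (\<forall>z\<in>K. (\<Sum>g\<leftarrow>\<Gamma>. winding_number g z) = 1) \<and>
     (\<forall>z. z \<notin> Om \<longrightarrow> (\<Sum>g\<leftarrow>\<Gamma>. winding_number g z) = 0)"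

text \<open>f(T) = 1/(2 pi i) \<integral>_gamma f(l) (l I - T)^{-1} dl, evaluated strongly (pointwise in x),
where gamma is a chosen admissible cycle for Sp(T) in Om.\<close>
definition hfc :: "complex set \<Rightarrow> (complex \<Rightarrow> complex) \<Rightarrow> ('a::complex_banach \<Rightarrow> 'a) \<Rightarrow> ('a \<Rightarrow> 'a)" where
  "hfc Om f T = (let \<Gamma> = (SOME \<Gamma>. admissible_cycle Om (sp T) \<Gamma>) in
     (\<lambda>x. cscale (1 / (2 * of_real pi * \<i>))
        (\<Sum>g\<leftarrow>\<Gamma>. integral {0..1}
            (\<lambda>t. cscale (f (g t) * vector_derivative g (at t within {0..1})) (resolv (g t) T x)))))"

definition bounded_family :: "(real \<Rightarrow> 'a::complex_banach \<Rightarrow> 'a) \<Rightarrow> bool" where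
  "bounded_family R \<longleftrightarrow> (\<forall>h\<in>{0<..1}. bop (R h)) \<and> (\<exists>M. \<forall>h\<in>{0<..1}. onorm (R h) \<le> M)"

definition fam_resolvent_set :: "(real \<Rightarrow> 'a::complex_banach \<Rightarrow> 'a) \<Rightarrow> complex set" where
  "fam_resolvent_set S = {l. \<exists>R. bounded_family R \<and>
      ((\<lambda>h. onorm (\<lambda>x. cscale l (R h x) - S h (R h x) - x)) \<longlongrightarrow> 0) (at_right 0) \<and>
      ((\<lambda>h. onorm (\<lambda>x. R h (cscale l x - S h x) - x)) \<longlongrightarrow> 0) (at_right 0)}"

definition fam_sp :: "(real \<Rightarrow> 'a::complex_banach \<Rightarrow> 'a) \<Rightarrow> complex set" where
  "fam_sp S = - fam_resolvent_set S"

end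

theory Submission
  imports Defs
begin

text \<open>
  A point outside the spectrum of the family is, for all small \<open>h\<close>, outside \<open>sp (T h)\<close> with resolvents bounded
  uniformly in \<open>h\<close>, and by compactness this is locally uniform in the point. Hence the spectrum of the
  family is compact, and one cycle around it in \<open>Om\<close> computes \<open>f(T h)\<close> for all small \<open>h\<close> with uniform bounds.
  The theorem then follows from identities for single operators. If \<open>\<mu>\<close> is not a value of \<open>f\<close> on the
  spectrum of the family, \<open>(1 / (\<mu> - f))(T h)\<close> is a bounded resolvent of \<open>f(T h)\<close>. Conversely,
  \<open>f l - f w = (l - w) k w\<close> gives \<open>f l - f(T h) = (l - T h) k(T h)\<close> with commuting factors, so a
  resolvent of \<open>f(T h)\<close> at \<open>f l\<close> yields one of \<open>T h\<close> at \<open>l\<close>.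

  Vector-valued integrals are reduced to scalar ones by bounded functionals, which separate points by the
  Hahn--Banach theorem. The independence of the chosen cycle comes from the homology form of Cauchy's theorem.
\<close>

section \<open>Separation by bounded functionals\<close>

definition sublinear :: "('a::real_vector \<Rightarrow> real) \<Rightarrow> bool" where
  "sublinear p \<longleftrightarrow> (\<forall>x y. p (x + y) \<le> p x + p y) \<and> (\<forall>c\<ge>0. \<forall>x. p (c *\<^sub>R x) = c * p x)"

lemma sublinear_add_le: "sublinear p \<Longrightarrow> p (x + y) \<le> p x + p y"
  by (simp add: sublinear_def)

lemma sublinear_scaleR: "sublinear p \<Longrightarrow> c \<ge> 0 \<Longrightarrow> p (c *\<^sub>R x) = c * p x"
  by (simp add: sublinear_def)

lemma sublinear_zero: "sublinear p \<Longrightarrow> p 0 = 0"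
  using sublinear_scaleR[of p 0 0] by simp

lemma sublinear_minus_ge: "sublinear p \<Longrightarrow> - p (- x) \<le> p x"
  using sublinear_add_le[of p x "- x"] sublinear_zero[of p] by simp

lemma sublinear_norm: "sublinear norm"
  by (simp add: sublinear_def norm_triangle_ineq)

lemma sublinear_INF:
  fixes p :: "'i \<Rightarrow> 'a::real_vector \<Rightarrow> real"
  assumes "I \<noteq> {}" and bdd: "\<And>x. bdd_below ((\<lambda>i. p i x) ` I)"
    and add: "\<And>i j x y. i \<in> I \<Longrightarrow> j \<in> I \<Longrightarrow> \<exists>k\<in>I. p k (x + y) \<le> p i x + p j y"
    and scale: "\<And>i c x. i \<in> I \<Longrightarrow> c > 0 \<Longrightarrow> \<exists>k\<in>I. p k (c *\<^sub>R x) \<le> c * p i x"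
  shows "sublinear (\<lambda>x. INF i\<in>I. p i x)"
proof -
  define q where "q x = (INF i\<in>I. p i x)" for x
  have lower: "q x \<le> p i x" if "i \<in> I" for i x
    unfolding q_def by (rule cINF_lower[OF bdd that])
  have greatest: "b \<le> q x" if "\<And>i. i \<in> I \<Longrightarrow> b \<le> p i x" for b x
    unfolding q_def using \<open>I \<noteq> {}\<close> that by (rule cINF_greatest)
  have subadditive: "q (x + y) \<le> q x + q y" for x y
  proof -
    have "q (x + y) - p i x \<le> q y" if i: "i \<in> I" for i
    proof (rule greatest)
      fix j assume "j \<in> I"
      then obtain k where "k \<in> I" "p k (x + y) \<le> p i x + p j y" using add[OF i] by blast
      then show "q (x + y) - p i x \<le> p j y" using lower[of k "x + y"] by linarith
    qed
    then have "q (x + y) - q y \<le> q x"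
      by (intro greatest) (simp add: algebra_simps)
    then show ?thesis by simp
  qed
  have scale_le: "q (c *\<^sub>R x) \<le> c * q x" if c: "c > 0" for c x
  proof -
    have "q (c *\<^sub>R x) / c \<le> q x"
    proof (rule greatest)
      fix i assume "i \<in> I"
      then obtain k where "k \<in> I" "p k (c *\<^sub>R x) \<le> c * p i x" using scale[OF _ c] by blast
      then have "q (c *\<^sub>R x) \<le> c * p i x" using lower order_trans by blast
      then show "q (c *\<^sub>R x) / c \<le> p i x" using c by (simp add: field_simps)
    qed
    then show ?thesis using c by (simp add: field_simps)
  qed
  have homogeneous: "q (c *\<^sub>R x) = c * q x" if c: "c > 0" for c x
    using scale_le[OF c, of x] scale_le[of "1 / c" "c *\<^sub>R x"] c by (simp add: field_simps)
  have "q 0 = 0"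
    using homogeneous[of 2 0] by simp
  then have "q (c *\<^sub>R x) = c * q x" if "c \<ge> 0" for c x
    using homogeneous[of c x] that by (cases "c = 0") auto
  then show ?thesis
    using subadditive by (simp add: sublinear_def flip: q_def)
qed

text \<open>A minimal sublinear functional is not changed by being tilted, which makes it additive.\<close>

lemma sublinear_tilt:
  assumes p: "sublinear p"
  obtains q where "sublinear q" "q \<le> p" "\<And>x. q x \<le> p (x + a) - p a"
proof -
  define r where "r t x = p (x + t *\<^sub>R a) - t * p a" for t x
  have "- p (- x) \<le> r t x" if "t \<ge> 0" for t x
    using sublinear_add_le[OF p, of "x + t *\<^sub>R a" "- x"] sublinear_scaleR[OF p that, of a] by (simp add: r_def)
  then have bdd: "bdd_below ((\<lambda>t. r t x) ` {0..})" for x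
    by (intro bdd_belowI2) auto
  have add: "r (s + t) (x + y) \<le> r s x + r t y" for s t x y
    using sublinear_add_le[OF p, of "x + s *\<^sub>R a" "y + t *\<^sub>R a"] by (simp add: r_def algebra_simps)
  have scale: "r (c * t) (c *\<^sub>R x) = c * r t x" if "c > 0" for c t x
    using sublinear_scaleR[OF p, of c "x + t *\<^sub>R a"] that by (simp add: r_def algebra_simps)
  define q where "q x = (INF t\<in>{0..}. r t x)" for x
  have lower: "q x \<le> r t x" if "t \<ge> 0" for t x
    unfolding q_def by (rule cINF_lower[OF bdd]) (use that in simp)
  have "sublinear q"
    unfolding q_def
  proof (rule sublinear_INF[OF _ bdd])
    show "\<exists>k\<in>{0..}. r k (x + y) \<le> r s x + r t y" if "s \<in> {0..}" "t \<in> {0..}" for s t x y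
      using that add[of s t x y] by (intro bexI[of _ "s + t"]) auto
    show "\<exists>k\<in>{0..}. r k (c *\<^sub>R x) \<le> c * r t x" if "t \<in> {0..}" "c > 0" for t c x
      using that scale[of c t x] by (intro bexI[of _ "c * t"]) auto
  qed simp
  moreover have "q \<le> p"
    using lower[of 0] by (intro le_funI) (simp add: r_def)
  moreover have "q x \<le> p (x + a) - p a" for x
    using lower[of 1 x] by (simp add: r_def)
  ultimately show ?thesis by (rule that)
qed

lemma sublinear_chain_lower_bound:
  assumes "C \<noteq> {}" and C: "\<And>q. q \<in> C \<Longrightarrow> sublinear q \<and> q \<le> p"
    and total: "\<And>q r. q \<in> C \<Longrightarrow> r \<in> C \<Longrightarrow> q \<le> r \<or> r \<le> q"
  obtains u where "sublinear u" "\<And>q. q \<in> C \<Longrightarrow> u \<le> q"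
proof -
  have bdd: "bdd_below ((\<lambda>q. q x) ` C)" for x
  proof (rule bdd_belowI2)
    fix q assume "q \<in> C"
    then have "- q (- x) \<le> q x" "q (- x) \<le> p (- x)"
      using C sublinear_minus_ge by (auto simp: le_fun_def)
    then show "- p (- x) \<le> q x" by linarith
  qed
  define u where "u x = (INF q\<in>C. q x)" for x
  have "sublinear u"
    unfolding u_def
  proof (rule sublinear_INF[OF \<open>C \<noteq> {}\<close> bdd])
    fix q r x y assume q: "q \<in> C" and r: "r \<in> C"
    obtain s where s: "s \<in> C" "s \<le> q" "s \<le> r" using total[OF q r] q r by blast
    then have "s (x + y) \<le> q x + r y"
      using C[OF s(1)] sublinear_add_le[of s x y] by (fastforce simp: le_fun_def intro: order_trans add_mono)
    then show "\<exists>s\<in>C. s (x + y) \<le> q x + r y" using s(1) by blast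
  next
    fix q c x assume "q \<in> C" "(c::real) > 0"
    then show "\<exists>r\<in>C. r (c *\<^sub>R x) \<le> c * q x"
      using C sublinear_scaleR[of q c x] by (intro bexI[of _ q]) auto
  qed
  moreover have "u \<le> q" if "q \<in> C" for q
    unfolding u_def by (intro le_funI cINF_lower[OF bdd that])
  ultimately show ?thesis by (rule that)
qed

lemma sublinear_minimal_below:
  assumes p: "sublinear p"
  obtains u where "sublinear u" "u \<le> p" "\<And>q. sublinear q \<Longrightarrow> q \<le> u \<Longrightarrow> q = u"
proof -
  define A where "A = {q. sublinear q \<and> q \<le> p}"
  have "\<exists>m\<in>A. \<forall>q\<in>A. q \<le> m \<longrightarrow> q = m"
  proof (rule predicate_Zorn)
    show "partial_order_on A (relation_of (\<lambda>q r. r \<le> q) A)"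
      by (rule partial_order_on_relation_ofI) auto
  next
    fix C assume chain: "C \<in> Chains (relation_of (\<lambda>q r. r \<le> q) A)"
    show "\<exists>u\<in>A. \<forall>q\<in>C. u \<le> q"
    proof (cases "C = {}")
      case True
      then show ?thesis using p by (auto simp: A_def)
    next
      case False
      have C: "sublinear q \<and> q \<le> p" if "q \<in> C" for q
        using chain that by (auto simp: Chains_def relation_of_def A_def)
      have total: "q \<le> r \<or> r \<le> q" if "q \<in> C" "r \<in> C" for q r
        using chain that by (auto simp: Chains_def relation_of_def)
      obtain u where u: "sublinear u" "\<And>q. q \<in> C \<Longrightarrow> u \<le> q"
        using sublinear_chain_lower_bound[OF False C total] by metis
      moreover have "u \<le> p" using False u(2) C order_trans by blast
      ultimately show ?thesis by (auto simp: A_def)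
    qed
  qed
  then obtain u where "u \<in> A" "\<And>q. q \<in> A \<Longrightarrow> q \<le> u \<Longrightarrow> q = u" by blast
  then show ?thesis
    using that[of u] by (auto simp: A_def intro: order_trans)
qed

lemma linear_below_sublinear:
  assumes p: "sublinear p"
  obtains u where "linear u" "u \<le> p"
proof -
  obtain u where u: "sublinear u" "u \<le> p" and minimal: "\<And>q. sublinear q \<Longrightarrow> q \<le> u \<Longrightarrow> q = u"
    using sublinear_minimal_below[OF p] by metis
  have add: "u (x + a) = u x + u a" for x a
  proof (rule antisym)
    obtain q where "sublinear q" "q \<le> u" "\<And>x. q x \<le> u (x + a) - u a"
      using sublinear_tilt[OF u(1), of a] by metis
    then have "u x \<le> u (x + a) - u a" using minimal by metis
    then show "u x + u a \<le> u (x + a)" by simp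
  qed (rule sublinear_add_le[OF u(1)])
  have minus: "u (- x) = - u x" for x
    using add[of x "- x"] sublinear_zero[OF u(1)] by simp
  have "u (c *\<^sub>R x) = c * u x" for c x
    using sublinear_scaleR[OF u(1), of "\<bar>c\<bar>" x] minus[of "c *\<^sub>R x"] by (cases "c \<ge> 0") auto
  then have "linear u" by (intro linearI) (simp_all add: add)
  then show ?thesis using u(2) by (rule that)
qed

theorem Hahn_Banach_sublinear:
  assumes p: "sublinear p"
  obtains u where "linear u" "u \<le> p" "u a = p a"
proof -
  obtain q where q: "sublinear q" "q \<le> p" "\<And>x. q x \<le> p (x + a) - p a"
    using sublinear_tilt[OF p] by metis
  obtain u where u: "linear u" "u \<le> q" using linear_below_sublinear[OF q(1)] by metis
  have "u (- a) \<le> - p a"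
    using le_funD[OF u(2), of "- a"] q(3)[of "- a"] sublinear_zero[OF p] by simp
  moreover have "u \<le> p" using u(2) q(2) by (rule order_trans)
  ultimately have "u a = p a"
    using linear_neg[OF u(1), of a] by (simp add: le_fun_def antisym)
  then show ?thesis using u(1) \<open>u \<le> p\<close> that by blast
qed

corollary norming_functional:
  fixes a :: "'a::real_normed_vector"
  obtains u :: "'a \<Rightarrow> real" where "linear u" "\<And>x. \<bar>u x\<bar> \<le> norm x" "u a = norm a"
proof -
  obtain u :: "'a \<Rightarrow> real" where u: "linear u" "u \<le> norm" "u a = norm a"
    using Hahn_Banach_sublinear[OF sublinear_norm] by metis
  have "\<bar>u x\<bar> \<le> norm x" for x
    using le_funD[OF u(2), of x] le_funD[OF u(2), of "- x"] linear_neg[OF u(1), of x] by simp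
  then show ?thesis using u(1,3) that by blast
qed

section \<open>Complex-linear maps\<close>

lemma bounded_bilinear_cscale: "bounded_bilinear cscale"
proof
  show "cscale (r *\<^sub>R c) x = r *\<^sub>R cscale c x" "cscale c (r *\<^sub>R x) = r *\<^sub>R cscale c x" for r c and x :: 'a
    by (metis cscale_cscale cscale_of_real scaleR_conv_of_real mult.commute)+
  show "\<exists>K. \<forall>c x. norm (cscale c (x :: 'a)) \<le> norm c * norm x * K"
    by (auto simp: norm_cscale intro: exI[of _ 1])
qed (simp_all add: cscale_add_left cscale_add_right)

interpretation cscale: bounded_bilinear cscale
  by (rule bounded_bilinear_cscale)

declare cscale_one [simp] cscale_complex_def [simp]

locale bounded_clinear = bounded_linear f
  for f :: "'a::complex_banach \<Rightarrow> 'b::complex_banach" +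
  assumes cscale: "f (cscale c x) = cscale c (f x)"

lemma bop_iff_bounded_clinear: "bop T \<longleftrightarrow> bounded_clinear T"
  by (simp add: bop_def bounded_clinear_def bounded_clinear_axioms_def)

lemma bounded_clinearI:
  assumes "\<And>x y. f (x + y) = f x + f y" "\<And>c x. f (cscale c x) = cscale c (f x)"
    "\<And>x. norm (f x) \<le> C * norm x"
  shows "bounded_clinear f"
proof
  show "f (r *\<^sub>R x) = r *\<^sub>R f x" for r x
    using assms(2)[of "of_real r" x] by (simp add: cscale_of_real)
  show "\<exists>K. \<forall>x. norm (f x) \<le> norm x * K"
    using assms(3) by (metis mult.commute)
qed (use assms in auto)

lemma bounded_clinear_ident: "bounded_clinear (\<lambda>x. x)"
  by (rule bounded_clinearI[where C = 1]) auto

lemma bounded_clinear_cscale: "bounded_clinear (cscale c)"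
  by (rule bounded_clinearI[where C = "cmod c"])
     (simp_all add: cscale.add_right cscale_cscale norm_cscale mult.commute)

lemma bounded_clinear_compose:
  "bounded_clinear f \<Longrightarrow> bounded_clinear g \<Longrightarrow> bounded_clinear (\<lambda>x. f (g x))"
  by (simp add: bounded_clinear_def bounded_clinear_axioms_def bounded_linear_compose)

lemma bounded_clinear_diff:
  "bounded_clinear f \<Longrightarrow> bounded_clinear g \<Longrightarrow> bounded_clinear (\<lambda>x. f x - g x)"
  by (simp add: bounded_clinear_def bounded_clinear_axioms_def bounded_linear_sub cscale.diff_right)

lemma bounded_clinear_complexify:
  fixes u :: "'a::complex_banach \<Rightarrow> real"
  assumes u: "linear u" "\<And>x. \<bar>u x\<bar> \<le> norm x"
  shows "bounded_clinear (\<lambda>x. Complex (u x) (- u (cscale \<i> x)))"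
proof (rule bounded_clinearI)
  show "norm (Complex (u x) (- u (cscale \<i> x))) \<le> 2 * norm x" for x
    using cmod_le[of "Complex (u x) (- u (cscale \<i> x))"] u(2)[of x] u(2)[of "cscale \<i> x"]
    by (simp add: norm_cscale)
  have cscale_Re_Im: "cscale c x = Re c *\<^sub>R x + Im c *\<^sub>R cscale \<i> x" for c and x :: 'a
  proof -
    have "cscale c x = cscale (of_real (Re c)) x + cscale (of_real (Im c)) (cscale \<i> x)"
      by (metis complex_eq mult.commute cscale.add_left cscale_cscale)
    then show ?thesis by (simp only: cscale_of_real)
  qed
  have "cscale \<i> (cscale \<i> x) = - x" for x :: 'a
    by (simp add: cscale_cscale cscale.minus_left)
  then show "Complex (u (cscale c x)) (- u (cscale \<i> (cscale c x))) =
      cscale c (Complex (u x) (- u (cscale \<i> x)))" for c x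
    by (simp add: cscale_Re_Im[of c x] complex_eq_iff cscale.add_right cscale.scaleR_right
        linear_add[OF u(1)] linear_diff[OF u(1)] linear_scale[OF u(1)])
qed (simp add: complex_eq_iff cscale.add_right linear_add[OF u(1)])

lemma functionals_separate_points:
  fixes x y :: "'a::complex_banach"
  assumes "\<And>\<phi> :: 'a \<Rightarrow> complex. bounded_clinear \<phi> \<Longrightarrow> \<phi> x = \<phi> y"
  shows "x = y"
proof -
  obtain u :: "'a \<Rightarrow> real" where u: "linear u" "\<And>z. \<bar>u z\<bar> \<le> norm z" "u (x - y) = norm (x - y)"
    using norming_functional by metis
  have "u x = u y"
    using assms[OF bounded_clinear_complexify[OF u(1,2)]] by simp
  then show ?thesis using u(3) linear_diff[OF u(1), of x y] by simp
qed

section \<open>Cycles\<close>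

definition is_cycle :: "complex set \<Rightarrow> (real \<Rightarrow> complex) list \<Rightarrow> bool" where
  "is_cycle V \<Gamma> \<longleftrightarrow> (\<forall>g\<in>set \<Gamma>. valid_path g \<and> pathfinish g = pathstart g \<and> path_image g \<subseteq> V)"

definition cycle_image :: "(real \<Rightarrow> complex) list \<Rightarrow> complex set" where
  "cycle_image \<Gamma> = (\<Union>g\<in>set \<Gamma>. path_image g)"

definition cycle_integral :: "(real \<Rightarrow> complex) list \<Rightarrow> (complex \<Rightarrow> complex) \<Rightarrow> complex" where
  "cycle_integral \<Gamma> F = (\<Sum>g\<leftarrow>\<Gamma>. contour_integral g F)"

definition cycle_integrable :: "(real \<Rightarrow> complex) list \<Rightarrow> (complex \<Rightarrow> complex) \<Rightarrow> bool" where
  "cycle_integrable \<Gamma> F \<longleftrightarrow> (\<forall>g\<in>set \<Gamma>. F contour_integrable_on g)"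

definition cycle_index :: "(real \<Rightarrow> complex) list \<Rightarrow> complex \<Rightarrow> complex" where
  "cycle_index \<Gamma> z = (\<Sum>g\<leftarrow>\<Gamma>. winding_number g z)"

lemma is_cycleD:
  assumes "is_cycle V \<Gamma>" "g \<in> set \<Gamma>"
  shows "valid_path g" "path g" "pathfinish g = pathstart g" "path_image g \<subseteq> V"
  using assms by (auto simp: is_cycle_def intro: valid_path_imp_path)

lemma is_cycle_mono: "is_cycle V \<Gamma> \<Longrightarrow> V \<subseteq> V' \<Longrightarrow> is_cycle V' \<Gamma>"
  by (auto simp: is_cycle_def)

lemma is_cycle_cycle_image: "is_cycle V \<Gamma> \<Longrightarrow> cycle_image \<Gamma> \<subseteq> V' \<Longrightarrow> is_cycle V' \<Gamma>"
  by (auto simp: is_cycle_def cycle_image_def)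

lemma cycle_image_subset: "is_cycle V \<Gamma> \<Longrightarrow> cycle_image \<Gamma> \<subseteq> V"
  by (auto simp: is_cycle_def cycle_image_def)

lemma path_image_subset_cycle_image: "g \<in> set \<Gamma> \<Longrightarrow> path_image g \<subseteq> cycle_image \<Gamma>"
  by (auto simp: cycle_image_def)

lemma compact_cycle_image: "is_cycle V \<Gamma> \<Longrightarrow> compact (cycle_image \<Gamma>)"
  unfolding cycle_image_def by (intro compact_UN) (auto dest: is_cycleD(2) intro: compact_path_image)

lemma is_cycle_append: "is_cycle V (\<Gamma> @ \<Delta>) \<longleftrightarrow> is_cycle V \<Gamma> \<and> is_cycle V \<Delta>"
  by (auto simp: is_cycle_def)

lemma is_cycle_reverse: "is_cycle V \<Gamma> \<Longrightarrow> is_cycle V (map reversepath \<Gamma>)"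
  by (auto simp: is_cycle_def)

lemma cycle_integral_append: "cycle_integral (\<Gamma> @ \<Delta>) F = cycle_integral \<Gamma> F + cycle_integral \<Delta> F"
  by (simp add: cycle_integral_def)

lemma cycle_integral_reverse:
  assumes "is_cycle V \<Gamma>"
  shows "cycle_integral (map reversepath \<Gamma>) F = - cycle_integral \<Gamma> F"
  using assms unfolding cycle_integral_def is_cycle_def
  by (induction \<Gamma>) (auto simp: contour_integral_reversepath)

lemma cycle_integral_cong:
  assumes "\<And>w. w \<in> cycle_image \<Gamma> \<Longrightarrow> F w = G w"
  shows "cycle_integral \<Gamma> F = cycle_integral \<Gamma> G"
  unfolding cycle_integral_def
  by (intro arg_cong[of _ _ sum_list] map_cong refl contour_integral_eq)
     (use assms in \<open>auto simp: cycle_image_def\<close>)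

lemma cycle_integral_eq_sum: "cycle_integral \<Gamma> F = (\<Sum>i<length \<Gamma>. contour_integral (\<Gamma> ! i) F)"
  by (simp add: cycle_integral_def sum_list_sum_nth atLeast0LessThan)

lemma cycle_integrable_holomorphic:
  "is_cycle V \<Gamma> \<Longrightarrow> open V \<Longrightarrow> F holomorphic_on V \<Longrightarrow> cycle_integrable \<Gamma> F"
  unfolding cycle_integrable_def by (meson contour_integrable_holomorphic_simple is_cycleD)

lemma cycle_integrable_lmul: "cycle_integrable \<Gamma> F \<Longrightarrow> cycle_integrable \<Gamma> (\<lambda>w. c * F w)"
  by (auto simp: cycle_integrable_def intro: contour_integrable_lmul)

lemma cycle_integral_zero: "cycle_integral \<Gamma> (\<lambda>w. 0) = 0"
  by (simp add: cycle_integral_def)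

lemma cycle_integral_add:
  assumes "cycle_integrable \<Gamma> F" "cycle_integrable \<Gamma> G"
  shows "cycle_integral \<Gamma> (\<lambda>w. F w + G w) = cycle_integral \<Gamma> F + cycle_integral \<Gamma> G"
  using assms unfolding cycle_integral_def cycle_integrable_def sum_list_addf[symmetric]
  by (intro arg_cong[of _ _ sum_list] map_cong) (auto simp: contour_integral_add)

lemma cycle_integral_diff:
  assumes "cycle_integrable \<Gamma> F" "cycle_integrable \<Gamma> G"
  shows "cycle_integral \<Gamma> (\<lambda>w. F w - G w) = cycle_integral \<Gamma> F - cycle_integral \<Gamma> G"
  using assms unfolding cycle_integral_def cycle_integrable_def sum_list_subtractf[symmetric]
  by (intro arg_cong[of _ _ sum_list] map_cong) (auto simp: contour_integral_diff)

lemma cycle_integral_lmul: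
  assumes "cycle_integrable \<Gamma> F"
  shows "cycle_integral \<Gamma> (\<lambda>w. c * F w) = c * cycle_integral \<Gamma> F"
  using assms unfolding cycle_integral_def cycle_integrable_def sum_list_const_mult[symmetric]
  by (intro arg_cong[of _ _ sum_list] map_cong) (auto simp: contour_integral_lmul)

lemma cycle_index_append: "cycle_index (\<Gamma> @ \<Delta>) z = cycle_index \<Gamma> z + cycle_index \<Delta> z"
  by (simp add: cycle_index_def)

lemma cycle_index_reverse:
  assumes "is_cycle V \<Gamma>" "z \<notin> cycle_image \<Gamma>"
  shows "cycle_index (map reversepath \<Gamma>) z = - cycle_index \<Gamma> z"
  using assms unfolding cycle_index_def is_cycle_def cycle_image_def
  by (induction \<Gamma>) (auto simp: winding_number_reversepath valid_path_imp_path)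

lemma cycle_integral_eq_cycle_index:
  assumes "is_cycle V \<Gamma>" "z \<notin> cycle_image \<Gamma>"
  shows "cycle_integral \<Gamma> (\<lambda>w. 1 / (w - z)) = 2 * pi * \<i> * cycle_index \<Gamma> z"
proof -
  have "contour_integral g (\<lambda>w. 1 / (w - z)) = 2 * pi * \<i> * winding_number g z" if "g \<in> set \<Gamma>" for g
    using winding_number_valid_path[of g z] is_cycleD(1)[OF assms(1) that] assms(2) that
    by (auto simp: cycle_image_def)
  then have "cycle_integral \<Gamma> (\<lambda>w. 1 / (w - z)) = (\<Sum>g\<leftarrow>\<Gamma>. 2 * pi * \<i> * winding_number g z)"
    unfolding cycle_integral_def by (intro arg_cong[of _ _ sum_list] map_cong) auto
  then show ?thesis by (simp add: cycle_index_def sum_list_const_mult)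
qed

lemma cycle_index_locally_constant:
  assumes "is_cycle V \<Gamma>" "z \<notin> cycle_image \<Gamma>"
  obtains r where "r > 0" "ball z r \<inter> cycle_image \<Gamma> = {}" "\<And>w. w \<in> ball z r \<Longrightarrow> cycle_index \<Gamma> w = cycle_index \<Gamma> z"
proof -
  have "open (- cycle_image \<Gamma>)"
    using compact_cycle_image[OF assms(1)] compact_imp_closed by blast
  then obtain r where r: "r > 0" "ball z r \<subseteq> - cycle_image \<Gamma>" using assms(2) by (meson ComplI openE)
  have "cycle_index \<Gamma> w = cycle_index \<Gamma> z" if w: "w \<in> ball z r" for w
    unfolding cycle_index_def
  proof (intro arg_cong[of _ _ sum_list] map_cong refl)
    fix g assume g: "g \<in> set \<Gamma>"
    have "winding_number g constant_on ball z r"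
      by (rule winding_number_constant)
         (use is_cycleD[OF assms(1) g] path_image_subset_cycle_image[OF g] r(2) in auto)
    then show "winding_number g w = winding_number g z"
      using w r(1) unfolding constant_on_def by (metis centre_in_ball)
  qed
  then show ?thesis using r that by blast
qed

lemma open_cycle_index_eq:
  assumes "is_cycle V \<Gamma>"
  shows "open {z. z \<notin> cycle_image \<Gamma> \<and> cycle_index \<Gamma> z = n}"
  unfolding open_contains_ball
proof
  fix z assume "z \<in> {z. z \<notin> cycle_image \<Gamma> \<and> cycle_index \<Gamma> z = n}"
  then have z: "z \<notin> cycle_image \<Gamma>" "cycle_index \<Gamma> z = n" by auto
  obtain r where "r > 0" "ball z r \<inter> cycle_image \<Gamma> = {}" "\<And>w. w \<in> ball z r \<Longrightarrow> cycle_index \<Gamma> w = cycle_index \<Gamma> z"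
    by (rule cycle_index_locally_constant[OF assms z(1)]) blast
  then have "ball z r \<subseteq> {z. z \<notin> cycle_image \<Gamma> \<and> cycle_index \<Gamma> z = n}"
    using z(2) by blast
  then show "\<exists>r>0. ball z r \<subseteq> {z. z \<notin> cycle_image \<Gamma> \<and> cycle_index \<Gamma> z = n}"
    using \<open>r > 0\<close> by blast
qed

definition cycle_inside :: "(real \<Rightarrow> complex) list \<Rightarrow> complex set" where
  "cycle_inside \<Gamma> = {z. z \<notin> cycle_image \<Gamma> \<and> cycle_index \<Gamma> z = 1}"

definition cycle_hull :: "(real \<Rightarrow> complex) list \<Rightarrow> complex set" where
  "cycle_hull \<Gamma> = cycle_image \<Gamma> \<union> {z. cycle_index \<Gamma> z \<noteq> 0}"

lemma open_cycle_inside: "is_cycle V \<Gamma> \<Longrightarrow> open (cycle_inside \<Gamma>)"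
  unfolding cycle_inside_def by (rule open_cycle_index_eq)

lemma compact_cycle_hull:
  assumes "is_cycle V \<Gamma>"
  shows "compact (cycle_hull \<Gamma>)"
proof -
  obtain B where B: "cycle_image \<Gamma> \<subseteq> ball 0 B"
    using compact_imp_bounded[OF compact_cycle_image[OF assms]] by (metis bounded_subset_ballD)
  have "z \<notin> cycle_hull \<Gamma>" if z: "z \<notin> ball 0 B" for z
  proof -
    have "winding_number g z = 0" if "g \<in> set \<Gamma>" for g
      by (rule winding_number_zero_outside[of g "ball 0 B"])
         (use is_cycleD[OF assms that] path_image_subset_cycle_image[OF that] B z in auto)
    then have "cycle_index \<Gamma> z = 0"
      unfolding cycle_index_def by (simp cong: map_cong)
    then show ?thesis using z B by (auto simp: cycle_hull_def)
  qed
  then have "bounded (cycle_hull \<Gamma>)" by (meson bounded_ball bounded_subset subsetI)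
  moreover have "- cycle_hull \<Gamma> = {z. z \<notin> cycle_image \<Gamma> \<and> cycle_index \<Gamma> z = 0}"
    by (auto simp: cycle_hull_def)
  ultimately show ?thesis
    using open_cycle_index_eq[OF assms, of 0] by (simp add: compact_eq_bounded_closed closed_def)
qed

section \<open>Cycles of polynomial paths\<close>

text \<open>A valid path may have an unbounded derivative, so continuity of the integrand does not make it
  integrable along the path. It does along polynomial paths, which approximate all others.\<close>

definition polynomial_paths :: "(real \<Rightarrow> complex) list \<Rightarrow> bool" where
  "polynomial_paths \<Gamma> \<longleftrightarrow> (\<forall>g\<in>set \<Gamma>. polynomial_function g)"

lemma polynomial_path_approx:
  assumes V: "open V" and g: "valid_path g" "path_image g \<subseteq> V"
  obtains p where "polynomial_function p" "pathstart p = pathstart g" "pathfinish p = pathfinish g"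
    "path_image p \<subseteq> V"
    "\<And>F. F holomorphic_on V \<Longrightarrow> contour_integral p F = contour_integral g F"
proof -
  have path: "path g" using g(1) by (rule valid_path_imp_path)
  obtain d where d: "d > 0" "\<And>g' p. valid_path g' \<Longrightarrow> valid_path p \<Longrightarrow>
      \<forall>t\<in>{0..1}. norm (g' t - g t) < d \<and> norm (p t - g t) < d \<Longrightarrow>
      pathstart p = pathstart g' \<Longrightarrow> pathfinish p = pathfinish g' \<Longrightarrow>
      path_image p \<subseteq> V \<and> (\<forall>F. F holomorphic_on V \<longrightarrow> contour_integral p F = contour_integral g' F)"
    using contour_integral_nearby_ends[OF V path g(2)] by metis
  obtain p where p: "polynomial_function p" "pathstart p = pathstart g" "pathfinish p = pathfinish g"
      "\<And>t. t \<in> {0..1} \<Longrightarrow> norm (p t - g t) < d"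
    using path_approx_polynomial_function[OF path d(1)] by metis
  show ?thesis
    using d(2)[OF g(1) valid_path_polynomial_function[OF p(1)]] d(1) p by (intro that[of p]) auto
qed

lemma polynomial_cycle_approx:
  assumes V: "open V" and \<Gamma>: "is_cycle V \<Gamma>"
  obtains \<Delta> where "polynomial_paths \<Delta>" "is_cycle V \<Delta>"
    "\<And>F. F holomorphic_on V \<Longrightarrow> cycle_integral \<Delta> F = cycle_integral \<Gamma> F"
    "\<And>z. z \<notin> V \<Longrightarrow> cycle_index \<Delta> z = cycle_index \<Gamma> z"
proof -
  have "\<exists>p. g \<in> set \<Gamma> \<longrightarrow> polynomial_function p \<and> pathfinish p = pathstart p \<and> path_image p \<subseteq> V \<and>
      (\<forall>F. F holomorphic_on V \<longrightarrow> contour_integral p F = contour_integral g F)" for g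
    using polynomial_path_approx[OF V, of g] is_cycleD[OF \<Gamma>, of g] by metis
  then obtain p where p: "\<And>g. g \<in> set \<Gamma> \<Longrightarrow> polynomial_function (p g) \<and> pathfinish (p g) = pathstart (p g) \<and>
      path_image (p g) \<subseteq> V \<and> (\<forall>F. F holomorphic_on V \<longrightarrow> contour_integral (p g) F = contour_integral g F)"
    by metis
  define \<Delta> where "\<Delta> = map p \<Gamma>"
  have poly: "polynomial_paths \<Delta>" using p by (auto simp: polynomial_paths_def \<Delta>_def)
  have cycle: "is_cycle V \<Delta>" using p by (auto simp: is_cycle_def valid_path_polynomial_function \<Delta>_def)
  have integral: "cycle_integral \<Delta> F = cycle_integral \<Gamma> F" if "F holomorphic_on V" for F
    unfolding cycle_integral_def \<Delta>_def map_map
    by (intro arg_cong[of _ _ sum_list] map_cong) (use p that in auto)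
  have "cycle_index \<Delta> z = cycle_index \<Gamma> z" if z: "z \<notin> V" for z
  proof -
    have "z \<notin> cycle_image \<Gamma>" "z \<notin> cycle_image \<Delta>"
      using cycle_image_subset[OF cycle] cycle_image_subset[OF \<Gamma>] z by auto
    moreover have "(\<lambda>w. 1 / (w - z)) holomorphic_on V" using z by (auto intro!: holomorphic_intros)
    ultimately show ?thesis
      using integral cycle_integral_eq_cycle_index[OF cycle, of z] cycle_integral_eq_cycle_index[OF \<Gamma>, of z]
      by simp
  qed
  then show ?thesis using poly cycle integral by (intro that)
qed

lemma continuous_vector_derivative_polynomial:
  fixes g :: "real \<Rightarrow> complex"
  assumes "polynomial_function g"
  shows "continuous_on A (\<lambda>t. vector_derivative g (at t))"
proof -
  obtain g' where g': "polynomial_function g'" "\<And>x. (g has_vector_derivative g' x) (at x)"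
    using has_vector_derivative_polynomial_function[OF assms] by metis
  then have "(\<lambda>t. vector_derivative g (at t)) = g'" by (auto simp: vector_derivative_at)
  then show ?thesis using g'(1) continuous_on_polymonial_function by auto
qed

lemma contour_integrable_polynomial:
  assumes g: "polynomial_function g" and f: "continuous_on (path_image g) f"
  shows "f contour_integrable_on g"
proof -
  have "continuous_on {0..1} (\<lambda>t. f (g t))"
    by (rule continuous_on_compose2[OF f]) (use g in \<open>auto simp: path_image_def continuous_on_polymonial_function\<close>)
  then have "continuous_on {0..1} (\<lambda>t. f (g t) * vector_derivative g (at t))"
    by (intro continuous_on_mult continuous_vector_derivative_polynomial g)
  then show ?thesis
    unfolding contour_integrable_on by (rule integrable_continuous_real)
qed

lemma continuous_on_contour_integral_param:
  assumes g: "polynomial_function g" and h: "continuous_on (S \<times> path_image g) (\<lambda>(z, w). h z w)"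
  shows "continuous_on S (\<lambda>z. contour_integral g (h z))"
proof -
  have "continuous_on (S \<times> {0..1}) (\<lambda>x. (\<lambda>(z, w). h z w) (fst x, g (snd x)))"
    by (rule continuous_on_compose2[OF h])
       (auto simp: path_image_def
          intro!: continuous_intros continuous_on_compose2[OF continuous_on_polymonial_function[OF g, of UNIV]])
  then have "continuous_on (S \<times> {0..1}) (\<lambda>x. h (fst x) (g (snd x)) * vector_derivative g (at (snd x)))"
    by (intro continuous_on_mult continuous_on_compose2[OF continuous_vector_derivative_polynomial[OF g, of UNIV]])
       (auto intro!: continuous_intros)
  then have "continuous_on S (\<lambda>z. integral (cbox 0 1) (\<lambda>t. h z (g t) * vector_derivative g (at t)))"
    by (intro integral_continuous_on_param) (simp add: case_prod_unfold)
  then show ?thesis by (simp add: contour_integral_integral)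
qed

lemma contour_integral_cycle_integral:
  assumes g: "polynomial_function g" and \<Delta>: "polynomial_paths \<Delta>"
    and h: "continuous_on (path_image g \<times> cycle_image \<Delta>) (\<lambda>(w, z). h w z)"
  shows "contour_integral g (\<lambda>w. cycle_integral \<Delta> (h w)) =
    (\<Sum>j<length \<Delta>. contour_integral g (\<lambda>w. contour_integral (\<Delta> ! j) (h w)))"
  unfolding cycle_integral_eq_sum
proof (rule contour_integral_sum)
  fix j assume "j \<in> {..<length \<Delta>}"
  then have j: "\<Delta> ! j \<in> set \<Delta>" by simp
  have "continuous_on (path_image g) (\<lambda>w. contour_integral (\<Delta> ! j) (h w))"
  proof (rule continuous_on_contour_integral_param)
    show "polynomial_function (\<Delta> ! j)" using \<Delta> j by (simp add: polynomial_paths_def)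
    show "continuous_on (path_image g \<times> path_image (\<Delta> ! j)) (\<lambda>(w, z). h w z)"
      by (rule continuous_on_subset[OF h]) (use path_image_subset_cycle_image[OF j] in auto)
  qed
  then show "(\<lambda>w. contour_integral (\<Delta> ! j) (h w)) contour_integrable_on g"
    by (rule contour_integrable_polynomial[OF g])
qed simp

lemma cycle_integral_swap:
  assumes \<Gamma>: "polynomial_paths \<Gamma>" and \<Delta>: "polynomial_paths \<Delta>"
    and h: "continuous_on (cycle_image \<Gamma> \<times> cycle_image \<Delta>) (\<lambda>(w, z). h w z)"
  shows "cycle_integral \<Gamma> (\<lambda>w. cycle_integral \<Delta> (h w)) = cycle_integral \<Delta> (\<lambda>z. cycle_integral \<Gamma> (\<lambda>w. h w z))"
proof -
  have \<Gamma>_nth: "polynomial_function (\<Gamma> ! i)" "path_image (\<Gamma> ! i) \<subseteq> cycle_image \<Gamma>" if "i \<in> {..<length \<Gamma>}" for i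
    using that \<Gamma> path_image_subset_cycle_image[of "\<Gamma> ! i" \<Gamma>] by (simp_all add: polynomial_paths_def)
  have \<Delta>_nth: "polynomial_function (\<Delta> ! j)" "path_image (\<Delta> ! j) \<subseteq> cycle_image \<Delta>" if "j \<in> {..<length \<Delta>}" for j
    using that \<Delta> path_image_subset_cycle_image[of "\<Delta> ! j" \<Delta>] by (simp_all add: polynomial_paths_def)
  have h': "continuous_on (cycle_image \<Delta> \<times> cycle_image \<Gamma>) (\<lambda>(z, w). h w z)"
    using continuous_on_swap_args[OF h] by simp
  have "cycle_integral \<Gamma> (\<lambda>w. cycle_integral \<Delta> (h w)) =
      (\<Sum>i<length \<Gamma>. \<Sum>j<length \<Delta>. contour_integral (\<Gamma> ! i) (\<lambda>w. contour_integral (\<Delta> ! j) (h w)))"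
    unfolding cycle_integral_eq_sum[of \<Gamma>]
    by (intro sum.cong refl contour_integral_cycle_integral continuous_on_subset[OF h]
        Sigma_mono order_refl \<Gamma>_nth \<Delta>)
  also have "\<dots> = (\<Sum>i<length \<Gamma>. \<Sum>j<length \<Delta>. contour_integral (\<Delta> ! j) (\<lambda>z. contour_integral (\<Gamma> ! i) (\<lambda>w. h w z)))"
    by (intro sum.cong refl contour_integral_swap continuous_on_subset[OF h] valid_path_polynomial_function
        continuous_vector_derivative_polynomial Sigma_mono \<Gamma>_nth \<Delta>_nth)
  also have "\<dots> = (\<Sum>j<length \<Delta>. \<Sum>i<length \<Gamma>. contour_integral (\<Delta> ! j) (\<lambda>z. contour_integral (\<Gamma> ! i) (\<lambda>w. h w z)))"
    by (rule sum.swap)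
  also have "\<dots> = cycle_integral \<Delta> (\<lambda>z. cycle_integral \<Gamma> (\<lambda>w. h w z))"
    unfolding cycle_integral_eq_sum[of \<Delta>]
    by (intro sum.cong refl contour_integral_cycle_integral[symmetric] continuous_on_subset[OF h']
        Sigma_mono order_refl \<Gamma> \<Delta>_nth)
  finally show ?thesis .
qed

lemma cycle_integrable_polynomial:
  "polynomial_paths \<Gamma> \<Longrightarrow> continuous_on (cycle_image \<Gamma>) f \<Longrightarrow> cycle_integrable \<Gamma> f"
  unfolding cycle_integrable_def polynomial_paths_def
  by (meson path_image_subset_cycle_image contour_integrable_polynomial continuous_on_subset)

lemma cycle_integral_Cauchy_kernel_swap:
  assumes \<Gamma>: "polynomial_paths \<Gamma>" and \<Delta>: "polynomial_paths \<Delta>" and disjoint: "cycle_image \<Gamma> \<inter> cycle_image \<Delta> = {}"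
    and F: "continuous_on (cycle_image \<Gamma>) F" and G: "continuous_on (cycle_image \<Delta>) G"
  shows "cycle_integral \<Gamma> (\<lambda>w. F w * cycle_integral \<Delta> (\<lambda>z. G z / (w - z))) =
    cycle_integral \<Delta> (\<lambda>z. G z * cycle_integral \<Gamma> (\<lambda>w. F w / (w - z)))"
proof -
  have "continuous_on (cycle_image \<Gamma> \<times> cycle_image \<Delta>) (\<lambda>p. F (fst p) * (G (snd p) / (fst p - snd p)))"
    using disjoint
    by (intro continuous_intros continuous_on_compose2[OF F] continuous_on_compose2[OF G]) auto
  then have kernel: "continuous_on (cycle_image \<Gamma> \<times> cycle_image \<Delta>) (\<lambda>(w, z). F w * (G z / (w - z)))"
    by (simp add: case_prod_unfold)
  have "cycle_integral \<Gamma> (\<lambda>w. F w * cycle_integral \<Delta> (\<lambda>z. G z / (w - z))) =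
      cycle_integral \<Gamma> (\<lambda>w. cycle_integral \<Delta> (\<lambda>z. F w * (G z / (w - z))))"
    using disjoint
    by (intro cycle_integral_cong cycle_integral_lmul[symmetric] cycle_integrable_polynomial[OF \<Delta>]
        continuous_intros G) auto
  also have "\<dots> = cycle_integral \<Delta> (\<lambda>z. cycle_integral \<Gamma> (\<lambda>w. F w * (G z / (w - z))))"
    by (rule cycle_integral_swap[OF \<Gamma> \<Delta> kernel])
  also have "\<dots> = cycle_integral \<Delta> (\<lambda>z. cycle_integral \<Gamma> (\<lambda>w. G z * (F w / (w - z))))"
    by (simp add: mult_ac)
  also have "\<dots> = cycle_integral \<Delta> (\<lambda>z. G z * cycle_integral \<Gamma> (\<lambda>w. F w / (w - z)))"
    using disjoint
    by (intro cycle_integral_cong cycle_integral_lmul cycle_integrable_polynomial[OF \<Gamma>] continuous_intros F) auto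
  finally show ?thesis .
qed

section \<open>Grid cycles\<close>

text \<open>Vertices of the grid are pairs of integers, a cell is named by its lower left corner, and an edge is an
  ordered pair of vertices. Every directed edge belongs to exactly one cell, the one on its left.\<close>

fun cell_edges :: "int \<times> int \<Rightarrow> ((int \<times> int) \<times> (int \<times> int)) set" where
  "cell_edges (i, j) =
    {((i, j), (i + 1, j)), ((i + 1, j), (i + 1, j + 1)), ((i + 1, j + 1), (i, j + 1)), ((i, j + 1), (i, j))}"

definition region_edges :: "(int \<times> int) set \<Rightarrow> ((int \<times> int) \<times> (int \<times> int)) set" where
  "region_edges S = (\<Union>q\<in>S. cell_edges q)"

definition boundary_edges :: "(int \<times> int) set \<Rightarrow> ((int \<times> int) \<times> (int \<times> int)) set" where
  "boundary_edges S = {e \<in> region_edges S. prod.swap e \<notin> region_edges S}"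

lemma finite_cell_edges: "finite (cell_edges q)"
  by (cases q) simp

lemma cell_edges_disjoint: "q \<noteq> q' \<Longrightarrow> cell_edges q \<inter> cell_edges q' = {}"
  by (cases q; cases q') auto

lemma swap_cell_edge:
  assumes "e \<in> cell_edges q"
  obtains q' where "prod.swap e \<in> cell_edges q'"
proof -
  obtain i j where q: "q = (i, j)" by (cases q)
  have "prod.swap e \<in> cell_edges (i, j - 1) \<union> cell_edges (i + 1, j) \<union> cell_edges (i, j + 1) \<union>
      cell_edges (i - 1, j)"
    using assms by (auto simp: q)
  then show ?thesis using that by blast
qed

lemma finite_region_edges: "finite S \<Longrightarrow> finite (region_edges S)"
  by (simp add: region_edges_def finite_cell_edges)

lemma finite_boundary_edges: "finite S \<Longrightarrow> finite (boundary_edges S)"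
  by (simp add: boundary_edges_def finite_region_edges)

lemma sum_boundary_edges:
  fixes G :: "(int \<times> int) \<times> (int \<times> int) \<Rightarrow> 'b::real_vector"
  assumes S: "finite S" and antisymmetric: "\<And>e. G (prod.swap e) = - G e"
  shows "(\<Sum>e\<in>boundary_edges S. G e) = (\<Sum>q\<in>S. \<Sum>e\<in>cell_edges q. G e)"
proof -
  define I where "I = region_edges S - boundary_edges S"
  have "(\<Sum>e\<in>I. G e) = (\<Sum>e\<in>I. G (prod.swap e))"
    by (rule sum.reindex_bij_witness[of _ prod.swap prod.swap]) (auto simp: I_def boundary_edges_def)
  then have "(\<Sum>e\<in>I. G e) = - (\<Sum>e\<in>I. G e)"
    by (simp add: antisymmetric sum_negf)
  then have "2 *\<^sub>R (\<Sum>e\<in>I. G e) = 0"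
    unfolding scaleR_2 by (metis add.right_inverse)
  then have "(\<Sum>e\<in>boundary_edges S. G e) = (\<Sum>e\<in>region_edges S. G e)"
    using sum.subset_diff[of "boundary_edges S" "region_edges S" G] finite_region_edges[OF S]
    by (auto simp: I_def boundary_edges_def)
  also have "\<dots> = (\<Sum>q\<in>S. \<Sum>e\<in>cell_edges q. G e)"
    unfolding region_edges_def
    by (rule sum.UNION_disjoint) (use S finite_cell_edges cell_edges_disjoint in auto)
  finally show ?thesis .
qed

lemma sum_cell_edges_coboundary:
  fixes c :: "int \<times> int \<Rightarrow> 'b::ab_group_add"
  shows "(\<Sum>e\<in>cell_edges q. c (fst e) - c (snd e)) = 0"
  by (cases q) simp

definition grid_point :: "real \<Rightarrow> int \<times> int \<Rightarrow> complex" where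
  "grid_point d v = Complex (d * fst v) (d * snd v)"

definition grid_edge :: "real \<Rightarrow> (int \<times> int) \<times> (int \<times> int) \<Rightarrow> real \<Rightarrow> complex" where
  "grid_edge d e = linepath (grid_point d (fst e)) (grid_point d (snd e))"

definition grid_cell :: "real \<Rightarrow> int \<times> int \<Rightarrow> complex set" where
  "grid_cell d q = cbox (grid_point d q) (grid_point d (q + (1, 1)))"

definition open_grid_cell :: "real \<Rightarrow> int \<times> int \<Rightarrow> complex set" where
  "open_grid_cell d q = box (grid_point d q) (grid_point d (q + (1, 1)))"

definition cell_boundary :: "real \<Rightarrow> int \<times> int \<Rightarrow> real \<Rightarrow> complex" where
  "cell_boundary d q = rectpath (grid_point d q) (grid_point d (q + (1, 1)))"

definition grid_cover :: "real \<Rightarrow> complex set \<Rightarrow> (int \<times> int) set" where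
  "grid_cover d K = {q. grid_cell d q \<inter> K \<noteq> {}}"

lemma mem_grid_cell:
  "z \<in> grid_cell d q \<longleftrightarrow> d * fst q \<le> Re z \<and> Re z \<le> d * (fst q + 1) \<and> d * snd q \<le> Im z \<and> Im z \<le> d * (snd q + 1)"
  by (auto simp: grid_cell_def grid_point_def in_cbox_complex_iff)

lemma mem_open_grid_cell:
  "z \<in> open_grid_cell d q \<longleftrightarrow> d * fst q < Re z \<and> Re z < d * (fst q + 1) \<and> d * snd q < Im z \<and> Im z < d * (snd q + 1)"
  by (auto simp: open_grid_cell_def grid_point_def in_box_complex_iff)

lemma grid_cells_cover:
  assumes "d > 0"
  obtains q where "z \<in> grid_cell d q"
proof
  show "z \<in> grid_cell d (\<lfloor>Re z / d\<rfloor>, \<lfloor>Im z / d\<rfloor>)"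
    using floor_divide_lower[OF assms] floor_divide_upper[OF assms]
    by (simp add: mem_grid_cell less_imp_le mult.commute)
qed

lemma closure_open_grid_cell:
  assumes "d > 0"
  shows "closure (open_grid_cell d q) = grid_cell d q"
proof -
  have "grid_point d q + Complex (d / 2) (d / 2) \<in> open_grid_cell d q"
    using assms by (simp add: mem_open_grid_cell grid_point_def field_simps)
  then show ?thesis
    unfolding open_grid_cell_def grid_cell_def by (intro closure_box) blast
qed

lemma open_grid_cell_disjoint:
  assumes "d > 0" "z \<in> open_grid_cell d q" "z \<in> grid_cell d q'"
  shows "q' = q"
proof -
  have "m = k" if "d * k < x" "x < d * (k + 1)" "d * m \<le> x" "x \<le> d * (m + 1)" for k m :: int and x
  proof -
    have "d * m < d * (k + 1)" "d * k < d * (m + 1)" using that by linarith+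
    then have "real_of_int m < k + 1" "real_of_int k < m + 1" using assms(1) by simp_all
    then show ?thesis by linarith
  qed
  from this[of "fst q" "Re z" "fst q'"] this[of "snd q" "Im z" "snd q'"] show ?thesis
    using assms(2,3) by (simp add: mem_open_grid_cell mem_grid_cell prod_eq_iff)
qed

lemma dist_grid_cell:
  assumes "z \<in> grid_cell d q" "w \<in> grid_cell d q"
  shows "dist z w \<le> 2 * d"
proof -
  have "\<bar>Re (z - w)\<bar> \<le> d" "\<bar>Im (z - w)\<bar> \<le> d"
    using assms by (auto simp: mem_grid_cell algebra_simps)
  then show ?thesis
    using cmod_le[of "z - w"] by (simp add: dist_norm)
qed

lemma finite_grid_cover:
  assumes "bounded K" "d > 0"
  shows "finite (grid_cover d K)"
proof -
  obtain B where B: "\<And>z. z \<in> K \<Longrightarrow> cmod z \<le> B"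
    using assms(1) by (auto simp: bounded_iff)
  define N where "N = \<lceil>B / d\<rceil> + 1"
  have bound: "m \<in> {- N..N}" if "d * m \<le> x" "x \<le> d * (m + 1)" "\<bar>x\<bar> \<le> B" for m :: int and x
  proof -
    have "m \<le> x / d" "x / d \<le> m + 1" "- (B / d) \<le> x / d" "x / d \<le> B / d"
      using that assms(2) by (auto simp: field_simps)
    then show ?thesis unfolding N_def atLeastAtMost_iff by linarith
  qed
  have "grid_cover d K \<subseteq> {- N..N} \<times> {- N..N}"
  proof
    fix q assume "q \<in> grid_cover d K"
    then obtain z where z: "z \<in> grid_cell d q" "z \<in> K" by (auto simp: grid_cover_def)
    have "\<bar>Re z\<bar> \<le> B" "\<bar>Im z\<bar> \<le> B"
      using B[OF z(2)] abs_Re_le_cmod[of z] abs_Im_le_cmod[of z] by auto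
    then show "q \<in> {- N..N} \<times> {- N..N}"
      using bound[of "fst q" "Re z"] bound[of "snd q" "Im z"] z(1) by (simp add: mem_grid_cell mem_Times_iff)
  qed
  then show ?thesis by (rule finite_subset) simp
qed

lemma path_image_cell_boundary:
  "path_image (cell_boundary d q) = (\<Union>e\<in>cell_edges q. path_image (grid_edge d e))"
  by (cases q)
     (simp add: cell_boundary_def rectpath_def Let_def grid_edge_def grid_point_def path_image_join Un_ac)

lemma path_image_cell_boundary_subset: "d > 0 \<Longrightarrow> path_image (cell_boundary d q) \<subseteq> grid_cell d q"
  unfolding cell_boundary_def grid_cell_def
  by (rule path_image_rectpath_subset_cbox) (simp_all add: grid_point_def)

lemma path_image_grid_edge_subset:
  "d > 0 \<Longrightarrow> e \<in> cell_edges q \<Longrightarrow> path_image (grid_edge d e) \<subseteq> grid_cell d q"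
  using path_image_cell_boundary_subset[of d q] by (auto simp: path_image_cell_boundary)

lemma path_image_grid_edge_swap: "path_image (grid_edge d (prod.swap e)) = path_image (grid_edge d e)"
  by (simp add: grid_edge_def closed_segment_commute)

lemma boundary_edge_avoids:
  assumes "d > 0" and e: "e \<in> boundary_edges (grid_cover d K)"
  shows "path_image (grid_edge d e) \<inter> K = {}"
proof (rule ccontr)
  assume "path_image (grid_edge d e) \<inter> K \<noteq> {}"
  moreover obtain q where "prod.swap e \<in> cell_edges q"
    using e swap_cell_edge unfolding boundary_edges_def region_edges_def by blast
  moreover from this have "path_image (grid_edge d e) \<subseteq> grid_cell d q"
    using path_image_grid_edge_subset[OF assms(1)] by (metis path_image_grid_edge_swap)
  ultimately have "prod.swap e \<in> region_edges (grid_cover d K)"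
    unfolding region_edges_def grid_cover_def by blast
  then show False using e by (simp add: boundary_edges_def)
qed

lemma contour_integral_cell_boundary:
  assumes "continuous_on (path_image (cell_boundary d q)) F"
  shows "contour_integral (cell_boundary d q) F = (\<Sum>e\<in>cell_edges q. contour_integral (grid_edge d e) F)"
proof -
  obtain i j where q: "q = (i, j)" by (cases q)
  have "F contour_integrable_on (grid_edge d e)" if "e \<in> cell_edges q" for e
    unfolding grid_edge_def
    by (rule contour_integrable_continuous_linepath, rule continuous_on_subset[OF assms])
       (use that in \<open>auto simp: path_image_cell_boundary grid_edge_def\<close>)
  then have "F contour_integrable_on (grid_edge d ((i, j), (i + 1, j)))"
    "F contour_integrable_on (grid_edge d ((i + 1, j), (i + 1, j + 1)))"
    "F contour_integrable_on (grid_edge d ((i + 1, j + 1), (i, j + 1)))"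
    "F contour_integrable_on (grid_edge d ((i, j + 1), (i, j)))"
    by (simp_all add: q)
  moreover have "cell_boundary d q =
      grid_edge d ((i, j), (i + 1, j)) +++ grid_edge d ((i + 1, j), (i + 1, j + 1)) +++
      grid_edge d ((i + 1, j + 1), (i, j + 1)) +++ grid_edge d ((i, j + 1), (i, j))"
    by (simp add: cell_boundary_def rectpath_def grid_edge_def grid_point_def q Let_def)
  ultimately show ?thesis
    by (simp add: q grid_edge_def contour_integrable_joinI valid_path_join add.assoc)
qed

lemma winding_number_cell_boundary:
  assumes "d > 0" "z \<in> open_grid_cell d q"
  shows "z \<notin> path_image (cell_boundary d q')"
    "winding_number (cell_boundary d q') z = (if q' = q then 1 else 0)"
proof -
  have le: "Re (grid_point d q') \<le> Re (grid_point d (q' + (1, 1)))"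
    "Im (grid_point d q') \<le> Im (grid_point d (q' + (1, 1)))"
    using assms(1) by (simp_all add: grid_point_def)
  consider "q' = q" | "q' \<noteq> q" "z \<notin> grid_cell d q'"
    using open_grid_cell_disjoint[OF assms] by blast
  then have "z \<notin> path_image (cell_boundary d q') \<and>
      winding_number (cell_boundary d q') z = (if q' = q then 1 else 0)"
  proof cases
    case 1
    then show ?thesis
      using assms(2) path_image_rectpath_inter_box[OF le]
      by (auto simp: cell_boundary_def open_grid_cell_def winding_number_rectpath)
  next
    case 2
    then show ?thesis
      using path_image_cell_boundary_subset[OF assms(1), of q'] winding_number_rectpath_outside[OF le]
      by (auto simp: cell_boundary_def grid_cell_def)
  qed
  then show "z \<notin> path_image (cell_boundary d q')"
    "winding_number (cell_boundary d q') z = (if q' = q then 1 else 0)" by auto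
qed

text \<open>Every boundary edge is closed up to a loop by paths to a base point of its component of \<open>V\<close>. These
  paths contribute a coboundary, which vanishes on every cell.\<close>

definition path_from_root :: "complex set \<Rightarrow> complex \<Rightarrow> real \<Rightarrow> complex" where
  "path_from_root V u = (SOME g. valid_path g \<and> path_image g \<subseteq> V \<and>
    pathstart g = (SOME x. x \<in> connected_component_set V u) \<and> pathfinish g = u)"

lemma path_from_root:
  assumes V: "open V" and u: "u \<in> V"
  shows "valid_path (path_from_root V u)" "path_image (path_from_root V u) \<subseteq> V"
    "pathstart (path_from_root V u) = (SOME x. x \<in> connected_component_set V u)"
    "pathfinish (path_from_root V u) = u"
proof -
  define C where "C = connected_component_set V u"
  have C: "open C" "connected C" "u \<in> C" "C \<subseteq> V"
    by (simp_all add: C_def V u open_connected_component connected_component_subset)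
  moreover have "(SOME x. x \<in> C) \<in> C" using C(3) by (rule someI)
  ultimately obtain g where "polynomial_function g" "path_image g \<subseteq> C"
    "pathstart g = (SOME x. x \<in> C)" "pathfinish g = u"
    using connected_open_polynomial_connected by metis
  then have "\<exists>g. valid_path g \<and> path_image g \<subseteq> V \<and> pathstart g = (SOME x. x \<in> C) \<and> pathfinish g = u"
    using C(4) valid_path_polynomial_function by blast
  from someI_ex[OF this]
  show "valid_path (path_from_root V u)" "path_image (path_from_root V u) \<subseteq> V"
    "pathstart (path_from_root V u) = (SOME x. x \<in> connected_component_set V u)"
    "pathfinish (path_from_root V u) = u"
    unfolding path_from_root_def C_def by blast+
qed

definition grid_loop :: "complex set \<Rightarrow> real \<Rightarrow> (int \<times> int) \<times> (int \<times> int) \<Rightarrow> real \<Rightarrow> complex" where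
  "grid_loop V d e = path_from_root V (grid_point d (fst e)) +++ grid_edge d e +++
    reversepath (path_from_root V (grid_point d (snd e)))"

lemma grid_edge_endpoints:
  "grid_point d (fst e) \<in> path_image (grid_edge d e)" "grid_point d (snd e) \<in> path_image (grid_edge d e)"
  by (simp_all add: grid_edge_def)

lemma grid_loop:
  assumes V: "open V" and e: "path_image (grid_edge d e) \<subseteq> V"
  shows "valid_path (grid_loop V d e)" "pathfinish (grid_loop V d e) = pathstart (grid_loop V d e)"
    "path_image (grid_loop V d e) = path_image (path_from_root V (grid_point d (fst e))) \<union>
      path_image (grid_edge d e) \<union> path_image (path_from_root V (grid_point d (snd e)))"
    "path_image (grid_loop V d e) \<subseteq> V"
proof -
  have ends: "grid_point d (fst e) \<in> V" "grid_point d (snd e) \<in> V"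
    using e grid_edge_endpoints by blast+
  have "connected_component V (grid_point d (fst e)) (grid_point d (snd e))"
    by (rule connected_componentI[OF _ e]) (simp_all add: grid_edge_def connected_path_image)
  then have same_root: "connected_component_set V (grid_point d (fst e)) =
      connected_component_set V (grid_point d (snd e))"
    by (intro connected_component_eq[symmetric]) simp
  note root = path_from_root[OF V ends(1)] path_from_root[OF V ends(2)]
  show "valid_path (grid_loop V d e)" "pathfinish (grid_loop V d e) = pathstart (grid_loop V d e)"
    using root same_root by (simp_all add: grid_loop_def grid_edge_def valid_path_join)
  show image: "path_image (grid_loop V d e) = path_image (path_from_root V (grid_point d (fst e))) \<union>
      path_image (grid_edge d e) \<union> path_image (path_from_root V (grid_point d (snd e)))"
    using root by (auto simp: grid_loop_def grid_edge_def path_image_join)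
  show "path_image (grid_loop V d e) \<subseteq> V"
    unfolding image using root e by blast
qed

lemma contour_integral_grid_loop:
  assumes V: "open V" "path_image (grid_edge d e) \<subseteq> V"
    and A: "open A" "F holomorphic_on A" "path_image (grid_loop V d e) \<subseteq> A"
  shows "contour_integral (grid_loop V d e) F = contour_integral (grid_edge d e) F +
    (contour_integral (path_from_root V (grid_point d (fst e))) F -
     contour_integral (path_from_root V (grid_point d (snd e))) F)"
proof -
  define a b where "a = path_from_root V (grid_point d (fst e))" and "b = path_from_root V (grid_point d (snd e))"
  have ends: "grid_point d (fst e) \<in> V" "grid_point d (snd e) \<in> V"
    using V(2) grid_edge_endpoints by blast+
  have path: "valid_path a" "valid_path b" "valid_path (grid_edge d e)"
    "pathfinish a = pathstart (grid_edge d e)" "pathfinish b = pathfinish (grid_edge d e)"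
    using path_from_root[OF V(1) ends(1)] path_from_root[OF V(1) ends(2)]
    by (simp_all add: a_def b_def grid_edge_def)
  have integrable: "F contour_integrable_on a" "F contour_integrable_on b" "F contour_integrable_on grid_edge d e"
    using A(3) path(1,2,3) unfolding grid_loop(3)[OF V] a_def b_def
    by (auto intro!: contour_integrable_holomorphic_simple[OF A(2,1)])
  have "contour_integral (grid_loop V d e) F =
      contour_integral a F + (contour_integral (grid_edge d e) F - contour_integral b F)"
    using path integrable unfolding grid_loop_def a_def[symmetric] b_def[symmetric]
    by (simp add: contour_integrable_joinI contour_integrable_reversepath_eq valid_path_join
        contour_integral_reversepath)
  then show ?thesis by (simp add: a_def b_def)
qed

lemma sum_contour_integral_grid_loops:
  assumes "finite S" and V: "open V" "\<And>e. e \<in> boundary_edges S \<Longrightarrow> path_image (grid_edge d e) \<subseteq> V"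
    and A: "open A" "F holomorphic_on A" "\<And>q. q \<in> S \<Longrightarrow> path_image (cell_boundary d q) \<subseteq> A"
    "\<And>e. e \<in> boundary_edges S \<Longrightarrow> path_image (grid_loop V d e) \<subseteq> A"
  shows "(\<Sum>e\<in>boundary_edges S. contour_integral (grid_loop V d e) F) =
    (\<Sum>q\<in>S. contour_integral (cell_boundary d q) F)"
proof -
  define c where "c v = contour_integral (path_from_root V (grid_point d v)) F" for v
  define G where "G e = contour_integral (grid_edge d e) F + (c (fst e) - c (snd e))" for e
  have "(\<Sum>e\<in>boundary_edges S. contour_integral (grid_loop V d e) F) = (\<Sum>e\<in>boundary_edges S. G e)"
    using contour_integral_grid_loop[OF V(1) V(2) A(1,2) A(4)] by (simp add: G_def c_def)
  also have "\<dots> = (\<Sum>q\<in>S. \<Sum>e\<in>cell_edges q. G e)"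
  proof (rule sum_boundary_edges[OF \<open>finite S\<close>])
    show "G (prod.swap e) = - G e" for e
      using contour_integral_reversepath[of "grid_edge d e" F]
      by (simp add: G_def grid_edge_def reversepath_linepath)
  qed
  also have "\<dots> = (\<Sum>q\<in>S. contour_integral (cell_boundary d q) F)"
  proof (rule sum.cong)
    fix q assume "q \<in> S"
    then have "contour_integral (cell_boundary d q) F = (\<Sum>e\<in>cell_edges q. contour_integral (grid_edge d e) F)"
      by (intro contour_integral_cell_boundary
          continuous_on_subset[OF holomorphic_on_imp_continuous_on[OF A(2)] A(3)])
    then show "(\<Sum>e\<in>cell_edges q. G e) = contour_integral (cell_boundary d q) F"
      using sum_cell_edges_coboundary[of c q] by (simp add: G_def sum.distrib)
  qed simp
  finally show ?thesis .
qed

lemma contour_integral_cell_boundary_eq_0: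
  assumes "d > 0" "F holomorphic_on grid_cell d q"
  shows "contour_integral (cell_boundary d q) F = 0"
proof (rule contour_integral_unique, rule Cauchy_theorem_convex_simple[OF assms(2)])
  show "path_image (cell_boundary d q) \<subseteq> grid_cell d q"
    by (rule path_image_cell_boundary_subset[OF assms(1)])
qed (simp_all add: cell_boundary_def grid_cell_def)

locale grid_neighbourhood =
  fixes K W :: "complex set" and d :: real
  assumes compact: "compact K" and nbhd: "open W" and pos: "d > 0"
    and cell_subset: "q \<in> grid_cover d K \<Longrightarrow> grid_cell d q \<subseteq> W"
begin

definition boundary_list :: "((int \<times> int) \<times> (int \<times> int)) list" where
  "boundary_list = (SOME es. set es = boundary_edges (grid_cover d K) \<and> distinct es)"

definition grid_cycle :: "(real \<Rightarrow> complex) list" where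
  "grid_cycle = map (grid_loop (W - K) d) boundary_list"

lemma finite_cover: "finite (grid_cover d K)"
  using compact_imp_bounded[OF compact] pos by (rule finite_grid_cover)

lemma boundary_list: "set boundary_list = boundary_edges (grid_cover d K)" "distinct boundary_list"
  using someI_ex[OF finite_distinct_list[OF finite_boundary_edges[OF finite_cover]]]
  by (simp_all add: boundary_list_def)

lemma open_diff: "open (W - K)"
  using nbhd compact_imp_closed[OF compact] by (rule open_Diff)

lemma boundary_edge_subset:
  assumes "e \<in> boundary_edges (grid_cover d K)"
  shows "path_image (grid_edge d e) \<subseteq> W - K"
proof -
  obtain q where "q \<in> grid_cover d K" "e \<in> cell_edges q"
    using assms by (auto simp: boundary_edges_def region_edges_def)
  then have "path_image (grid_edge d e) \<subseteq> W"
    using path_image_grid_edge_subset[OF pos] cell_subset by blast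
  then show ?thesis
    using boundary_edge_avoids[OF pos assms] by blast
qed

lemma is_cycle_grid_cycle: "is_cycle (W - K) grid_cycle"
  using grid_loop[OF open_diff boundary_edge_subset] by (auto simp: is_cycle_def grid_cycle_def boundary_list(1))

lemma cycle_integral_grid_cycle:
  assumes "open A" "F holomorphic_on A" "cycle_image grid_cycle \<subseteq> A"
    and "\<And>q. q \<in> grid_cover d K \<Longrightarrow> path_image (cell_boundary d q) \<subseteq> A"
  shows "cycle_integral grid_cycle F = (\<Sum>q\<in>grid_cover d K. contour_integral (cell_boundary d q) F)"
proof -
  have "cycle_integral grid_cycle F =
      (\<Sum>e\<in>boundary_edges (grid_cover d K). contour_integral (grid_loop (W - K) d e) F)"
    using boundary_list by (simp add: cycle_integral_def grid_cycle_def sum_list_distinct_conv_sum_set comp_def)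
  also have "\<dots> = (\<Sum>q\<in>grid_cover d K. contour_integral (cell_boundary d q) F)"
    by (rule sum_contour_integral_grid_loops[OF finite_cover open_diff boundary_edge_subset assms(1,2,4)])
       (use assms(3) boundary_list(1) in \<open>auto simp: cycle_image_def grid_cycle_def\<close>)
  finally show ?thesis .
qed

lemma cycle_integral_grid_cycle_eq_0:
  assumes F: "F holomorphic_on W"
  shows "cycle_integral grid_cycle F = 0"
proof -
  have "cycle_image grid_cycle \<subseteq> W"
    using cycle_image_subset[OF is_cycle_grid_cycle] by blast
  then have "cycle_integral grid_cycle F = (\<Sum>q\<in>grid_cover d K. contour_integral (cell_boundary d q) F)"
    using path_image_cell_boundary_subset[OF pos] cell_subset
    by (intro cycle_integral_grid_cycle[OF nbhd F]) blast+
  also have "\<dots> = 0"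
    using contour_integral_cell_boundary_eq_0[OF pos holomorphic_on_subset[OF F cell_subset]] by simp
  finally show ?thesis .
qed

lemma cycle_index_grid_cycle_open_cell:
  assumes q: "q \<in> grid_cover d K" "z \<in> open_grid_cell d q" and z: "z \<notin> cycle_image grid_cycle"
  shows "cycle_index grid_cycle z = 1"
proof -
  note boundary = winding_number_cell_boundary[OF pos q(2)]
  have "2 * pi * \<i> * cycle_index grid_cycle z = cycle_integral grid_cycle (\<lambda>w. 1 / (w - z))"
    by (rule cycle_integral_eq_cycle_index[OF is_cycle_grid_cycle z, symmetric])
  also have "\<dots> = (\<Sum>q'\<in>grid_cover d K. contour_integral (cell_boundary d q') (\<lambda>w. 1 / (w - z)))"
    by (rule cycle_integral_grid_cycle[of "- {z}"]) (use boundary(1) z in \<open>auto intro!: holomorphic_intros\<close>)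
  also have "\<dots> = (\<Sum>q'\<in>grid_cover d K. 2 * pi * \<i> * (if q' = q then 1 else 0))"
  proof (rule sum.cong)
    fix q'
    have "valid_path (cell_boundary d q')" by (simp add: cell_boundary_def)
    then show "contour_integral (cell_boundary d q') (\<lambda>w. 1 / (w - z)) = 2 * pi * \<i> * (if q' = q then 1 else 0)"
      using winding_number_valid_path[of "cell_boundary d q'" z] boundary[of q'] by (simp split: if_splits)
  qed simp
  also have "\<dots> = 2 * pi * \<i>"
    using finite_cover q(1) by (simp add: sum_distrib_left[symmetric])
  finally show ?thesis by simp
qed

lemma subset_cycle_inside_grid_cycle: "K \<subseteq> cycle_inside grid_cycle"
proof
  fix z assume "z \<in> K"
  then have z: "z \<notin> cycle_image grid_cycle"
    using cycle_image_subset[OF is_cycle_grid_cycle] by blast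
  obtain r where r: "r > 0" "ball z r \<inter> cycle_image grid_cycle = {}"
    "\<And>w. w \<in> ball z r \<Longrightarrow> cycle_index grid_cycle w = cycle_index grid_cycle z"
    by (rule cycle_index_locally_constant[OF is_cycle_grid_cycle z]) blast
  obtain q where q: "z \<in> grid_cell d q" by (rule grid_cells_cover[OF pos])
  then obtain w where w: "w \<in> open_grid_cell d q" "w \<in> ball z r"
    using r(1) unfolding closure_open_grid_cell[OF pos, symmetric] closure_approachable
    by (metis dist_commute mem_ball)
  have "q \<in> grid_cover d K" using q \<open>z \<in> K\<close> by (auto simp: grid_cover_def)
  then have "cycle_index grid_cycle w = 1"
    using w r(2) by (intro cycle_index_grid_cycle_open_cell) auto
  then show "z \<in> cycle_inside grid_cycle"
    using r(3)[OF w(2)] z by (simp add: cycle_inside_def)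
qed

end

lemma null_cycle_around_compact:
  assumes K: "compact K" and W: "open W" and KW: "K \<subseteq> W"
  obtains \<Gamma> where "is_cycle (W - K) \<Gamma>" "\<And>F. F holomorphic_on W \<Longrightarrow> cycle_integral \<Gamma> F = 0"
    "K \<subseteq> cycle_inside \<Gamma>"
proof -
  obtain r where r: "r > 0" "(\<Union>z\<in>K. ball z r) \<subseteq> W"
    using compact_subset_open_imp_ball_epsilon_subset[OF K W KW] by metis
  have "w \<in> W" if q: "q \<in> grid_cover (r / 3) K" and w: "w \<in> grid_cell (r / 3) q" for q w
  proof -
    obtain z where z: "z \<in> grid_cell (r / 3) q" "z \<in> K" using q unfolding grid_cover_def by blast
    then have "w \<in> ball z r" using dist_grid_cell[OF z(1) w] r(1) by simp
    then show ?thesis using r(2) z(2) by blast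
  qed
  then interpret grid_neighbourhood K W "r / 3"
    using K W r(1) by unfold_locales auto
  show ?thesis
    using is_cycle_grid_cycle cycle_integral_grid_cycle_eq_0 subset_cycle_inside_grid_cycle by (rule that)
qed

section \<open>Cauchy's theorem for cycles\<close>

lemma polynomial_null_cycle_around_compact:
  assumes K: "compact K" and W: "open W" and KW: "K \<subseteq> W"
  obtains \<Gamma> where "polynomial_paths \<Gamma>" "is_cycle (W - K) \<Gamma>" "K \<subseteq> cycle_inside \<Gamma>"
    "\<And>F. F holomorphic_on W \<Longrightarrow> cycle_integral \<Gamma> F = 0"
proof -
  obtain \<Delta> where \<Delta>: "is_cycle (W - K) \<Delta>" "\<And>F. F holomorphic_on W \<Longrightarrow> cycle_integral \<Delta> F = 0"
      "K \<subseteq> cycle_inside \<Delta>"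
    using null_cycle_around_compact[OF K W KW] by metis
  have "open (W - K)" using W compact_imp_closed[OF K] by (rule open_Diff)
  then obtain \<Gamma> where \<Gamma>: "polynomial_paths \<Gamma>" "is_cycle (W - K) \<Gamma>"
      "\<And>F. F holomorphic_on (W - K) \<Longrightarrow> cycle_integral \<Gamma> F = cycle_integral \<Delta> F"
      "\<And>z. z \<notin> W - K \<Longrightarrow> cycle_index \<Gamma> z = cycle_index \<Delta> z"
    using polynomial_cycle_approx[OF _ \<Delta>(1)] by metis
  have "cycle_integral \<Gamma> F = 0" if "F holomorphic_on W" for F
    using \<Gamma>(3)[OF holomorphic_on_subset[OF that]] \<Delta>(2)[OF that] by auto
  moreover have "K \<subseteq> cycle_inside \<Gamma>"
    using \<Delta>(3) \<Gamma>(4) cycle_image_subset[OF \<Gamma>(2)] by (auto simp: cycle_inside_def)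
  ultimately show ?thesis using \<Gamma>(1,2) that by blast
qed

lemma Cauchy_integral_formula_null_cycle:
  assumes W: "open W" and cycle: "is_cycle W \<Gamma>" and F: "F holomorphic_on W"
    and null: "\<And>G. G holomorphic_on W \<Longrightarrow> cycle_integral \<Gamma> G = 0"
    and z: "z \<in> W" "z \<notin> cycle_image \<Gamma>"
  shows "cycle_integral \<Gamma> (\<lambda>w. F w / (w - z)) = 2 * pi * \<i> * cycle_index \<Gamma> z * F z"
proof -
  define Q where "Q w = (if w = z then deriv F z else (F w - F z) / (w - z))" for w
  have Q: "Q holomorphic_on W"
    unfolding Q_def by (rule pole_lemma[OF F]) (use z W in \<open>simp add: interior_open\<close>)
  have off_z: "is_cycle (W - {z}) \<Gamma>"
    using is_cycle_cycle_image[OF cycle, of "W - {z}"] cycle_image_subset[OF cycle] z by blast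
  have integrable: "cycle_integrable \<Gamma> (\<lambda>w. 1 / (w - z))" "cycle_integrable \<Gamma> Q"
    using W by (auto intro!: cycle_integrable_holomorphic[OF off_z] holomorphic_intros holomorphic_on_subset[OF Q])
  have "cycle_integral \<Gamma> (\<lambda>w. F w / (w - z)) = cycle_integral \<Gamma> (\<lambda>w. Q w + F z * (1 / (w - z)))"
    by (rule cycle_integral_cong) (use z in \<open>auto simp: Q_def diff_divide_distrib\<close>)
  also have "\<dots> = F z * cycle_integral \<Gamma> (\<lambda>w. 1 / (w - z))"
    using integrable null[OF Q]
    by (simp add: cycle_integral_add cycle_integral_lmul cycle_integrable_lmul del: times_divide_eq_right)
  finally show ?thesis using cycle_integral_eq_cycle_index[OF cycle z(2)] by simp
qed

definition null_homologous :: "complex set \<Rightarrow> (real \<Rightarrow> complex) list \<Rightarrow> bool" where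
  "null_homologous W \<Gamma> \<longleftrightarrow> is_cycle W \<Gamma> \<and> (\<forall>z. z \<notin> W \<longrightarrow> cycle_index \<Gamma> z = 0)"

text \<open>The hull of the cycle is a compact subset of \<open>W\<close>. Represent \<open>F\<close> on it by Cauchy's formula over a grid
  cycle around it and change the order of integration.\<close>

lemma Cauchy_theorem_polynomial_cycle:
  assumes W: "open W" and poly: "polynomial_paths \<Gamma>" and null: "null_homologous W \<Gamma>" and F: "F holomorphic_on W"
  shows "cycle_integral \<Gamma> F = 0"
proof -
  have cycle: "is_cycle W \<Gamma>" using null by (simp add: null_homologous_def)
  have hull: "cycle_hull \<Gamma> \<subseteq> W"
    using null cycle_image_subset[OF cycle] by (auto simp: cycle_hull_def null_homologous_def)
  obtain \<Delta> where \<Delta>: "polynomial_paths \<Delta>" "is_cycle (W - cycle_hull \<Gamma>) \<Delta>" "cycle_hull \<Gamma> \<subseteq> cycle_inside \<Delta>"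
      "\<And>F. F holomorphic_on W \<Longrightarrow> cycle_integral \<Delta> F = 0"
    using polynomial_null_cycle_around_compact[OF compact_cycle_hull[OF cycle] W hull] by metis
  have \<Delta>_cycle: "is_cycle W \<Delta>" using \<Delta>(2) by (rule is_cycle_mono) auto
  have \<Delta>_image: "cycle_image \<Delta> \<subseteq> W" "cycle_image \<Delta> \<inter> cycle_hull \<Gamma> = {}"
    using cycle_image_subset[OF \<Delta>(2)] by auto
  have formula: "2 * pi * \<i> * F z = cycle_integral \<Delta> (\<lambda>w. - F w / (z - w))" if "z \<in> cycle_image \<Gamma>" for z
  proof -
    have "z \<in> W" "z \<notin> cycle_image \<Delta>" "cycle_index \<Delta> z = 1"
      using that hull \<Delta>(3) by (auto simp: cycle_hull_def cycle_inside_def)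
    then have "2 * pi * \<i> * F z = cycle_integral \<Delta> (\<lambda>w. F w / (w - z))"
      using Cauchy_integral_formula_null_cycle[OF W \<Delta>_cycle F \<Delta>(4)] by simp
    also have "\<dots> = cycle_integral \<Delta> (\<lambda>w. - F w / (z - w))"
      by (metis minus_diff_eq minus_divide_divide)
    finally show ?thesis .
  qed
  have "2 * pi * \<i> * cycle_integral \<Gamma> F = cycle_integral \<Gamma> (\<lambda>z. 2 * pi * \<i> * F z)"
    by (rule cycle_integral_lmul[symmetric], rule cycle_integrable_holomorphic[OF cycle W F])
  also have "\<dots> = cycle_integral \<Gamma> (\<lambda>z. 1 * cycle_integral \<Delta> (\<lambda>w. - F w / (z - w)))"
    by (rule cycle_integral_cong) (simp only: formula mult_1)
  also have "\<dots> = cycle_integral \<Delta> (\<lambda>w. - F w * cycle_integral \<Gamma> (\<lambda>z. 1 / (z - w)))"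
    using \<Delta>_image holomorphic_on_imp_continuous_on[OF F]
    by (intro cycle_integral_Cauchy_kernel_swap[OF poly \<Delta>(1)])
       (auto simp: cycle_hull_def intro!: continuous_on_minus intro: continuous_on_subset)
  also have "\<dots> = cycle_integral \<Delta> (\<lambda>w. 0)"
    using \<Delta>_image(2) cycle_integral_eq_cycle_index[OF cycle]
    by (intro cycle_integral_cong) (auto simp: cycle_hull_def)
  finally show ?thesis by (simp add: cycle_integral_zero)
qed

theorem Cauchy_theorem_cycle:
  assumes W: "open W" and null: "null_homologous W \<Gamma>" and F: "F holomorphic_on W"
  shows "cycle_integral \<Gamma> F = 0"
proof -
  have "is_cycle W \<Gamma>" using null by (simp add: null_homologous_def)
  then obtain \<Delta> where \<Delta>: "polynomial_paths \<Delta>" "is_cycle W \<Delta>"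
      "\<And>F. F holomorphic_on W \<Longrightarrow> cycle_integral \<Delta> F = cycle_integral \<Gamma> F"
      "\<And>z. z \<notin> W \<Longrightarrow> cycle_index \<Delta> z = cycle_index \<Gamma> z"
    using polynomial_cycle_approx[OF W] by metis
  then have "null_homologous W \<Delta>" using null by (simp add: null_homologous_def)
  then show ?thesis using Cauchy_theorem_polynomial_cycle[OF W \<Delta>(1) _ F] \<Delta>(3)[OF F] by simp
qed

theorem Cauchy_integral_formula_cycle:
  assumes W: "open W" and null: "null_homologous W \<Gamma>" and F: "F holomorphic_on W"
    and z: "z \<in> W" "z \<notin> cycle_image \<Gamma>"
  shows "cycle_integral \<Gamma> (\<lambda>w. F w / (w - z)) = 2 * pi * \<i> * cycle_index \<Gamma> z * F z"
  using null by (intro Cauchy_integral_formula_null_cycle[OF W _ F _ z] Cauchy_theorem_cycle[OF W null])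
    (simp_all add: null_homologous_def)

lemma cycle_integral_Cauchy_transform:
  assumes Om: "open Om" and \<Gamma>: "polynomial_paths \<Gamma>" "null_homologous Om \<Gamma>" and F: "F holomorphic_on Om"
    and \<Delta>: "polynomial_paths \<Delta>" "cycle_image \<Delta> \<subseteq> Om \<inter> cycle_inside \<Gamma>" and G: "continuous_on (cycle_image \<Delta>) G"
  shows "cycle_integral \<Gamma> (\<lambda>w. F w * cycle_integral \<Delta> (\<lambda>z. G z / (w - z))) =
    cycle_integral \<Delta> (\<lambda>z. 2 * pi * \<i> * F z * G z)"
proof -
  have "cycle_image \<Gamma> \<subseteq> Om"
    using \<Gamma>(2) cycle_image_subset by (auto simp: null_homologous_def)
  then have "cycle_integral \<Gamma> (\<lambda>w. F w * cycle_integral \<Delta> (\<lambda>z. G z / (w - z))) =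
      cycle_integral \<Delta> (\<lambda>z. G z * cycle_integral \<Gamma> (\<lambda>w. F w / (w - z)))"
    using \<Delta>(2) holomorphic_on_imp_continuous_on[OF F]
    by (intro cycle_integral_Cauchy_kernel_swap[OF \<Gamma>(1) \<Delta>(1)] G)
       (auto simp: cycle_inside_def intro: continuous_on_subset)
  also have "\<dots> = cycle_integral \<Delta> (\<lambda>z. 2 * pi * \<i> * F z * G z)"
  proof (rule cycle_integral_cong)
    fix z assume "z \<in> cycle_image \<Delta>"
    then have "z \<in> Om" "z \<notin> cycle_image \<Gamma>" "cycle_index \<Gamma> z = 1" using \<Delta>(2) by (auto simp: cycle_inside_def)
    then show "G z * cycle_integral \<Gamma> (\<lambda>w. F w / (w - z)) = 2 * pi * \<i> * F z * G z"
      using Cauchy_integral_formula_cycle[OF Om \<Gamma>(2) F] by simp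
  qed
  finally show ?thesis .
qed

section \<open>Admissible cycles\<close>

lemma admissible_cycle_iff:
  "admissible_cycle Om K \<Gamma> \<longleftrightarrow> null_homologous Om \<Gamma> \<and> K \<subseteq> cycle_inside \<Gamma>"
  by (auto simp: admissible_cycle_def null_homologous_def is_cycle_def cycle_inside_def cycle_index_def
      cycle_image_def)

lemma admissible_cycle_is_cycle: "admissible_cycle Om K \<Gamma> \<Longrightarrow> is_cycle (Om - K) \<Gamma>"
  by (auto simp: admissible_cycle_def is_cycle_def)

lemma admissible_cycle_image: "admissible_cycle Om K \<Gamma> \<Longrightarrow> cycle_image \<Gamma> \<subseteq> Om - K"
  by (rule cycle_image_subset[OF admissible_cycle_is_cycle])

lemma admissible_cycle_null_homologous: "admissible_cycle Om K \<Gamma> \<Longrightarrow> null_homologous Om \<Gamma>"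
  by (simp add: admissible_cycle_iff)

lemma admissible_cycle_mono: "admissible_cycle Om' K \<Gamma> \<Longrightarrow> Om' \<subseteq> Om \<Longrightarrow> admissible_cycle Om K \<Gamma>"
  by (auto simp: admissible_cycle_iff null_homologous_def intro: is_cycle_mono)

lemma polynomial_admissible_cycle:
  assumes "compact K" "open Om" "K \<subseteq> Om"
  obtains \<Gamma> where "polynomial_paths \<Gamma>" "admissible_cycle Om K \<Gamma>"
proof -
  obtain \<Gamma> where \<Gamma>: "polynomial_paths \<Gamma>" "is_cycle (Om - K) \<Gamma>" "K \<subseteq> cycle_inside \<Gamma>"
      "\<And>F. F holomorphic_on Om \<Longrightarrow> cycle_integral \<Gamma> F = 0"
    using polynomial_null_cycle_around_compact[OF assms] by metis
  have "cycle_index \<Gamma> z = 0" if "z \<notin> Om" for z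
  proof -
    have "(\<lambda>w. 1 / (w - z)) holomorphic_on Om" using that by (auto intro!: holomorphic_intros)
    moreover have "z \<notin> cycle_image \<Gamma>" using that cycle_image_subset[OF \<Gamma>(2)] by auto
    ultimately show ?thesis using \<Gamma>(4) cycle_integral_eq_cycle_index[OF \<Gamma>(2)] by fastforce
  qed
  then have "admissible_cycle Om K \<Gamma>"
    using \<Gamma>(2,3) by (auto simp: admissible_cycle_iff null_homologous_def intro: is_cycle_mono)
  then show ?thesis using \<Gamma>(1) that by blast
qed

lemma admissible_cycle_integral_unique:
  assumes Om: "open Om" and K: "closed K" and \<Gamma>: "admissible_cycle Om K \<Gamma>" and \<Delta>: "admissible_cycle Om K \<Delta>"
    and F: "F holomorphic_on (Om - K)"
  shows "cycle_integral \<Gamma> F = cycle_integral \<Delta> F"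
proof -
  note cycle = admissible_cycle_is_cycle[OF \<Gamma>] admissible_cycle_is_cycle[OF \<Delta>]
  have "null_homologous (Om - K) (\<Gamma> @ map reversepath \<Delta>)"
    unfolding null_homologous_def
  proof (intro conjI allI impI)
    show "is_cycle (Om - K) (\<Gamma> @ map reversepath \<Delta>)"
      using cycle by (simp add: is_cycle_append is_cycle_reverse)
    fix z assume z: "z \<notin> Om - K"
    then have "z \<notin> cycle_image \<Delta>" using admissible_cycle_image[OF \<Delta>] by auto
    then have "cycle_index (\<Gamma> @ map reversepath \<Delta>) z = cycle_index \<Gamma> z - cycle_index \<Delta> z"
      by (simp add: cycle_index_append cycle_index_reverse[OF cycle(2)])
    also have "\<dots> = 0"
      using z \<Gamma> \<Delta> by (auto simp: admissible_cycle_iff null_homologous_def cycle_inside_def subset_iff)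
    finally show "cycle_index (\<Gamma> @ map reversepath \<Delta>) z = 0" .
  qed
  then have "cycle_integral (\<Gamma> @ map reversepath \<Delta>) F = 0"
    using F Om K by (intro Cauchy_theorem_cycle[of "Om - K"] open_Diff)
  then show ?thesis by (simp add: cycle_integral_append cycle_integral_reverse[OF cycle(2)])
qed

section \<open>Contour integrals of vector-valued functions\<close>

definition vcontour_integrable :: "(real \<Rightarrow> complex) \<Rightarrow> (complex \<Rightarrow> 'a::complex_banach) \<Rightarrow> bool" where
  "vcontour_integrable g F \<longleftrightarrow>
    (\<lambda>t. cscale (vector_derivative g (at t within {0..1})) (F (g t))) integrable_on {0..1}"

definition vcontour_integral :: "(real \<Rightarrow> complex) \<Rightarrow> (complex \<Rightarrow> 'a::complex_banach) \<Rightarrow> 'a" where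
  "vcontour_integral g F = integral {0..1} (\<lambda>t. cscale (vector_derivative g (at t within {0..1})) (F (g t)))"

definition vcycle_integral :: "(real \<Rightarrow> complex) list \<Rightarrow> (complex \<Rightarrow> 'a::complex_banach) \<Rightarrow> 'a" where
  "vcycle_integral \<Gamma> F = (\<Sum>g\<leftarrow>\<Gamma>. vcontour_integral g F)"

text \<open>Continuity would follow from the other condition by the uniform boundedness principle.\<close>

definition weakly_holomorphic :: "complex set \<Rightarrow> (complex \<Rightarrow> 'a::complex_banach) \<Rightarrow> bool" where
  "weakly_holomorphic A F \<longleftrightarrow> continuous_on A F \<and>
    (\<forall>\<phi> :: 'a \<Rightarrow> complex. bounded_clinear \<phi> \<longrightarrow> (\<lambda>w. \<phi> (F w)) holomorphic_on A)"

lemma weakly_holomorphic_subset: "weakly_holomorphic A F \<Longrightarrow> B \<subseteq> A \<Longrightarrow> weakly_holomorphic B F"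
  unfolding weakly_holomorphic_def by (meson continuous_on_subset holomorphic_on_subset)

lemma weakly_holomorphic_cscale:
  assumes f: "f holomorphic_on A" and F: "weakly_holomorphic A F"
  shows "weakly_holomorphic A (\<lambda>w. cscale (f w) (F w))"
  unfolding weakly_holomorphic_def
proof (intro conjI allI impI)
  show "continuous_on A (\<lambda>w. cscale (f w) (F w))"
    using holomorphic_on_imp_continuous_on[OF f] F
    by (auto simp: weakly_holomorphic_def intro: cscale.continuous_on)
  fix \<phi> :: "'a \<Rightarrow> complex" assume \<phi>: "bounded_clinear \<phi>"
  then show "(\<lambda>w. \<phi> (cscale (f w) (F w))) holomorphic_on A"
    using f F by (auto simp: bounded_clinear.cscale[OF \<phi>] weakly_holomorphic_def intro: holomorphic_on_mult)
qed

lemma functional_vcontour_integral: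
  fixes \<phi> :: "'a::complex_banach \<Rightarrow> complex"
  assumes F: "vcontour_integrable g F" and \<phi>: "bounded_clinear \<phi>"
  shows "\<phi> (vcontour_integral g F) = contour_integral g (\<lambda>w. \<phi> (F w))"
proof -
  interpret \<phi>: bounded_clinear \<phi> by (rule \<phi>)
  have "(\<phi> \<circ> (\<lambda>t. cscale (vector_derivative g (at t within {0..1})) (F (g t)))
      has_integral \<phi> (vcontour_integral g F)) {0..1}"
    using integrable_integral[OF F[unfolded vcontour_integrable_def]] \<phi>.bounded_linear_axioms
    unfolding vcontour_integral_def by (rule has_integral_linear)
  then have "((\<lambda>w. \<phi> (F w)) has_contour_integral \<phi> (vcontour_integral g F)) g"
    by (simp add: has_contour_integral_def o_def \<phi>.cscale mult.commute)
  then show ?thesis by (rule contour_integral_unique[symmetric])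
qed

lemma vcontour_integrable_linepath:
  assumes F: "continuous_on (closed_segment a b) F"
  shows "vcontour_integrable (linepath a b) F"
proof -
  have "continuous_on {0..1} (\<lambda>t. F (linepath a b t))"
    by (rule continuous_on_compose2[OF F]) (auto simp: path_image_def simp flip: path_image_linepath)
  then have "(\<lambda>t. cscale (b - a) (F (linepath a b t))) integrable_on {0..1}"
    by (intro integrable_continuous_real cscale.continuous_on continuous_on_const)
  then show ?thesis
    unfolding vcontour_integrable_def
    by (rule integrable_eq) (simp add: vector_derivative_linepath_within)
qed

lemma vcontour_integral_linepath:
  "vcontour_integral (linepath a b) F = integral {0..1} (\<lambda>t. cscale (b - a) (F (linepath a b t)))"
  unfolding vcontour_integral_def by (rule integral_cong) (simp add: vector_derivative_linepath_within)

lemma norm_vcontour_integral_linepath_diff_le: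
  assumes F: "continuous_on (closed_segment a b) F"
    and bound: "\<And>w. w \<in> closed_segment a b \<Longrightarrow> norm (F w - F a) \<le> e"
  shows "norm (vcontour_integral (linepath a b) F - cscale (b - a) (F a)) \<le> e * norm (b - a)"
proof -
  have segment: "linepath a b t \<in> closed_segment a b" if "t \<in> {0..1}" for t
    using that by (metis image_eqI path_image_def path_image_linepath)
  have "continuous_on {0..1} (\<lambda>t. F (linepath a b t))"
    by (rule continuous_on_compose2[OF F]) (auto intro: segment)
  then have cont: "continuous_on {0..1} (\<lambda>t. cscale (b - a) (F (linepath a b t)))"
    by (intro cscale.continuous_on continuous_on_const)
  have "vcontour_integral (linepath a b) F - cscale (b - a) (F a) =
      integral {0..1} (\<lambda>t. cscale (b - a) (F (linepath a b t))) - integral {0..1} (\<lambda>t::real. cscale (b - a) (F a))"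
    by (simp add: vcontour_integral_linepath)
  also have "\<dots> = integral {0..1} (\<lambda>t. cscale (b - a) (F (linepath a b t)) - cscale (b - a) (F a))"
    by (rule integral_diff[symmetric]) (intro integrable_continuous_real cont continuous_on_const)+
  also have "norm \<dots> \<le> e * norm (b - a) * (1 - 0)"
  proof (rule integral_bound)
    fix t :: real assume "t \<in> {0..1}"
    then show "norm (cscale (b - a) (F (linepath a b t)) - cscale (b - a) (F a)) \<le> e * norm (b - a)"
      using mult_right_mono[OF bound[OF segment] norm_ge_zero[of "b - a"]]
      by (simp add: norm_cscale mult.commute flip: cscale.diff_right)
  qed (auto intro: cont continuous_on_diff)
  finally show ?thesis by simp
qed

lemma vcontour_integral_triangle:
  fixes F :: "complex \<Rightarrow> 'a::complex_banach"
  assumes A: "convex A" and F: "weakly_holomorphic A F" and points: "a \<in> A" "b \<in> A" "c \<in> A"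
  shows "vcontour_integral (linepath a c) F - vcontour_integral (linepath a b) F =
    vcontour_integral (linepath b c) F"
proof (rule functionals_separate_points)
  fix \<phi> :: "'a \<Rightarrow> complex" assume \<phi>: "bounded_clinear \<phi>"
  then interpret \<phi>: bounded_clinear \<phi> .
  have F\<phi>: "(\<lambda>w. \<phi> (F w)) holomorphic_on A" using F \<phi> by (simp add: weakly_holomorphic_def)
  have integrable: "vcontour_integrable (linepath u v) F" "(\<lambda>w. \<phi> (F w)) contour_integrable_on linepath u v"
    if "u \<in> A" "v \<in> A" for u v
  proof -
    have "closed_segment u v \<subseteq> A" using that A by (simp add: closed_segment_subset)
    then show "vcontour_integrable (linepath u v) F" "(\<lambda>w. \<phi> (F w)) contour_integrable_on linepath u v"
      using F holomorphic_on_imp_continuous_on[OF F\<phi>]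
      by (auto intro!: vcontour_integrable_linepath contour_integrable_continuous_linepath
          intro: continuous_on_subset simp: weakly_holomorphic_def)
  qed
  have "convex hull {a, b, c} \<subseteq> A" by (rule hull_minimal) (use A points in auto)
  then have "contour_integral (linepath a b +++ linepath b c +++ linepath c a) (\<lambda>w. \<phi> (F w)) = 0"
    by (intro contour_integral_unique Cauchy_theorem_triangle holomorphic_on_subset[OF F\<phi>])
  then have "contour_integral (linepath a b) (\<lambda>w. \<phi> (F w)) + (contour_integral (linepath b c) (\<lambda>w. \<phi> (F w)) +
      contour_integral (linepath c a) (\<lambda>w. \<phi> (F w))) = 0"
    using integrable(2) points by (simp add: contour_integrable_joinI)
  moreover have "contour_integral (linepath c a) (\<lambda>w. \<phi> (F w)) = - contour_integral (linepath a c) (\<lambda>w. \<phi> (F w))"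
    using contour_integral_reversepath[of "linepath a c"] by (simp add: reversepath_linepath)
  ultimately show "\<phi> (vcontour_integral (linepath a c) F - vcontour_integral (linepath a b) F) =
      \<phi> (vcontour_integral (linepath b c) F)"
    using points by (simp add: \<phi>.diff functional_vcontour_integral[OF integrable(1) \<phi>] algebra_simps)
qed

lemma weakly_holomorphic_primitive:
  fixes F :: "complex \<Rightarrow> 'a::complex_banach"
  assumes A: "open A" "convex A" and F: "weakly_holomorphic A F"
  obtains P where "\<And>z. z \<in> A \<Longrightarrow> (P has_derivative (\<lambda>h. cscale h (F z))) (at z)"
proof (cases "A = {}")
  case False
  then obtain a where a: "a \<in> A" by blast
  define P where "P z = vcontour_integral (linepath a z) F" for z
  have "(P has_derivative (\<lambda>h. cscale h (F z))) (at z)" if z: "z \<in> A" for z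
    unfolding has_derivative_at_alt
  proof (intro conjI allI impI)
    show "bounded_linear (\<lambda>h. cscale h (F z))" by (rule cscale.bounded_linear_left)
    fix e :: real assume e: "e > 0"
    have "isCont F z" using F A(1) z by (simp add: weakly_holomorphic_def continuous_on_eq_continuous_at)
    then obtain d where d: "d > 0" "\<And>w. dist w z < d \<Longrightarrow> dist (F w) (F z) < e"
      using e unfolding continuous_at_eps_delta by metis
    obtain r where r: "r > 0" "ball z r \<subseteq> A" using z A(1) by (meson openE)
    have "norm (P y - P z - cscale (y - z) (F z)) \<le> e * norm (y - z)" if y: "norm (y - z) < min d r" for y
    proof -
      have "y \<in> A" using y r(2) by (auto simp: dist_norm norm_minus_commute)
      then have "P y - P z = vcontour_integral (linepath z y) F"
        unfolding P_def by (rule vcontour_integral_triangle[OF A(2) F a z])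
      moreover have "closed_segment z y \<subseteq> A" using z \<open>y \<in> A\<close> A(2) by (simp add: closed_segment_subset)
      then have "continuous_on (closed_segment z y) F"
        using F continuous_on_subset by (auto simp: weakly_holomorphic_def)
      moreover have "norm (F w - F z) \<le> e" if "w \<in> closed_segment z y" for w
        using d(2)[of w] dist_in_closed_segment[OF that] y by (simp add: dist_norm norm_minus_commute)
      ultimately show ?thesis by (simp add: norm_vcontour_integral_linepath_diff_le)
    qed
    then show "\<exists>d>0. \<forall>y. norm (y - z) < d \<longrightarrow> norm (P y - P z - cscale (y - z) (F z)) \<le> e * norm (y - z)"
      using d(1) r(1) by (intro exI[of _ "min d r"]) auto
  qed
  then show ?thesis by (rule that)
qed (use that in auto)

lemma has_integral_primitive_along_path:
  fixes F P :: "complex \<Rightarrow> 'a::complex_banach"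
  assumes g: "valid_path g" and uv: "u \<le> v" "{u..v} \<subseteq> {0..1}"
    and P: "\<And>t. t \<in> {u..v} \<Longrightarrow> (P has_derivative (\<lambda>h. cscale h (F (g t)))) (at (g t))"
  shows "((\<lambda>t. cscale (vector_derivative g (at t within {0..1})) (F (g t))) has_integral P (g v) - P (g u)) {u..v}"
proof -
  obtain S where S: "finite S" "g C1_differentiable_on ({0..1} - S)" and cont_g: "continuous_on {0..1} g"
    using g by (auto simp: valid_path_def piecewise_C1_differentiable_on_def)
  show ?thesis
  proof (rule fundamental_theorem_of_calculus_interior_strong[OF S(1) uv(1)])
    have "continuous_on (g ` {u..v}) P"
      using P has_derivative_continuous by (blast intro: continuous_at_imp_continuous_on)
    then show "continuous_on {u..v} (\<lambda>t. P (g t))"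
      by (rule continuous_on_compose2[OF _ continuous_on_subset[OF cont_g uv(2)]]) simp
    fix t assume t: "t \<in> {u<..<v} - S"
    have "u \<in> {0..1}" "v \<in> {0..1}" using uv by auto
    then have t01: "t \<in> {0..1} - S" "0 < t" "t < 1" using t by auto
    then have deriv_g: "(g has_vector_derivative vector_derivative g (at t)) (at t)"
      using S(2) by (simp add: C1_differentiable_on_eq vector_derivative_works)
    then have "vector_derivative g (at t within {0..1}) = vector_derivative g (at t)"
      using vector_derivative_at_within_ivl t01 by fastforce
    then have "(g has_derivative (\<lambda>h. h *\<^sub>R vector_derivative g (at t within {0..1}))) (at t)"
      using deriv_g by (simp add: has_vector_derivative_def)
    then have "((\<lambda>t. P (g t)) has_derivative
        (\<lambda>h. cscale (h *\<^sub>R vector_derivative g (at t within {0..1})) (F (g t)))) (at t)"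
      by (rule has_derivative_compose) (use P t in auto)
    then show "((\<lambda>t. P (g t)) has_vector_derivative
        cscale (vector_derivative g (at t within {0..1})) (F (g t))) (at t)"
      by (simp add: has_vector_derivative_def cscale.scaleR_left)
  qed
qed

lemma vcontour_integrable_weakly_holomorphic:
  fixes F :: "complex \<Rightarrow> 'a::complex_banach"
  assumes V: "open V" and F: "weakly_holomorphic V F" and g: "valid_path g" "path_image g \<subseteq> V"
  shows "vcontour_integrable g F"
proof -
  let ?f = "\<lambda>t. cscale (vector_derivative g (at t within {0..1})) (F (g t))"
  have cont_g: "continuous_on {0..1} g" using valid_path_imp_path[OF g(1)] by (simp add: path_def)
  have "?f integrable_on cbox 0 1"
  proof (rule integrable_on_little_subintervals, rule ballI)
    fix s :: real assume s: "s \<in> cbox 0 1"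
    then have "g s \<in> V" using g(2) by (auto simp: path_image_def)
    then obtain r where r: "r > 0" "ball (g s) r \<subseteq> V" using V by (meson openE)
    obtain P where P: "\<And>z. z \<in> ball (g s) r \<Longrightarrow> (P has_derivative (\<lambda>h. cscale h (F z))) (at z)"
      by (rule weakly_holomorphic_primitive[OF open_ball convex_ball weakly_holomorphic_subset[OF F r(2)]]) blast
    obtain d where d: "d > 0" "\<And>t. t \<in> {0..1} \<Longrightarrow> dist t s < d \<Longrightarrow> dist (g t) (g s) < r"
      using cont_g s r(1) unfolding continuous_on_iff by (metis box_real(2))
    have "?f integrable_on cbox u v" if uv: "s \<in> cbox u v" "cbox u v \<subseteq> ball s d" "cbox u v \<subseteq> cbox 0 1" for u v
    proof -
      have "u \<le> v" "{u..v} \<subseteq> {0..1}" using uv by auto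
      moreover have "g t \<in> ball (g s) r" if "t \<in> {u..v}" for t
        using d(2)[of t] that uv by (auto simp: dist_commute subset_iff)
      ultimately have "(?f has_integral P (g v) - P (g u)) {u..v}"
        by (intro has_integral_primitive_along_path[OF g(1)] P)
      then show ?thesis by (auto simp: integrable_on_def)
    qed
    then show "\<exists>d>0. \<forall>u v. s \<in> cbox u v \<and> cbox u v \<subseteq> ball s d \<and> cbox u v \<subseteq> cbox 0 1 \<longrightarrow> ?f integrable_on cbox u v"
      using d(1) by blast
  qed
  then show ?thesis by (simp add: vcontour_integrable_def)
qed

lemma functional_vcycle_integral:
  fixes \<phi> :: "'a::complex_banach \<Rightarrow> complex"
  assumes "open V" "weakly_holomorphic V F" and \<Gamma>: "is_cycle V \<Gamma>" and \<phi>: "bounded_clinear \<phi>"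
  shows "\<phi> (vcycle_integral \<Gamma> F) = cycle_integral \<Gamma> (\<lambda>w. \<phi> (F w))"
proof -
  interpret \<phi>: bounded_clinear \<phi> by (rule \<phi>)
  have "\<phi> (vcycle_integral \<Gamma> F) = (\<Sum>g\<leftarrow>\<Gamma>. \<phi> (vcontour_integral g F))"
    unfolding vcycle_integral_def by (induction \<Gamma>) (simp_all add: \<phi>.zero \<phi>.add)
  also have "\<dots> = cycle_integral \<Gamma> (\<lambda>w. \<phi> (F w))"
    unfolding cycle_integral_def
    by (intro arg_cong[of _ _ sum_list] map_cong refl functional_vcontour_integral \<phi>
        vcontour_integrable_weakly_holomorphic[OF assms(1,2)] is_cycleD[OF \<Gamma>])
  finally show ?thesis .
qed

lemma norm_integral_unit_interval_le:
  fixes F :: "real \<Rightarrow> 'a::banach"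
  assumes "B \<ge> 0" "\<And>t. t \<in> {0..1} \<Longrightarrow> norm (F t) \<le> B"
  shows "norm (integral {0..1} F) \<le> B"
proof (cases "F integrable_on {0..1}")
  case True
  then show ?thesis
    using has_integral_bound_real[OF assms(1) finite.emptyI integrable_integral[OF True]] assms(2) by simp
next
  case False
  then show ?thesis using assms(1) by (simp add: not_integrable_integral)
qed

lemma polynomial_path_vector_derivative_bounded:
  fixes g :: "real \<Rightarrow> complex"
  assumes g: "polynomial_function g"
  obtains m where "m \<ge> 0" "\<And>t. t \<in> {0..1} \<Longrightarrow> norm (vector_derivative g (at t within {0..1})) \<le> m"
proof -
  obtain g' where g': "polynomial_function g'" "\<And>t. (g has_vector_derivative g' t) (at t)"
    using has_vector_derivative_polynomial_function[OF g] by metis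
  have "bounded (g' ` {0..1})"
    using g'(1) by (intro compact_imp_bounded compact_continuous_image continuous_on_polymonial_function) auto
  then obtain m where m: "\<And>t. t \<in> {0..1} \<Longrightarrow> norm (g' t) \<le> m"
    unfolding bounded_iff by blast
  have "vector_derivative g (at t within {0..1}) = g' t" if "t \<in> {0..1}" for t
    using that g'(2)[of t] by (intro vector_derivative_at_within_ivl) auto
  then show ?thesis
    using m order_trans[OF norm_ge_zero m[of 0]] by (intro that[of m]) auto
qed

lemma norm_vcycle_integral_le:
  assumes "polynomial_paths \<Gamma>"
  obtains L where "L \<ge> 0" "\<And>(F :: complex \<Rightarrow> 'a::complex_banach) B. B \<ge> 0 \<Longrightarrow>
    (\<And>w. w \<in> cycle_image \<Gamma> \<Longrightarrow> norm (F w) \<le> B) \<Longrightarrow> norm (vcycle_integral \<Gamma> F) \<le> L * B"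
proof -
  have "\<exists>m. g \<in> set \<Gamma> \<longrightarrow> m \<ge> 0 \<and> (\<forall>t\<in>{0..1}. norm (vector_derivative g (at t within {0..1})) \<le> m)" for g
    using polynomial_path_vector_derivative_bounded[of g] assms unfolding polynomial_paths_def by metis
  then obtain m where m: "\<And>g. g \<in> set \<Gamma> \<Longrightarrow> m g \<ge> 0"
      "\<And>g t. g \<in> set \<Gamma> \<Longrightarrow> t \<in> {0..1} \<Longrightarrow> norm (vector_derivative g (at t within {0..1})) \<le> m g"
    by metis
  show ?thesis
  proof (rule that[of "\<Sum>g\<leftarrow>\<Gamma>. m g"])
    show "0 \<le> (\<Sum>g\<leftarrow>\<Gamma>. m g)" using m(1) by (intro sum_list_nonneg) auto
    fix F :: "complex \<Rightarrow> 'a" and B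
    assume B: "B \<ge> 0" and F: "\<And>w. w \<in> cycle_image \<Gamma> \<Longrightarrow> norm (F w) \<le> B"
    have path_bound: "norm (vcontour_integral g F) \<le> m g * B" if g: "g \<in> set \<Gamma>" for g
      unfolding vcontour_integral_def
    proof (rule norm_integral_unit_interval_le)
      fix t :: real assume t: "t \<in> {0..1}"
      then have "g t \<in> cycle_image \<Gamma>" using path_image_subset_cycle_image[OF g] by (auto simp: path_image_def)
      then show "norm (cscale (vector_derivative g (at t within {0..1})) (F (g t))) \<le> m g * B"
        unfolding norm_cscale by (intro mult_mono m g t F) auto
    qed (use m(1)[OF g] B in simp)
    have "norm (vcycle_integral \<Gamma> F) \<le> (\<Sum>g\<leftarrow>\<Gamma>. norm (vcontour_integral g F))"
      unfolding vcycle_integral_def by (induction \<Gamma>) (auto intro: norm_triangle_le)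
    also have "\<dots> \<le> (\<Sum>g\<leftarrow>\<Gamma>. m g * B)"
      by (rule sum_list_mono) (rule path_bound)
    finally show "norm (vcycle_integral \<Gamma> F) \<le> (\<Sum>g\<leftarrow>\<Gamma>. m g) * B"
      by (simp add: sum_list_mult_const)
  qed
qed

section \<open>Resolvents\<close>

lemma inverse_id_minus_contraction:
  fixes A :: "'a::complex_banach \<Rightarrow> 'a"
  assumes A: "bounded_clinear A" and q: "0 \<le> q" "q < 1" and bound: "\<And>x. norm (A x) \<le> q * norm x"
  obtains B where "bounded_clinear B" "\<And>x. B x - A (B x) = x" "\<And>x. norm (B x) \<le> 1 / (1 - q) * norm x"
proof -
  interpret A: bounded_clinear A by (rule A)
  have fixpoint: "\<exists>!x. y + A x = x" for y
    by (rule banach_fix_type[OF q]) (simp add: dist_norm bound flip: A.diff)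
  define B where "B y = (THE x. y + A x = x)" for y
  have B: "y + A (B y) = B y" for y
    unfolding B_def by (rule theI'[OF fixpoint])
  have B_eqI: "B y = x" if "y + A x = x" for x y
    using fixpoint[of y] B[of y] that by blast
  have norm_B: "norm (B x) \<le> 1 / (1 - q) * norm x" for x
  proof -
    have "norm (B x) \<le> norm x + q * norm (B x)"
      using norm_triangle_ineq[of x "A (B x)"] bound[of "B x"] B[of x] by simp
    then show ?thesis using q by (simp add: field_simps)
  qed
  have "bounded_clinear B"
  proof (rule bounded_clinearI[OF _ _ norm_B])
    show "B (x + y) = B x + B y" for x y
    proof (rule B_eqI)
      have "(x + y) + A (B x + B y) = (x + A (B x)) + (y + A (B y))" by (simp add: A.add)
      then show "(x + y) + A (B x + B y) = B x + B y" by (simp add: B)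
    qed
    show "B (cscale c x) = cscale c (B x)" for c x
      by (rule B_eqI) (simp add: A.cscale B flip: cscale.add_right)
  qed
  moreover have "B x - A (B x) = x" for x using B[of x] by (metis add_diff_cancel_right')
  ultimately show ?thesis using that norm_B by blast
qed

lemma inverse_of_approximate_inverse:
  fixes A :: "'a::complex_banach \<Rightarrow> 'a"
  assumes A: "bounded_clinear A" and R: "bounded_clinear R" and q: "0 \<le> q" "q < 1" and C: "C \<ge> 0"
    and left: "\<And>x. norm (R (A x) - x) \<le> q * norm x" and right: "\<And>x. norm (A (R x) - x) \<le> q * norm x"
    and norm_R: "\<And>x. norm (R x) \<le> C * norm x"
  obtains S where "bounded_clinear S" "\<And>x. A (S x) = x" "\<And>x. S (A x) = x" "\<And>x. norm (S x) \<le> C / (1 - q) * norm x"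
proof -
  interpret A: bounded_clinear A by (rule A)
  interpret R: bounded_clinear R by (rule R)
  have "bounded_clinear (\<lambda>x. x - A (R x))"
    by (intro bounded_clinear_diff bounded_clinear_ident bounded_clinear_compose[OF A R])
  moreover have "norm (x - A (R x)) \<le> q * norm x" for x
    using right[of x] by (simp add: norm_minus_commute)
  ultimately obtain B where B: "bounded_clinear B" "\<And>x. B x - (B x - A (R (B x))) = x"
      "\<And>x. norm (B x) \<le> 1 / (1 - q) * norm x"
    by (rule inverse_id_minus_contraction[OF _ q]) blast
  have ARB: "A (R (B x)) = x" for x using B(2)[of x] by simp
  have A_inj: "x = 0" if "A x = 0" for x
  proof -
    have "norm x \<le> q * norm x" using left[of x] that R.zero by simp
    then have "(1 - q) * norm x \<le> 0" by (simp add: algebra_simps)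
    then show ?thesis using q by (simp add: mult_le_0_iff)
  qed
  show ?thesis
  proof (rule that[of "\<lambda>x. R (B x)"])
    show "bounded_clinear (\<lambda>x. R (B x))" by (rule bounded_clinear_compose[OF R B(1)])
    show "A (R (B x)) = x" for x by (rule ARB)
    show "R (B (A x)) = x" for x
      using A_inj[of "R (B (A x)) - x"] ARB[of "A x"] by (simp add: A.diff)
    show "norm (R (B x)) \<le> C / (1 - q) * norm x" for x
      using order_trans[OF norm_R mult_left_mono[OF B(3) C], of x] by (simp add: mult.assoc)
  qed
qed

lemma is_resolvent_iff:
  "is_resolvent l T S \<longleftrightarrow> bounded_clinear S \<and> (\<forall>x. cscale l (S x) - T (S x) = x) \<and> (\<forall>x. S (cscale l x - T x) = x)"
  by (simp add: is_resolvent_def bop_iff_bounded_clinear)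

lemma bounded_clinear_cscale_minus: "bounded_clinear T \<Longrightarrow> bounded_clinear (\<lambda>x. cscale l x - T x)"
  by (intro bounded_clinear_diff bounded_clinear_cscale)

lemma resolvent_of_approximate_inverse:
  fixes T :: "'a::complex_banach \<Rightarrow> 'a"
  assumes "bounded_clinear T" "bounded_clinear R" "0 \<le> q" "q < 1" "C \<ge> 0"
    and "\<And>x. norm (R (cscale l x - T x) - x) \<le> q * norm x"
    and "\<And>x. norm (cscale l (R x) - T (R x) - x) \<le> q * norm x"
    and "\<And>x. norm (R x) \<le> C * norm x"
  obtains S where "is_resolvent l T S" "\<And>x. norm (S x) \<le> C / (1 - q) * norm x"
  using inverse_of_approximate_inverse[OF bounded_clinear_cscale_minus[OF assms(1)] assms(2-8)]
  unfolding is_resolvent_iff by metis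

lemma is_resolvent_unique:
  assumes "is_resolvent l T S" "is_resolvent l T S'"
  shows "S = S'"
proof
  fix x
  have "S x = S (cscale l (S' x) - T (S' x))" using assms(2) by (simp add: is_resolvent_def)
  also have "\<dots> = S' x" using assms(1) by (simp add: is_resolvent_def)
  finally show "S x = S' x" .
qed

lemma resolv_eq: "is_resolvent l T S \<Longrightarrow> resolv l T = S"
  unfolding resolv_def by (rule some_equality) (auto intro: is_resolvent_unique)

lemma not_in_sp: "is_resolvent l T S \<Longrightarrow> l \<notin> sp T"
  by (auto simp: sp_def)

lemma is_resolvent_resolv: "l \<notin> sp T \<Longrightarrow> is_resolvent l T (resolv l T)"
  unfolding sp_def resolv_def using someI_ex[of "is_resolvent l T"] by auto

lemma bounded_clinear_resolv: "l \<notin> sp T \<Longrightarrow> bounded_clinear (resolv l T)"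
  using is_resolvent_resolv by (auto simp: is_resolvent_iff)

lemma resolv_right_inverse: "l \<notin> sp T \<Longrightarrow> cscale l (resolv l T x) - T (resolv l T x) = x"
  using is_resolvent_resolv by (auto simp: is_resolvent_iff)

lemma resolv_left_inverse: "l \<notin> sp T \<Longrightarrow> resolv l T (cscale l x - T x) = x"
  using is_resolvent_resolv by (auto simp: is_resolvent_iff)

lemma apply_resolv: "l \<notin> sp T \<Longrightarrow> T (resolv l T x) = cscale l (resolv l T x) - x"
  using resolv_right_inverse[of l T x] by (simp add: algebra_simps)

lemma resolv_apply:
  assumes "l \<notin> sp T"
  shows "resolv l T (T x) = cscale l (resolv l T x) - x"
proof -
  interpret R: bounded_clinear "resolv l T" by (rule bounded_clinear_resolv[OF assms])
  show ?thesis
    using resolv_left_inverse[OF assms, of x] by (simp add: R.diff R.cscale algebra_simps)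
qed

lemma resolvent_identity:
  assumes w: "w \<notin> sp T" and z: "z \<notin> sp T"
  shows "resolv w T x - resolv z T x = cscale (z - w) (resolv w T (resolv z T x))"
proof -
  interpret R: bounded_clinear "resolv w T" by (rule bounded_clinear_resolv[OF w])
  define y where "y = resolv z T x"
  have "y = resolv w T (cscale w y - T y)" by (rule resolv_left_inverse[OF w, symmetric])
  also have "cscale w y - T y = cscale (w - z) y + x"
    by (simp add: y_def apply_resolv[OF z] cscale.diff_left)
  finally have "y = cscale (w - z) (resolv w T y) + resolv w T x"
    by (simp add: R.add R.cscale)
  then show ?thesis
    by (simp add: y_def cscale.diff_left algebra_simps)
qed

definition resolvent_bounded :: "real \<Rightarrow> complex set \<Rightarrow> ('a::complex_banach \<Rightarrow> 'a) \<Rightarrow> bool" where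
  "resolvent_bounded C A T \<longleftrightarrow> (\<forall>l\<in>A. l \<notin> sp T \<and> (\<forall>x. norm (resolv l T x) \<le> C * norm x))"

lemma resolvent_boundedD:
  assumes "resolvent_bounded C A T" "l \<in> A"
  shows "l \<notin> sp T" "norm (resolv l T x) \<le> C * norm x"
  using assms by (auto simp: resolvent_bounded_def)

lemma resolvent_bounded_singletonI:
  "is_resolvent l T S \<Longrightarrow> (\<And>x. norm (S x) \<le> C * norm x) \<Longrightarrow> resolvent_bounded C {l} T"
  by (simp add: resolvent_bounded_def not_in_sp resolv_eq)

lemma resolvent_bounded_subset: "resolvent_bounded C A T \<Longrightarrow> B \<subseteq> A \<Longrightarrow> resolvent_bounded C B T"
  by (auto simp: resolvent_bounded_def)

lemma resolvent_bounded_Un: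
  assumes "resolvent_bounded C A T" "resolvent_bounded D B T"
  shows "resolvent_bounded (max C D) (A \<union> B) T"
proof -
  have "C * norm x \<le> max C D * norm x" "D * norm x \<le> max C D * norm x" for x :: 'a
    by (auto intro: mult_right_mono)
  then show ?thesis
    using assms unfolding resolvent_bounded_def by (meson UnE order_trans)
qed

lemma resolvent_bounded_singleton:
  assumes "l \<notin> sp T"
  obtains C where "C \<ge> 0" "resolvent_bounded C {l} T"
proof -
  obtain C where "C \<ge> 0" "\<And>x. norm (resolv l T x) \<le> norm x * C"
    using bounded_linear.nonneg_bounded[OF bounded_clinear.axioms(1)[OF bounded_clinear_resolv[OF assms]]] by metis
  then show ?thesis
    using assms that[of C] by (simp add: resolvent_bounded_def mult.commute)
qed

lemma resolvent_bounded_outside_cball: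
  fixes T :: "'a::complex_banach \<Rightarrow> 'a"
  assumes T: "bounded_clinear T" and M: "M \<ge> 0" "\<And>x. norm (T x) \<le> M * norm x" and l: "cmod l > M"
  shows "resolvent_bounded (1 / (cmod l - M)) {l} T"
proof -
  interpret T: bounded_clinear T by (rule T)
  have "l \<noteq> 0" using l M by auto
  then have bound: "norm (T x) / cmod l \<le> M / cmod l * norm x" for x
    using divide_right_mono[OF M(2)[of x], of "cmod l"] by simp
  obtain S where "is_resolvent l T S" "\<And>x. norm (S x) \<le> 1 / cmod l / (1 - M / cmod l) * norm x"
  proof (rule resolvent_of_approximate_inverse[of T "cscale (1 / l)" "M / cmod l" "1 / cmod l" l])
    show "norm (cscale (1 / l) (cscale l x - T x) - x) \<le> M / cmod l * norm x" for x
      using \<open>l \<noteq> 0\<close> bound[of x] by (simp add: cscale.diff_right cscale_cscale norm_cscale norm_divide)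
    show "norm (cscale l (cscale (1 / l) x) - T (cscale (1 / l) x) - x) \<le> M / cmod l * norm x" for x
      using \<open>l \<noteq> 0\<close> bound[of x] by (simp add: T.cscale cscale_cscale norm_cscale norm_divide)
  qed (use T l \<open>l \<noteq> 0\<close> M in \<open>auto simp: bounded_clinear_cscale norm_cscale norm_divide\<close>)
  moreover have "1 / cmod l / (1 - M / cmod l) = 1 / (cmod l - M)"
    using l M(1) \<open>l \<noteq> 0\<close> by (simp add: field_simps)
  ultimately show ?thesis by (intro resolvent_bounded_singletonI) auto
qed

lemma resolvent_bounded_ball:
  fixes T :: "'a::complex_banach \<Rightarrow> 'a"
  assumes T: "bounded_clinear T" and C: "C \<ge> 0" and l: "resolvent_bounded C {l} T"
  shows "resolvent_bounded (2 * C) (ball l (1 / (2 * (C + 1)))) T"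
proof -
  note nsp = resolvent_boundedD(1)[OF l singletonI]
  interpret R: bounded_clinear "resolv l T" by (rule bounded_clinear_resolv[OF nsp])
  have "resolvent_bounded (2 * C) {w} T" if w: "w \<in> ball l (1 / (2 * (C + 1)))" for w
  proof -
    have "cmod (w - l) * C \<le> 1 / (2 * (C + 1)) * C"
      using w C by (intro mult_right_mono) (auto simp: dist_norm norm_minus_commute)
    also have "\<dots> \<le> 1 / 2" using C by (simp add: field_simps)
    finally have half: "cmod (w - l) * C \<le> 1 / 2" .
    have bound: "norm (cscale (w - l) (resolv l T x)) \<le> 1 / 2 * norm x" for x
    proof -
      have "cmod (w - l) * norm (resolv l T x) \<le> cmod (w - l) * (C * norm x)"
        by (intro mult_left_mono resolvent_boundedD(2)[OF l singletonI]) auto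
      also have "\<dots> \<le> 1 / 2 * norm x" using mult_right_mono[OF half, of "norm x"] by (simp add: mult.assoc)
      finally show ?thesis by (simp add: norm_cscale)
    qed
    obtain S where "is_resolvent w T S" "\<And>x. norm (S x) \<le> C / (1 - 1 / 2) * norm x"
    proof (rule resolvent_of_approximate_inverse[of T "resolv l T" "1 / 2" C w])
      have "resolv l T (cscale w x - T x) - x = cscale (w - l) (resolv l T x)" for x
        by (simp add: R.diff R.cscale resolv_apply[OF nsp] cscale.diff_left)
      then show "norm (resolv l T (cscale w x - T x) - x) \<le> 1 / 2 * norm x" for x
        using bound[of x] by simp
      have "cscale w (resolv l T x) - T (resolv l T x) - x = cscale (w - l) (resolv l T x)" for x
        by (simp add: apply_resolv[OF nsp] cscale.diff_left)
      then show "norm (cscale w (resolv l T x) - T (resolv l T x) - x) \<le> 1 / 2 * norm x" for x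
        using bound[of x] by simp
    qed (use T R.bounded_clinear_axioms C resolvent_boundedD(2)[OF l] in auto)
    then show ?thesis by (intro resolvent_bounded_singletonI) (auto simp: mult.commute)
  qed
  then show ?thesis by (simp add: resolvent_bounded_def)
qed

lemma norm_le_in_sp:
  fixes T :: "'a::complex_banach \<Rightarrow> 'a"
  assumes T: "bounded_clinear T" and M: "M \<ge> 0" "\<And>x. norm (T x) \<le> M * norm x" and l: "l \<in> sp T"
  shows "cmod l \<le> M"
proof (rule ccontr)
  assume "\<not> cmod l \<le> M"
  then have "resolvent_bounded (1 / (cmod l - M)) {l} T"
    by (intro resolvent_bounded_outside_cball[OF T M]) simp
  then show False using l by (simp add: resolvent_bounded_def)
qed

section \<open>Uniformly bounded resolvents\<close>

definition uniform_resolvent :: "(real \<Rightarrow> 'a::complex_banach \<Rightarrow> 'a) \<Rightarrow> complex set \<Rightarrow> bool" where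
  "uniform_resolvent S A \<longleftrightarrow> (\<exists>C\<ge>0. \<forall>\<^sub>F h in at_right 0. resolvent_bounded C A (S h))"

lemma uniform_resolvent_subset: "uniform_resolvent S A \<Longrightarrow> B \<subseteq> A \<Longrightarrow> uniform_resolvent S B"
  unfolding uniform_resolvent_def by (meson eventually_mono resolvent_bounded_subset)

lemma uniform_resolvent_empty: "uniform_resolvent S {}"
  by (auto simp: uniform_resolvent_def resolvent_bounded_def)

lemma uniform_resolvent_Un:
  assumes "uniform_resolvent S A" "uniform_resolvent S B"
  shows "uniform_resolvent S (A \<union> B)"
proof -
  obtain C D where "C \<ge> 0" and CD: "\<forall>\<^sub>F h in at_right 0. resolvent_bounded C A (S h)"
      "\<forall>\<^sub>F h in at_right 0. resolvent_bounded D B (S h)"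
    using assms unfolding uniform_resolvent_def by blast
  from CD have "\<forall>\<^sub>F h in at_right 0. resolvent_bounded (max C D) (A \<union> B) (S h)"
    by eventually_elim (rule resolvent_bounded_Un)
  then show ?thesis
    using \<open>C \<ge> 0\<close> unfolding uniform_resolvent_def by (intro exI[of _ "max C D"]) auto
qed

lemma uniform_resolvent_ball:
  assumes S: "\<forall>\<^sub>F h in at_right 0. bounded_clinear (S h)" and l: "uniform_resolvent S {l}"
  obtains r where "r > 0" "uniform_resolvent S (ball l r)"
proof -
  obtain C where C: "C \<ge> 0" "\<forall>\<^sub>F h in at_right 0. resolvent_bounded C {l} (S h)"
    using l unfolding uniform_resolvent_def by blast
  from C(2) S have "\<forall>\<^sub>F h in at_right 0. resolvent_bounded (2 * C) (ball l (1 / (2 * (C + 1)))) (S h)"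
    by eventually_elim (rule resolvent_bounded_ball[OF _ C(1)])
  then have "uniform_resolvent S (ball l (1 / (2 * (C + 1))))"
    using C(1) unfolding uniform_resolvent_def by (intro exI[of _ "2 * C"]) auto
  then show ?thesis using C(1) by (intro that[of "1 / (2 * (C + 1))"]) auto
qed

lemma uniform_resolvent_compact:
  assumes S: "\<forall>\<^sub>F h in at_right 0. bounded_clinear (S h)"
    and K: "compact K" "\<And>l. l \<in> K \<Longrightarrow> uniform_resolvent S {l}"
  shows "uniform_resolvent S K"
proof -
  have "\<exists>r>0. uniform_resolvent S (ball l r)" if "l \<in> K" for l
    using uniform_resolvent_ball[OF S K(2)[OF that]] by blast
  then obtain r where r: "\<And>l. l \<in> K \<Longrightarrow> r l > 0" "\<And>l. l \<in> K \<Longrightarrow> uniform_resolvent S (ball l (r l))"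
    by metis
  have cover: "K \<subseteq> (\<Union>l\<in>K. ball l (r l))" using r(1) by force
  obtain D where D: "D \<subseteq> K" "finite D" "K \<subseteq> (\<Union>l\<in>D. ball l (r l))"
    by (rule compactE_image[OF K(1) open_ball cover])
  from D(2,1) have "uniform_resolvent S (\<Union>l\<in>D. ball l (r l))"
    by (induction D rule: finite_induct) (simp_all add: uniform_resolvent_empty uniform_resolvent_Un r(2))
  then show ?thesis using D(3) by (rule uniform_resolvent_subset)
qed

lemma compact_not_uniform_resolvent:
  assumes M: "M \<ge> 0" and S: "\<forall>\<^sub>F h in at_right 0. bounded_clinear (S h) \<and> (\<forall>x. norm (S h x) \<le> M * norm x)"
  shows "compact {l. \<not> uniform_resolvent S {l}}"
proof -
  have "uniform_resolvent S {l}" if l: "cmod l > M" for l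
  proof -
    from S have "\<forall>\<^sub>F h in at_right 0. resolvent_bounded (1 / (cmod l - M)) {l} (S h)"
      by eventually_elim (use M l resolvent_bounded_outside_cball in blast)
    then show ?thesis
      using l unfolding uniform_resolvent_def by (intro exI[of _ "1 / (cmod l - M)"]) auto
  qed
  then have "{l. \<not> uniform_resolvent S {l}} \<subseteq> cball 0 M" by (force simp: not_less)
  then have "bounded {l. \<not> uniform_resolvent S {l}}" by (rule bounded_subset[OF bounded_cball])
  moreover have "open {l. uniform_resolvent S {l}}"
    unfolding open_contains_ball
  proof
    have linear: "\<forall>\<^sub>F h in at_right 0. bounded_clinear (S h)" using S by eventually_elim simp
    fix l assume "l \<in> {l. uniform_resolvent S {l}}"
    then obtain r where r: "r > 0" "uniform_resolvent S (ball l r)"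
      using uniform_resolvent_ball[OF linear] by blast
    have "ball l r \<subseteq> {l. uniform_resolvent S {l}}"
      using uniform_resolvent_subset[OF r(2)] by blast
    then show "\<exists>r>0. ball l r \<subseteq> {l. uniform_resolvent S {l}}" using r(1) by blast
  qed
  moreover have "- {l. uniform_resolvent S {l}} = {l. \<not> uniform_resolvent S {l}}" by blast
  ultimately show ?thesis by (metis closed_Compl compact_eq_bounded_closed)
qed

lemma uniform_resolvent_const: "uniform_resolvent (\<lambda>_. T) {l} \<longleftrightarrow> l \<notin> sp T"
proof
  assume "uniform_resolvent (\<lambda>_. T) {l}"
  then show "l \<notin> sp T" by (auto simp: uniform_resolvent_def resolvent_bounded_def)
next
  assume "l \<notin> sp T"
  then obtain C where "C \<ge> 0" "resolvent_bounded C {l} T" by (rule resolvent_bounded_singleton)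
  then show "uniform_resolvent (\<lambda>_. T) {l}" by (auto simp: uniform_resolvent_def)
qed

lemma compact_sp:
  fixes T :: "'a::complex_banach \<Rightarrow> 'a"
  assumes T: "bounded_clinear T"
  shows "compact (sp T)"
proof -
  obtain M where "M \<ge> 0" "\<And>x. norm (T x) \<le> M * norm x"
    using bounded_linear.nonneg_bounded[OF bounded_clinear.axioms(1)[OF T]] by (metis mult.commute)
  then have "compact {l. \<not> uniform_resolvent (\<lambda>_. T) {l}}"
    by (intro compact_not_uniform_resolvent[of M]) (simp_all add: T)
  then show ?thesis by (simp add: uniform_resolvent_const)
qed

lemma open_resolvent_set: "bounded_clinear T \<Longrightarrow> open (- sp T)"
  by (simp add: compact_sp compact_imp_closed open_Compl)

lemma resolvent_bounded_compact:
  assumes T: "bounded_clinear T" and K: "compact K" "K \<inter> sp T = {}"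
  obtains C where "C \<ge> 0" "resolvent_bounded C K T"
proof -
  have pointwise: "uniform_resolvent (\<lambda>_. T) {l}" if "l \<in> K" for l
    using that K(2) by (auto simp: uniform_resolvent_const)
  have "uniform_resolvent (\<lambda>_. T) K"
    by (rule uniform_resolvent_compact[OF _ K(1) pointwise]) (simp_all add: T)
  then show ?thesis using that by (auto simp: uniform_resolvent_def)
qed

section \<open>Analyticity of the resolvent\<close>

lemma isCont_resolv:
  fixes T :: "'a::complex_banach \<Rightarrow> 'a"
  assumes T: "bounded_clinear T" and l: "l \<notin> sp T"
  shows "isCont (\<lambda>w. resolv w T x) l"
proof -
  obtain C where C: "C \<ge> 0" "resolvent_bounded C {l} T" using resolvent_bounded_singleton[OF l] .
  note ball = resolvent_boundedD[OF resolvent_bounded_ball[OF T C]]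
  have "\<forall>\<^sub>F w in at l. w \<in> ball l (1 / (2 * (C + 1)))"
    using C(1) by (intro eventually_at_in_open') auto
  then have bound: "\<forall>\<^sub>F w in at l. norm (resolv w T x - resolv l T x) \<le>
      cmod (l - w) * (2 * C * norm (resolv l T x))"
  proof eventually_elim
    case (elim w)
    then show ?case
      using ball(2)[OF elim] by (simp add: resolvent_identity[OF ball(1) l] norm_cscale mult_left_mono)
  qed
  have "((\<lambda>w. cmod (l - w) * (2 * C * norm (resolv l T x))) \<longlongrightarrow> cmod (l - l) * (2 * C * norm (resolv l T x))) (at l)"
    by (intro tendsto_intros)
  then have "((\<lambda>w. cmod (l - w) * (2 * C * norm (resolv l T x))) \<longlongrightarrow> 0) (at l)" by simp
  then have "((\<lambda>w. resolv w T x - resolv l T x) \<longlongrightarrow> 0) (at l)" by (rule Lim_null_comparison[OF bound])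
  then show ?thesis unfolding isCont_def by (rule LIM_zero_cancel)
qed

lemma functional_resolv_has_field_derivative:
  fixes T :: "'a::complex_banach \<Rightarrow> 'a"
  assumes T: "bounded_clinear T" and l: "l \<notin> sp T" and \<phi>: "bounded_clinear \<phi>"
  shows "((\<lambda>w. \<phi> (resolv w T x)) has_field_derivative - \<phi> (resolv l T (resolv l T x))) (at l)"
  unfolding has_field_derivative_iff
proof -
  interpret \<phi>: bounded_clinear \<phi> by (rule \<phi>)
  have "\<forall>\<^sub>F w in at l. w \<in> - sp T"
    using open_resolvent_set[OF T] l by (intro eventually_at_in_open') auto
  then have quotient: "\<forall>\<^sub>F w in at l. - \<phi> (resolv w T (resolv l T x)) =
      (\<phi> (resolv w T x) - \<phi> (resolv l T x)) / (w - l)"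
    using eventually_neq_at_within[of l l UNIV]
  proof eventually_elim
    case (elim w)
    have "\<phi> (resolv w T x) - \<phi> (resolv l T x) = (l - w) * \<phi> (resolv w T (resolv l T x))"
      using resolvent_identity[OF _ l, of w x] elim by (simp add: \<phi>.cscale flip: \<phi>.diff)
    then show ?case using elim by (simp add: field_simps)
  qed
  have "((\<lambda>w. - \<phi> (resolv w T (resolv l T x))) \<longlongrightarrow> - \<phi> (resolv l T (resolv l T x))) (at l)"
    using isCont_resolv[OF T l] unfolding isCont_def by (intro tendsto_minus \<phi>.tendsto)
  then show "((\<lambda>w. (\<phi> (resolv w T x) - \<phi> (resolv l T x)) / (w - l)) \<longlongrightarrow> - \<phi> (resolv l T (resolv l T x))) (at l)"
    by (rule tendsto_cong[OF quotient, THEN iffD1])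
qed

lemma weakly_holomorphic_resolv:
  fixes T :: "'a::complex_banach \<Rightarrow> 'a"
  assumes T: "bounded_clinear T"
  shows "weakly_holomorphic (- sp T) (\<lambda>w. resolv w T x)"
  unfolding weakly_holomorphic_def holomorphic_on_open[OF open_resolvent_set[OF T]]
  using isCont_resolv[OF T] functional_resolv_has_field_derivative[OF T]
  by (auto intro!: continuous_at_imp_continuous_on) blast

section \<open>The holomorphic functional calculus\<close>

locale hfc_domain =
  fixes T :: "'a::complex_banach \<Rightarrow> 'a" and Om :: "complex set"
  assumes bounded_clinear: "bounded_clinear T" and open_domain: "open Om" and sp_subset: "sp T \<subseteq> Om"
begin

sublocale bounded_clinear T
  by (rule bounded_clinear)

lemma polynomial_admissible_cycle_exists:
  obtains \<Gamma> where "polynomial_paths \<Gamma>" "admissible_cycle Om (sp T) \<Gamma>"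
  using polynomial_admissible_cycle[OF compact_sp[OF bounded_clinear] open_domain sp_subset] by metis

lemma open_domain_diff_sp: "open (Om - sp T)"
  using open_domain compact_imp_closed[OF compact_sp[OF bounded_clinear]] by (rule open_Diff)

lemma cycle_image_not_in_sp: "admissible_cycle Om (sp T) \<Gamma> \<Longrightarrow> w \<in> cycle_image \<Gamma> \<Longrightarrow> w \<notin> sp T"
  using admissible_cycle_image by blast

lemma weakly_holomorphic_cscale_resolv:
  assumes "f holomorphic_on Om"
  shows "weakly_holomorphic (Om - sp T) (\<lambda>w. cscale (f w) (resolv w T x))"
proof (rule weakly_holomorphic_cscale)
  show "f holomorphic_on Om - sp T" using assms by (rule holomorphic_on_subset) auto
  show "weakly_holomorphic (Om - sp T) (\<lambda>w. resolv w T x)"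
    using weakly_holomorphic_resolv[OF bounded_clinear] by (rule weakly_holomorphic_subset) auto
qed

lemma holomorphic_functional_resolv:
  fixes \<phi> :: "'a \<Rightarrow> complex"
  assumes f: "f holomorphic_on Om" and \<phi>: "bounded_clinear \<phi>"
  shows "(\<lambda>w. f w * \<phi> (resolv w T x)) holomorphic_on (Om - sp T)"
proof -
  have "(\<lambda>w. \<phi> (cscale (f w) (resolv w T x))) holomorphic_on (Om - sp T)"
    using weakly_holomorphic_cscale_resolv[OF f] \<phi> by (simp add: weakly_holomorphic_def)
  then show ?thesis by (simp add: bounded_clinear.cscale[OF \<phi>])
qed

lemma cycle_integrable_functional_resolv:
  fixes \<phi> :: "'a \<Rightarrow> complex"
  assumes "admissible_cycle Om (sp T) \<Gamma>" "f holomorphic_on Om" "bounded_clinear \<phi>"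
  shows "cycle_integrable \<Gamma> (\<lambda>w. f w * \<phi> (resolv w T x))"
  by (rule cycle_integrable_holomorphic[OF admissible_cycle_is_cycle open_domain_diff_sp
     holomorphic_functional_resolv])
     (rule assms)+

lemma functional_vcycle_integral_resolv:
  fixes \<phi> :: "'a \<Rightarrow> complex"
  assumes \<Gamma>: "admissible_cycle Om (sp T) \<Gamma>" and f: "f holomorphic_on Om" and \<phi>: "bounded_clinear \<phi>"
  shows "\<phi> (vcycle_integral \<Gamma> (\<lambda>w. cscale (f w) (resolv w T x))) = cycle_integral \<Gamma> (\<lambda>w. f w * \<phi> (resolv w T x))"
  using functional_vcycle_integral[OF open_domain_diff_sp weakly_holomorphic_cscale_resolv[OF f]
    admissible_cycle_is_cycle[OF \<Gamma>] \<phi>]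
  by (simp add: bounded_clinear.cscale[OF \<phi>])

lemma hfc_eq_vcycle_integral:
  assumes \<Gamma>: "admissible_cycle Om (sp T) \<Gamma>" and f: "f holomorphic_on Om"
  shows "hfc Om f T x = cscale (1 / (2 * of_real pi * \<i>)) (vcycle_integral \<Gamma> (\<lambda>w. cscale (f w) (resolv w T x)))"
proof -
  define \<Delta> where "\<Delta> = (SOME \<Gamma>. admissible_cycle Om (sp T) \<Gamma>)"
  have \<Delta>: "admissible_cycle Om (sp T) \<Delta>"
    unfolding \<Delta>_def by (rule someI[of "admissible_cycle Om (sp T)", OF \<Gamma>])
  have "vcycle_integral \<Delta> (\<lambda>w. cscale (f w) (resolv w T x)) = vcycle_integral \<Gamma> (\<lambda>w. cscale (f w) (resolv w T x))"
  proof (rule functionals_separate_points)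
    fix \<phi> :: "'a \<Rightarrow> complex" assume \<phi>: "bounded_clinear \<phi>"
    have "cycle_integral \<Delta> (\<lambda>w. f w * \<phi> (resolv w T x)) = cycle_integral \<Gamma> (\<lambda>w. f w * \<phi> (resolv w T x))"
      by (rule admissible_cycle_integral_unique[OF open_domain
            compact_imp_closed[OF compact_sp[OF bounded_clinear]] \<Delta> \<Gamma> holomorphic_functional_resolv[OF f \<phi>]])
    then show "\<phi> (vcycle_integral \<Delta> (\<lambda>w. cscale (f w) (resolv w T x))) =
        \<phi> (vcycle_integral \<Gamma> (\<lambda>w. cscale (f w) (resolv w T x)))"
      by (simp only: functional_vcycle_integral_resolv[OF \<Delta> f \<phi>] functional_vcycle_integral_resolv[OF \<Gamma> f \<phi>])
  qed
  then show ?thesis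
    by (simp add: hfc_def Let_def vcycle_integral_def vcontour_integral_def cscale_cscale mult.commute flip: \<Delta>_def)
qed

lemma functional_hfc:
  fixes \<phi> :: "'a \<Rightarrow> complex"
  assumes \<Gamma>: "admissible_cycle Om (sp T) \<Gamma>" and f: "f holomorphic_on Om" and \<phi>: "bounded_clinear \<phi>"
  shows "\<phi> (hfc Om f T x) = 1 / (2 * of_real pi * \<i>) * cycle_integral \<Gamma> (\<lambda>w. f w * \<phi> (resolv w T x))"
  by (simp add: hfc_eq_vcycle_integral[OF \<Gamma> f] bounded_clinear.cscale[OF \<phi>]
      functional_vcycle_integral_resolv[OF \<Gamma> f \<phi>])

lemma hfc_cong:
  assumes f: "f holomorphic_on Om" and eq: "\<And>w. w \<in> Om \<Longrightarrow> f w = g w"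
  shows "hfc Om f T x = hfc Om g T x"
proof (rule functionals_separate_points)
  fix \<phi> :: "'a \<Rightarrow> complex" assume \<phi>: "bounded_clinear \<phi>"
  obtain \<Gamma> where \<Gamma>: "admissible_cycle Om (sp T) \<Gamma>" using polynomial_admissible_cycle_exists .
  have g: "g holomorphic_on Om" using f eq by (rule holomorphic_transform)
  have "cycle_integral \<Gamma> (\<lambda>w. f w * \<phi> (resolv w T x)) = cycle_integral \<Gamma> (\<lambda>w. g w * \<phi> (resolv w T x))"
    by (rule cycle_integral_cong) (use admissible_cycle_image[OF \<Gamma>] eq in auto)
  then show "\<phi> (hfc Om f T x) = \<phi> (hfc Om g T x)"
    by (simp only: functional_hfc[OF \<Gamma> f \<phi>] functional_hfc[OF \<Gamma> g \<phi>])
qed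

lemma hfc_subdomain:
  assumes "open Om'" "Om \<subseteq> Om'" and f: "f holomorphic_on Om'"
  shows "hfc Om f T x = hfc Om' f T x"
proof -
  interpret Om': hfc_domain T Om'
    using assms(1,2) sp_subset by unfold_locales auto
  obtain \<Gamma> where \<Gamma>: "admissible_cycle Om (sp T) \<Gamma>" using polynomial_admissible_cycle_exists .
  show ?thesis
    using hfc_eq_vcycle_integral[OF \<Gamma> holomorphic_on_subset[OF f assms(2)]]
      Om'.hfc_eq_vcycle_integral[OF admissible_cycle_mono[OF \<Gamma> assms(2)] f] by simp
qed

end

lemma norm_hfc_le:
  assumes \<Gamma>: "polynomial_paths \<Gamma>" "is_cycle Om \<Gamma>" and f: "f holomorphic_on Om"
  obtains L where "L \<ge> 0" "\<And>(T :: 'a::complex_banach \<Rightarrow> 'a) C x. hfc_domain T Om \<Longrightarrow> admissible_cycle Om (sp T) \<Gamma> \<Longrightarrow>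
    C \<ge> 0 \<Longrightarrow> resolvent_bounded C (cycle_image \<Gamma>) T \<Longrightarrow> norm (hfc Om f T x) \<le> L * C * norm x"
proof -
  obtain L where L: "L \<ge> 0" "\<And>(F :: complex \<Rightarrow> 'a) B. B \<ge> 0 \<Longrightarrow>
      (\<And>w. w \<in> cycle_image \<Gamma> \<Longrightarrow> norm (F w) \<le> B) \<Longrightarrow> norm (vcycle_integral \<Gamma> F) \<le> L * B"
    using norm_vcycle_integral_le[OF \<Gamma>(1)] by blast
  have "continuous_on (cycle_image \<Gamma>) f"
    using holomorphic_on_imp_continuous_on[OF f] cycle_image_subset[OF \<Gamma>(2)] by (rule continuous_on_subset)
  then have "bounded (f ` cycle_image \<Gamma>)"
    by (intro compact_imp_bounded compact_continuous_image compact_cycle_image[OF \<Gamma>(2)])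
  then obtain m where m: "m > 0" "\<And>w. w \<in> cycle_image \<Gamma> \<Longrightarrow> cmod (f w) \<le> m"
    unfolding bounded_pos by blast
  show ?thesis
  proof (rule that[of "L * m"])
    show "L * m \<ge> 0" using L(1) m(1) by simp
    fix T :: "'a \<Rightarrow> 'a" and C x
    assume T: "hfc_domain T Om" and adm: "admissible_cycle Om (sp T) \<Gamma>" and C: "C \<ge> 0"
      and bound: "resolvent_bounded C (cycle_image \<Gamma>) T"
    define I where "I = vcycle_integral \<Gamma> (\<lambda>w. cscale (f w) (resolv w T x))"
    have "norm I \<le> L * (m * (C * norm x))"
      unfolding I_def
    proof (rule L(2))
      fix w assume w: "w \<in> cycle_image \<Gamma>"
      show "norm (cscale (f w) (resolv w T x)) \<le> m * (C * norm x)"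
        unfolding norm_cscale by (intro mult_mono m(2) resolvent_boundedD(2)[OF bound] w) (use m(1) in auto)
    qed (use m(1) C in simp)
    moreover have "norm (hfc Om f T x) = 1 / (2 * pi) * norm I"
      by (simp add: hfc_domain.hfc_eq_vcycle_integral[OF T adm f] I_def norm_cscale norm_divide norm_mult)
    moreover have "1 / (2 * pi) * norm I \<le> 1 * norm I"
      using pi_gt3 by (intro mult_right_mono) auto
    ultimately show "norm (hfc Om f T x) \<le> L * m * C * norm x"
      by (simp add: mult.assoc)
  qed
qed

context hfc_domain
begin

lemma hfc_add_vector:
  assumes f: "f holomorphic_on Om"
  shows "hfc Om f T (x + y) = hfc Om f T x + hfc Om f T y"
proof (rule functionals_separate_points)
  fix \<phi> :: "'a \<Rightarrow> complex" assume \<phi>: "bounded_clinear \<phi>"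
  then interpret \<phi>: bounded_clinear \<phi> .
  obtain \<Gamma> where \<Gamma>: "admissible_cycle Om (sp T) \<Gamma>" using polynomial_admissible_cycle_exists .
  have "cycle_integral \<Gamma> (\<lambda>w. f w * \<phi> (resolv w T (x + y))) =
      cycle_integral \<Gamma> (\<lambda>w. f w * \<phi> (resolv w T x) + f w * \<phi> (resolv w T y))"
  proof (rule cycle_integral_cong)
    fix w assume "w \<in> cycle_image \<Gamma>"
    then interpret R: bounded_clinear "resolv w T"
      by (intro bounded_clinear_resolv cycle_image_not_in_sp[OF \<Gamma>])
    show "f w * \<phi> (resolv w T (x + y)) = f w * \<phi> (resolv w T x) + f w * \<phi> (resolv w T y)"
      by (simp add: R.add \<phi>.add distrib_left)
  qed
  then show "\<phi> (hfc Om f T (x + y)) = \<phi> (hfc Om f T x + hfc Om f T y)"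
    by (simp add: functional_hfc[OF \<Gamma> f \<phi>] \<phi>.add cycle_integral_add add_divide_distrib
        cycle_integrable_functional_resolv[OF \<Gamma> f \<phi>])
qed

lemma hfc_cscale_vector:
  assumes f: "f holomorphic_on Om"
  shows "hfc Om f T (cscale c x) = cscale c (hfc Om f T x)"
proof (rule functionals_separate_points)
  fix \<phi> :: "'a \<Rightarrow> complex" assume \<phi>: "bounded_clinear \<phi>"
  then interpret \<phi>: bounded_clinear \<phi> .
  obtain \<Gamma> where \<Gamma>: "admissible_cycle Om (sp T) \<Gamma>" using polynomial_admissible_cycle_exists .
  have "cycle_integral \<Gamma> (\<lambda>w. f w * \<phi> (resolv w T (cscale c x))) =
      cycle_integral \<Gamma> (\<lambda>w. c * (f w * \<phi> (resolv w T x)))"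
    by (rule cycle_integral_cong)
       (simp add: bounded_clinear.cscale[OF bounded_clinear_resolv] cycle_image_not_in_sp[OF \<Gamma>] \<phi>.cscale)
  then show "\<phi> (hfc Om f T (cscale c x)) = \<phi> (cscale c (hfc Om f T x))"
    by (simp add: functional_hfc[OF \<Gamma> f \<phi>] \<phi>.cscale cycle_integral_lmul
        cycle_integrable_functional_resolv[OF \<Gamma> f \<phi>])
qed

lemma bounded_clinear_hfc:
  assumes f: "f holomorphic_on Om"
  shows "bounded_clinear (hfc Om f T)"
proof -
  obtain \<Gamma> where \<Gamma>: "polynomial_paths \<Gamma>" "admissible_cycle Om (sp T) \<Gamma>"
    using polynomial_admissible_cycle_exists .
  have cycle: "is_cycle Om \<Gamma>" using \<Gamma>(2) by (simp add: admissible_cycle_iff null_homologous_def)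
  obtain C where C: "C \<ge> 0" "resolvent_bounded C (cycle_image \<Gamma>) T"
    using resolvent_bounded_compact[OF bounded_clinear compact_cycle_image[OF cycle]]
      admissible_cycle_image[OF \<Gamma>(2)]
    by blast
  obtain L where "\<And>x. norm (hfc Om f T x) \<le> L * C * norm x"
    using norm_hfc_le[OF \<Gamma>(1) cycle f] hfc_domain_axioms \<Gamma>(2) C by metis
  with hfc_add_vector[OF f] hfc_cscale_vector[OF f] show ?thesis by (rule bounded_clinearI)
qed

end

lemma (in hfc_domain) hfc_diff:
  assumes f: "f holomorphic_on Om" and g: "g holomorphic_on Om"
  shows "hfc Om (\<lambda>w. f w - g w) T x = hfc Om f T x - hfc Om g T x"
proof (rule functionals_separate_points)
  fix \<phi> :: "'a \<Rightarrow> complex" assume \<phi>: "bounded_clinear \<phi>"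
  then interpret \<phi>: bounded_clinear \<phi> .
  obtain \<Gamma> where \<Gamma>: "admissible_cycle Om (sp T) \<Gamma>" using polynomial_admissible_cycle_exists .
  have "\<phi> (hfc Om (\<lambda>w. f w - g w) T x) =
      1 / (2 * of_real pi * \<i>) * cycle_integral \<Gamma> (\<lambda>w. f w * \<phi> (resolv w T x) - g w * \<phi> (resolv w T x))"
    using functional_hfc[OF \<Gamma> holomorphic_on_diff[OF f g] \<phi>] by (simp add: left_diff_distrib)
  then show "\<phi> (hfc Om (\<lambda>w. f w - g w) T x) = \<phi> (hfc Om f T x - hfc Om g T x)"
    using cycle_integrable_functional_resolv[OF \<Gamma> _ \<phi>] f g
    by (simp add: cycle_integral_diff \<phi>.diff functional_hfc[OF \<Gamma> _ \<phi>] diff_divide_distrib)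
qed

text \<open>On the circle, \<open>R(w) x - x / w = R(w) T x / w\<close>.\<close>

lemma norm_contour_integral_circlepath_resolv_le:
  fixes T :: "'a::complex_banach \<Rightarrow> 'a"
  assumes T: "bounded_clinear T" and M: "M \<ge> 0" "\<And>x. norm (T x) \<le> M * norm x" and r: "r > M"
    and \<phi>: "bounded_clinear \<phi>" and k: "k \<ge> 0" "\<And>x. cmod (\<phi> x) \<le> k * norm x"
  shows "cmod (contour_integral (circlepath 0 r) (\<lambda>w. \<phi> (resolv w T x)) - 2 * of_real pi * \<i> * \<phi> x)
    \<le> 2 * pi * (k * norm (T x) / (r - M))"
proof -
  interpret \<phi>: bounded_clinear \<phi> by (rule \<phi>)
  have "r > 0" using r M(1) by simp
  have circle: "w \<notin> sp T" "norm (resolv w T y) \<le> 1 / (r - M) * norm y" "w \<noteq> 0" if "cmod w = r" for w y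
    using resolvent_boundedD[OF resolvent_bounded_outside_cball[OF T M]] that r \<open>r > 0\<close> by auto
  have resolvent: "(\<lambda>w. \<phi> (resolv w T x)) contour_integrable_on circlepath 0 r"
    using weakly_holomorphic_resolv[OF T, of x] \<phi> circle(1) \<open>r > 0\<close>
    by (intro contour_integrable_holomorphic_simple[OF _ open_resolvent_set[OF T]])
       (auto simp: weakly_holomorphic_def)
  have "(\<lambda>w. 1 / (w - 0)) contour_integrable_on circlepath 0 r"
    using \<open>r > 0\<close> by (intro contour_integrable_holomorphic_simple[of _ "- {0}"]) (auto intro!: holomorphic_intros)
  then have kernel: "((\<lambda>w. 1 / (w - 0)) has_contour_integral 2 * of_real pi * \<i>) (circlepath 0 r)"
    by (metis contour_integral_circlepath[OF \<open>r > 0\<close>] has_contour_integral_integral)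
  have "((\<lambda>w. \<phi> (resolv w T x) - \<phi> x * (1 / (w - 0))) has_contour_integral
      contour_integral (circlepath 0 r) (\<lambda>w. \<phi> (resolv w T x)) - \<phi> x * (2 * of_real pi * \<i>)) (circlepath 0 r)"
    by (intro has_contour_integral_diff has_contour_integral_lmul has_contour_integral_integral resolvent kernel)
  then have "cmod (contour_integral (circlepath 0 r) (\<lambda>w. \<phi> (resolv w T x)) - \<phi> x * (2 * of_real pi * \<i>))
      \<le> k * norm (T x) / (r - M) / r * (2 * pi * r)"
  proof (rule has_contour_integral_bound_circlepath)
    fix w assume "cmod (w - 0) = r"
    then have w: "cmod w = r" by simp
    have "\<phi> (resolv w T (T x)) = w * \<phi> (resolv w T x) - \<phi> x"
      by (simp add: resolv_apply[OF circle(1)[OF w]] \<phi>.diff \<phi>.cscale)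
    then have "\<phi> (resolv w T x) - \<phi> x * (1 / (w - 0)) = \<phi> (resolv w T (T x)) / w"
      using circle(3)[OF w] by (simp add: field_simps)
    moreover have "cmod (\<phi> (resolv w T (T x))) \<le> k * (1 / (r - M) * norm (T x))"
      using k(2) mult_left_mono[OF circle(2)[OF w] k(1)] order_trans by blast
    then have "cmod (\<phi> (resolv w T (T x))) / r \<le> k * (1 / (r - M) * norm (T x)) / r"
      using \<open>r > 0\<close> by (simp only: divide_right_mono less_imp_le)
    ultimately show "cmod (\<phi> (resolv w T x) - \<phi> x * (1 / (w - 0))) \<le> k * norm (T x) / (r - M) / r"
      using w by (simp add: norm_divide)
  qed (use r \<open>r > 0\<close> k in auto)
  then show ?thesis using \<open>r > 0\<close> by (simp add: mult_ac)
qed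

context hfc_domain
begin

lemma hfc_one: "hfc Om (\<lambda>_. 1) T x = x"
proof (rule functionals_separate_points)
  fix \<phi> :: "'a \<Rightarrow> complex" assume \<phi>: "bounded_clinear \<phi>"
  then interpret \<phi>: bounded_clinear \<phi> .
  interpret plane: hfc_domain T UNIV by unfold_locales auto
  obtain M where M: "M \<ge> 0" "\<And>x. norm (T x) \<le> M * norm x" using nonneg_bounded by (metis mult.commute)
  obtain k where k: "k \<ge> 0" "\<And>x. cmod (\<phi> x) \<le> k * norm x" using \<phi>.nonneg_bounded by (metis mult.commute)
  have bound: "cmod (\<phi> (hfc UNIV (\<lambda>_. 1) T x) - \<phi> x) \<le> k * norm (T x) / (r - M)" if r: "r > M" for r
  proof -
    define I where "I = contour_integral (circlepath 0 r) (\<lambda>w. \<phi> (resolv w T x))"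
    have "\<forall>z\<in>sp T. cmod z < r"
      using norm_le_in_sp[OF bounded_clinear M] r by fastforce
    then have "admissible_cycle UNIV (sp T) [circlepath 0 r]"
      using r M(1) by (auto simp: admissible_cycle_def intro!: winding_number_circlepath)
    then have "\<phi> (hfc UNIV (\<lambda>_. 1) T x) = 1 / (2 * of_real pi * \<i>) * I"
      using plane.functional_hfc[OF _ holomorphic_on_const \<phi>] by (simp add: cycle_integral_def I_def)
    then have "I - 2 * of_real pi * \<i> * \<phi> x = 2 * of_real pi * \<i> * (\<phi> (hfc UNIV (\<lambda>_. 1) T x) - \<phi> x)"
      by (simp add: field_simps)
    then have "2 * pi * cmod (\<phi> (hfc UNIV (\<lambda>_. 1) T x) - \<phi> x) \<le> 2 * pi * (k * norm (T x) / (r - M))"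
      using norm_contour_integral_circlepath_resolv_le[OF bounded_clinear M r \<phi> k, of x]
      by (simp add: I_def norm_mult)
    then show ?thesis by (rule mult_left_le_imp_le) simp
  qed
  have "filterlim (\<lambda>r. - M + r) at_top at_top"
    by (rule filterlim_tendsto_add_at_top[OF tendsto_const filterlim_ident])
  then have "((\<lambda>r. k * norm (T x) / (r - M)) \<longlongrightarrow> 0) at_top"
    by (intro tendsto_divide_0[OF tendsto_const] filterlim_at_top_imp_at_infinity) simp
  then have "cmod (\<phi> (hfc UNIV (\<lambda>_. 1) T x) - \<phi> x) \<le> 0"
    by (rule tendsto_lowerbound) (auto intro: eventually_mono[OF eventually_gt_at_top[of M] bound])
  then show "\<phi> (hfc Om (\<lambda>_. 1) T x) = \<phi> x"
    by (simp add: hfc_subdomain[of UNIV])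
qed

lemma hfc_const: "hfc Om (\<lambda>_. c) T x = cscale c x"
proof (rule functionals_separate_points)
  fix \<phi> :: "'a \<Rightarrow> complex" assume \<phi>: "bounded_clinear \<phi>"
  obtain \<Gamma> where \<Gamma>: "admissible_cycle Om (sp T) \<Gamma>" using polynomial_admissible_cycle_exists .
  have "cycle_integral \<Gamma> (\<lambda>w. c * (1 * \<phi> (resolv w T x))) = c * cycle_integral \<Gamma> (\<lambda>w. 1 * \<phi> (resolv w T x))"
    by (rule cycle_integral_lmul[OF cycle_integrable_functional_resolv[OF \<Gamma> holomorphic_on_const \<phi>]])
  then have "\<phi> (hfc Om (\<lambda>_. c) T x) = c * \<phi> (hfc Om (\<lambda>_. 1) T x)"
    by (simp add: functional_hfc[OF \<Gamma> holomorphic_on_const \<phi>])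
  then show "\<phi> (hfc Om (\<lambda>_. c) T x) = \<phi> (cscale c x)"
    by (simp add: hfc_one bounded_clinear.cscale[OF \<phi>])
qed

lemma hfc_ident: "hfc Om (\<lambda>w. w) T x = T x"
proof (rule functionals_separate_points)
  fix \<phi> :: "'a \<Rightarrow> complex" assume \<phi>: "bounded_clinear \<phi>"
  then interpret \<phi>: bounded_clinear \<phi> .
  obtain \<Gamma> where \<Gamma>: "admissible_cycle Om (sp T) \<Gamma>" using polynomial_admissible_cycle_exists .
  have "cycle_integral \<Gamma> (\<lambda>w. w * \<phi> (resolv w T x)) = cycle_integral \<Gamma> (\<lambda>w. 1 * \<phi> (resolv w T (T x)) + \<phi> x)"
    by (rule cycle_integral_cong) (simp add: resolv_apply cycle_image_not_in_sp[OF \<Gamma>] \<phi>.diff \<phi>.cscale)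
  also have "\<dots> = cycle_integral \<Gamma> (\<lambda>w. 1 * \<phi> (resolv w T (T x))) + cycle_integral \<Gamma> (\<lambda>_. \<phi> x)"
    by (intro cycle_integral_add cycle_integrable_functional_resolv[OF \<Gamma> _ \<phi>]
        cycle_integrable_holomorphic[OF admissible_cycle_is_cycle[OF \<Gamma>] open_domain_diff_sp] holomorphic_on_const)
  also have "cycle_integral \<Gamma> (\<lambda>_. \<phi> x) = 0"
    by (rule Cauchy_theorem_cycle[OF open_domain admissible_cycle_null_homologous[OF \<Gamma>] holomorphic_on_const])
  finally have "\<phi> (hfc Om (\<lambda>w. w) T x) = \<phi> (hfc Om (\<lambda>_. 1) T (T x))"
    by (simp add: functional_hfc[OF \<Gamma> _ \<phi>] holomorphic_on_ident holomorphic_on_const)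
  then show "\<phi> (hfc Om (\<lambda>w. w) T x) = \<phi> (T x)" by (simp add: hfc_one)
qed

lemma resolv_hfc:
  assumes w: "w \<notin> Om" and g: "g holomorphic_on Om"
  shows "resolv w T (hfc Om g T x) = hfc Om (\<lambda>z. g z / (w - z)) T x"
proof (rule functionals_separate_points)
  fix \<phi> :: "'a \<Rightarrow> complex" assume \<phi>: "bounded_clinear \<phi>"
  then interpret \<phi>: bounded_clinear \<phi> .
  obtain \<Gamma> where \<Gamma>: "admissible_cycle Om (sp T) \<Gamma>" using polynomial_admissible_cycle_exists .
  have w_sp: "w \<notin> sp T" using w sp_subset by blast
  have quotient: "(\<lambda>z. g z / (w - z)) holomorphic_on Om" using w by (auto intro!: holomorphic_intros g)
  have integrable: "cycle_integrable \<Gamma> (\<lambda>z. g z / (w - z))"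
    using holomorphic_on_subset[OF quotient]
    by (intro cycle_integrable_holomorphic[OF admissible_cycle_is_cycle[OF \<Gamma>] open_domain_diff_sp]) auto
  have "cycle_integral \<Gamma> (\<lambda>z. g z * \<phi> (resolv w T (resolv z T x))) =
      cycle_integral \<Gamma> (\<lambda>z. g z / (w - z) * \<phi> (resolv z T x) - \<phi> (resolv w T x) * (g z / (w - z)))"
  proof (rule cycle_integral_cong)
    fix z assume z: "z \<in> cycle_image \<Gamma>"
    have "\<phi> (resolv w T x) - \<phi> (resolv z T x) = (z - w) * \<phi> (resolv w T (resolv z T x))"
      using resolvent_identity[OF w_sp cycle_image_not_in_sp[OF \<Gamma> z], of x] by (simp add: \<phi>.cscale flip: \<phi>.diff)
    moreover have "w \<noteq> z" using z w admissible_cycle_image[OF \<Gamma>] by auto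
    ultimately have difference: "\<phi> (resolv w T (resolv z T x)) = (\<phi> (resolv z T x) - \<phi> (resolv w T x)) / (w - z)"
      by (simp add: field_simps)
    show "g z * \<phi> (resolv w T (resolv z T x)) =
        g z / (w - z) * \<phi> (resolv z T x) - \<phi> (resolv w T x) * (g z / (w - z))"
      unfolding difference by (simp add: diff_divide_distrib algebra_simps)
  qed
  also have "\<dots> = cycle_integral \<Gamma> (\<lambda>z. g z / (w - z) * \<phi> (resolv z T x)) -
      \<phi> (resolv w T x) * cycle_integral \<Gamma> (\<lambda>z. g z / (w - z))"
    by (simp only: cycle_integral_diff cycle_integral_lmul integrable cycle_integrable_lmul
        cycle_integrable_functional_resolv[OF \<Gamma> quotient \<phi>])
  also have "cycle_integral \<Gamma> (\<lambda>z. g z / (w - z)) = 0"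
    by (rule Cauchy_theorem_cycle[OF open_domain admissible_cycle_null_homologous[OF \<Gamma>] quotient])
  finally show "\<phi> (resolv w T (hfc Om g T x)) = \<phi> (hfc Om (\<lambda>z. g z / (w - z)) T x)"
    using functional_hfc[OF \<Gamma> g bounded_clinear_compose[OF \<phi> bounded_clinear_resolv[OF w_sp]]]
    by (simp add: functional_hfc[OF \<Gamma> quotient \<phi>])
qed

lemma functional_resolv_hfc:
  fixes \<phi> :: "'a \<Rightarrow> complex"
  assumes \<Gamma>: "admissible_cycle Om (sp T) \<Gamma>" and w: "w \<notin> Om" and g: "g holomorphic_on Om" and \<phi>: "bounded_clinear \<phi>"
  shows "\<phi> (resolv w T (hfc Om g T x)) =
    cycle_integral \<Gamma> (\<lambda>z. 1 / (2 * of_real pi * \<i>) * (g z * \<phi> (resolv z T x)) / (w - z))"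
proof -
  have quotient: "(\<lambda>z. g z / (w - z)) holomorphic_on Om" using w by (auto intro!: holomorphic_intros g)
  have "\<phi> (resolv w T (hfc Om g T x)) =
      1 / (2 * of_real pi * \<i>) * cycle_integral \<Gamma> (\<lambda>z. g z / (w - z) * \<phi> (resolv z T x))"
    by (simp only: resolv_hfc[OF w g] functional_hfc[OF \<Gamma> quotient \<phi>])
  also have "\<dots> = cycle_integral \<Gamma> (\<lambda>z. 1 / (2 * of_real pi * \<i>) * (g z / (w - z) * \<phi> (resolv z T x)))"
    by (rule cycle_integral_lmul[OF cycle_integrable_functional_resolv[OF \<Gamma> quotient \<phi>], symmetric])
  finally show ?thesis by simp
qed

lemma hfc_domain_inside:
  assumes "admissible_cycle Om (sp T) \<Gamma>"
  shows "hfc_domain T (Om \<inter> cycle_inside \<Gamma>)"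
proof
  show "open (Om \<inter> cycle_inside \<Gamma>)"
    using open_domain open_cycle_inside[OF admissible_cycle_is_cycle[OF assms]] by (rule open_Int)
  show "sp T \<subseteq> Om \<inter> cycle_inside \<Gamma>"
    using assms sp_subset by (simp add: admissible_cycle_iff)
qed

text \<open>The cycle of the second factor runs inside the cycle of the first one.\<close>

lemma hfc_mult:
  assumes f: "f holomorphic_on Om" and g: "g holomorphic_on Om"
  shows "hfc Om f T (hfc Om g T x) = hfc Om (\<lambda>w. f w * g w) T x"
proof (rule functionals_separate_points)
  fix \<phi> :: "'a \<Rightarrow> complex" assume \<phi>: "bounded_clinear \<phi>"
  define c :: complex where "c = 1 / (2 * of_real pi * \<i>)"
  obtain \<Gamma> where \<Gamma>: "polynomial_paths \<Gamma>" "admissible_cycle Om (sp T) \<Gamma>" using polynomial_admissible_cycle_exists .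
  define U where "U = Om \<inter> cycle_inside \<Gamma>"
  have U: "U \<subseteq> Om" by (simp add: U_def)
  interpret U: hfc_domain T U unfolding U_def by (rule hfc_domain_inside[OF \<Gamma>(2)])
  obtain \<Delta> where \<Delta>: "polynomial_paths \<Delta>" "admissible_cycle U (sp T) \<Delta>" using U.polynomial_admissible_cycle_exists .
  have fU: "f holomorphic_on U" and gU: "g holomorphic_on U" using f g U by (auto intro: holomorphic_on_subset)
  define G where "G z = c * (g z * \<phi> (resolv z T x))" for z
  have "G holomorphic_on U - sp T"
    unfolding G_def by (intro holomorphic_on_mult holomorphic_on_const U.holomorphic_functional_resolv gU \<phi>)
  then have G: "continuous_on (cycle_image \<Delta>) G"
    using admissible_cycle_image[OF \<Delta>(2)] by (blast intro: continuous_on_subset holomorphic_on_imp_continuous_on)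
  have inner: "\<phi> (resolv w T (hfc Om g T x)) = cycle_integral \<Delta> (\<lambda>z. G z / (w - z))" if "w \<in> cycle_image \<Gamma>" for w
  proof -
    have "w \<notin> U" using that by (simp add: U_def cycle_inside_def)
    then show ?thesis
      using U.functional_resolv_hfc[OF \<Delta>(2) _ gU \<phi>] U.hfc_subdomain[OF open_domain U g]
      by (simp add: G_def c_def)
  qed
  have "\<phi> (hfc Om f T (hfc Om g T x)) = c * cycle_integral \<Gamma> (\<lambda>w. f w * \<phi> (resolv w T (hfc Om g T x)))"
    unfolding c_def by (rule functional_hfc[OF \<Gamma>(2) f \<phi>])
  also have "cycle_integral \<Gamma> (\<lambda>w. f w * \<phi> (resolv w T (hfc Om g T x))) =
      cycle_integral \<Gamma> (\<lambda>w. f w * cycle_integral \<Delta> (\<lambda>z. G z / (w - z)))"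
    by (rule cycle_integral_cong) (simp only: inner)
  also have "\<dots> = cycle_integral \<Delta> (\<lambda>z. 2 * pi * \<i> * f z * G z)"
    using admissible_cycle_image[OF \<Delta>(2)]
    by (intro cycle_integral_Cauchy_transform[OF open_domain \<Gamma>(1) _ f \<Delta>(1) _ G]
        admissible_cycle_null_homologous[OF \<Gamma>(2)])
       (auto simp: U_def)
  also have "\<dots> = cycle_integral \<Delta> (\<lambda>z. f z * g z * \<phi> (resolv z T x))"
    by (simp add: G_def c_def mult_ac)
  also have "c * \<dots> = \<phi> (hfc U (\<lambda>w. f w * g w) T x)"
    unfolding c_def by (rule U.functional_hfc[OF \<Delta>(2) holomorphic_on_mult[OF fU gU] \<phi>, symmetric])
  also have "\<dots> = \<phi> (hfc Om (\<lambda>w. f w * g w) T x)"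
    by (simp only: U.hfc_subdomain[OF open_domain U holomorphic_on_mult[OF f g]])
  finally show "\<phi> (hfc Om f T (hfc Om g T x)) = \<phi> (hfc Om (\<lambda>w. f w * g w) T x)" .
qed

lemma is_resolvent_hfc_inverse:
  assumes f: "f holomorphic_on Om" and \<mu>: "\<mu> \<notin> f ` Om"
  shows "is_resolvent \<mu> (hfc Om f T) (hfc Om (\<lambda>w. 1 / (\<mu> - f w)) T)"
proof -
  have difference: "(\<lambda>w. \<mu> - f w) holomorphic_on Om" by (intro holomorphic_intros f)
  have inverse: "(\<lambda>w. 1 / (\<mu> - f w)) holomorphic_on Om" using \<mu> by (intro holomorphic_intros f) auto
  have one: "hfc Om h T x = x" if "\<And>w. w \<in> Om \<Longrightarrow> 1 = h w" for h x
    using hfc_cong[OF holomorphic_on_const that] by (simp add: hfc_one)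
  have "cscale \<mu> x - hfc Om f T x = hfc Om (\<lambda>w. \<mu> - f w) T x" for x
    by (simp add: hfc_diff[OF holomorphic_on_const f] hfc_const)
  moreover have "hfc Om (\<lambda>w. (\<mu> - f w) * (1 / (\<mu> - f w))) T x = x"
    "hfc Om (\<lambda>w. 1 / (\<mu> - f w) * (\<mu> - f w)) T x = x" for x
    by (rule one; use \<mu> in force)+
  ultimately show ?thesis
    by (simp only: is_resolvent_iff bounded_clinear_hfc[OF inverse] hfc_mult[OF difference inverse]
        hfc_mult[OF inverse difference] simp_thms)
qed

lemma is_resolvent_hfc_factor:
  assumes f: "f holomorphic_on Om" and k: "k holomorphic_on Om"
    and factor: "\<And>w. w \<in> Om \<Longrightarrow> f l - f w = (l - w) * k w" and l: "f l \<notin> sp (hfc Om f T)"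
  shows "is_resolvent l T (\<lambda>x. hfc Om k T (resolv (f l) (hfc Om f T) x))"
proof -
  define K where "K = hfc Om k T"
  define Q where "Q = resolv (f l) (hfc Om f T)"
  have linear: "(\<lambda>w. l - w) holomorphic_on Om" by (intro holomorphic_intros)
  have shift: "cscale l x - T x = hfc Om (\<lambda>w. l - w) T x" for x
    by (simp add: hfc_diff[OF holomorphic_on_const holomorphic_on_ident] hfc_const hfc_ident)
  have product: "hfc Om h T x = cscale (f l) x - hfc Om f T x" if "\<And>w. w \<in> Om \<Longrightarrow> f l - f w = h w" for h x
  proof -
    have "hfc Om h T x = hfc Om (\<lambda>w. f l - f w) T x"
      using hfc_cong[OF holomorphic_on_diff[OF holomorphic_on_const f] that] by simp
    then show ?thesis by (simp add: hfc_diff[OF holomorphic_on_const f] hfc_const)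
  qed
  have right: "cscale l (K (Q x)) - T (K (Q x)) = x" for x
    using resolv_right_inverse[OF l, of x]
    by (simp add: shift K_def Q_def hfc_mult[OF linear k] product[of "\<lambda>w. (l - w) * k w"] factor)
  have left: "Q (K (cscale l x - T x)) = x" for x
    using resolv_left_inverse[OF l, of x]
    by (simp add: shift K_def Q_def hfc_mult[OF k linear] product[of "\<lambda>w. k w * (l - w)"] factor mult.commute)
  have "K (Q y) = Q (K y)" for y \<comment> \<open>a right inverse and a left inverse coincide\<close>
    using left[of "K (Q y)"] by (simp only: right)
  then have "K (Q (cscale l x - T x)) = x" for x
    by (simp only: left)
  moreover have "bounded_clinear (\<lambda>x. K (Q x))"
    unfolding K_def Q_def
    by (rule bounded_clinear_compose[OF bounded_clinear_hfc[OF k] bounded_clinear_resolv[OF l]])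
  ultimately show ?thesis
    using right by (simp add: is_resolvent_iff K_def Q_def)
qed

end

section \<open>Spectra of families\<close>

lemma bounded_family_eventually:
  assumes T: "bounded_family T"
  obtains M where "M \<ge> 0" "\<forall>\<^sub>F h in at_right 0. bounded_clinear (T h) \<and> (\<forall>x. norm (T h x) \<le> M * norm x)"
proof -
  obtain M where M: "\<And>h. h \<in> {0<..1} \<Longrightarrow> onorm (T h) \<le> M"
    using T unfolding bounded_family_def by blast
  have bounded: "bounded_clinear (T h) \<and> (\<forall>x. norm (T h x) \<le> max M 0 * norm x)" if "h \<in> {0<..1}" for h
  proof -
    have "bounded_clinear (T h)" using T that by (simp add: bounded_family_def bop_iff_bounded_clinear)
    moreover have "norm (T h x) \<le> max M 0 * norm x" for x
    proof -
      have "norm (T h x) \<le> onorm (T h) * norm x"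
        by (rule onorm[OF bounded_clinear.axioms(1)[OF \<open>bounded_clinear (T h)\<close>]])
      also have "\<dots> \<le> max M 0 * norm x" using M[OF that] by (intro mult_right_mono) auto
      finally show ?thesis .
    qed
    ultimately show ?thesis by blast
  qed
  have "\<forall>\<^sub>F h in at_right 0. h \<in> {0<..<1::real}" by (rule eventually_at_right_real) simp
  then have "\<forall>\<^sub>F h in at_right 0. bounded_clinear (T h) \<and> (\<forall>x. norm (T h x) \<le> max M 0 * norm x)"
    by (rule eventually_mono) (rule bounded, simp)
  then show ?thesis by (intro that[of "max M 0"]) simp
qed

lemma resolvent_bounded_of_onorm:
  fixes T :: "'a::complex_banach \<Rightarrow> 'a"
  assumes T: "bounded_clinear T" and R: "bounded_clinear R" and C: "C \<ge> 0" "\<And>x. norm (R x) \<le> C * norm x"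
    and right: "onorm (\<lambda>x. cscale l (R x) - T (R x) - x) < 1 / 2"
    and left: "onorm (\<lambda>x. R (cscale l x - T x) - x) < 1 / 2"
  shows "resolvent_bounded (2 * C) {l} T"
proof -
  have half: "norm (E x) \<le> 1 / 2 * norm x" if "bounded_clinear E" "onorm E < 1 / 2" for E :: "'a \<Rightarrow> 'a" and x
    using onorm[OF bounded_clinear.axioms(1)[OF that(1)], of x]
      mult_right_mono[OF less_imp_le[OF that(2)] norm_ge_zero[of x]]
    by (rule order_trans)
  note shift = bounded_clinear_cscale_minus[OF T, of l]
  obtain S where "is_resolvent l T S" "\<And>x. norm (S x) \<le> C / (1 - 1 / 2) * norm x"
  proof (rule resolvent_of_approximate_inverse[OF T R, of "1 / 2" C l])
    show "norm (R (cscale l x - T x) - x) \<le> 1 / 2 * norm x" for x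
      using half[OF bounded_clinear_diff[OF bounded_clinear_compose[OF R shift] bounded_clinear_ident] left] .
    show "norm (cscale l (R x) - T (R x) - x) \<le> 1 / 2 * norm x" for x
      using half[OF bounded_clinear_diff[OF bounded_clinear_compose[OF shift R] bounded_clinear_ident] right] .
  qed (use C in auto)
  then show ?thesis by (intro resolvent_bounded_singletonI) (auto simp: mult.commute)
qed

lemma fam_resolvent_set_imp_uniform_resolvent:
  assumes S: "\<forall>\<^sub>F h in at_right 0. bounded_clinear (S h)" and l: "l \<in> fam_resolvent_set S"
  shows "uniform_resolvent S {l}"
proof -
  obtain R where R: "bounded_family R"
      "((\<lambda>h. onorm (\<lambda>x. cscale l (R h x) - S h (R h x) - x)) \<longlongrightarrow> 0) (at_right 0)"
      "((\<lambda>h. onorm (\<lambda>x. R h (cscale l x - S h x) - x)) \<longlongrightarrow> 0) (at_right 0)"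
    using l by (auto simp: fam_resolvent_set_def)
  obtain C where C: "C \<ge> 0" "\<forall>\<^sub>F h in at_right 0. bounded_clinear (R h) \<and> (\<forall>x. norm (R h x) \<le> C * norm x)"
    using bounded_family_eventually[OF R(1)] .
  have "\<forall>\<^sub>F h in at_right 0. onorm (\<lambda>x. cscale l (R h x) - S h (R h x) - x) < 1 / 2"
    "\<forall>\<^sub>F h in at_right 0. onorm (\<lambda>x. R h (cscale l x - S h x) - x) < 1 / 2"
    using order_tendstoD(2)[OF R(2), of "1 / 2"] order_tendstoD(2)[OF R(3), of "1 / 2"] by simp_all
  with S C(2) have "\<forall>\<^sub>F h in at_right 0. resolvent_bounded (2 * C) {l} (S h)"
    by eventually_elim (auto intro: resolvent_bounded_of_onorm[OF _ _ C(1)])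
  then show ?thesis using C(1) unfolding uniform_resolvent_def by (intro exI[of _ "2 * C"]) auto
qed

lemma uniform_resolvent_imp_fam_resolvent_set:
  fixes S :: "real \<Rightarrow> 'a::complex_banach \<Rightarrow> 'a"
  assumes "uniform_resolvent S {l}"
  shows "l \<in> fam_resolvent_set S"
proof -
  obtain C where C: "C \<ge> 0" and ev: "\<forall>\<^sub>F h in at_right 0. resolvent_bounded C {l} (S h)"
    using assms unfolding uniform_resolvent_def by blast
  define R where "R h = (if resolvent_bounded C {l} (S h) then resolv l (S h) else (\<lambda>x. 0))" for h
  have "bounded_family R"
    unfolding bounded_family_def
  proof (intro conjI ballI exI[of _ C])
    fix h :: real
    have "norm (R h x) \<le> C * norm x" for x
      using C by (simp add: R_def resolvent_bounded_def)
    then show "onorm (R h) \<le> C" by (rule onorm_bound[OF C])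
    have "bounded_clinear (\<lambda>x. 0 :: 'a)"
      by (rule bounded_clinearI[where C = 0]) (simp_all add: cscale.zero_right)
    then show "bop (R h)"
      unfolding bop_iff_bounded_clinear R_def by (auto simp: resolvent_bounded_def intro: bounded_clinear_resolv)
  qed
  moreover from ev have "\<forall>\<^sub>F h in at_right 0. onorm (\<lambda>x. cscale l (R h x) - S h (R h x) - x) = 0"
    by eventually_elim (simp add: R_def resolv_right_inverse resolvent_boundedD(1) onorm_zero)
  moreover from ev have "\<forall>\<^sub>F h in at_right 0. onorm (\<lambda>x. R h (cscale l x - S h x) - x) = 0"
    by eventually_elim (simp add: R_def resolv_left_inverse resolvent_boundedD(1) onorm_zero)
  ultimately show ?thesis
    unfolding fam_resolvent_set_def by (blast intro: tendsto_eventually)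
qed

lemma fam_resolvent_set_iff_uniform_resolvent:
  "\<forall>\<^sub>F h in at_right 0. bounded_clinear (S h) \<Longrightarrow> l \<in> fam_resolvent_set S \<longleftrightarrow> uniform_resolvent S {l}"
  using fam_resolvent_set_imp_uniform_resolvent uniform_resolvent_imp_fam_resolvent_set by blast

context
  fixes T :: "real \<Rightarrow> 'a::complex_banach \<Rightarrow> 'a"
  assumes T: "bounded_family T"
begin

lemma family_eventually_bounded_clinear: "\<forall>\<^sub>F h in at_right 0. bounded_clinear (T h)"
  using bounded_family_eventually[OF T] by (metis (mono_tags, lifting) eventually_mono)

lemma fam_resolvent_set_iff: "l \<in> fam_resolvent_set T \<longleftrightarrow> uniform_resolvent T {l}"
  by (rule fam_resolvent_set_iff_uniform_resolvent[OF family_eventually_bounded_clinear])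

lemma uniform_resolvent_of_compact:
  assumes "compact K" "K \<inter> fam_sp T = {}"
  shows "uniform_resolvent T K"
proof (rule uniform_resolvent_compact[OF family_eventually_bounded_clinear assms(1)])
  show "uniform_resolvent T {l}" if "l \<in> K" for l
    using that assms(2) by (auto simp: fam_sp_def simp flip: fam_resolvent_set_iff)
qed

lemma compact_fam_sp: "compact (fam_sp T)"
proof -
  obtain M where M: "M \<ge> 0" "\<forall>\<^sub>F h in at_right 0. bounded_clinear (T h) \<and> (\<forall>x. norm (T h x) \<le> M * norm x)"
    using bounded_family_eventually[OF T] .
  have "fam_sp T = {l. \<not> uniform_resolvent T {l}}"
    by (auto simp: fam_sp_def fam_resolvent_set_iff)
  then show ?thesis using compact_not_uniform_resolvent[OF M] by simp
qed

lemma eventually_sp_subset: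
  assumes U: "open U" "fam_sp T \<subseteq> U"
  shows "\<forall>\<^sub>F h in at_right 0. sp (T h) \<subseteq> U"
proof -
  obtain M where M: "M \<ge> 0" "\<forall>\<^sub>F h in at_right 0. bounded_clinear (T h) \<and> (\<forall>x. norm (T h x) \<le> M * norm x)"
    using bounded_family_eventually[OF T] .
  have "uniform_resolvent T (cball 0 M - U)"
    using U by (intro uniform_resolvent_of_compact compact_diff compact_cball) auto
  then obtain C where "\<forall>\<^sub>F h in at_right 0. resolvent_bounded C (cball 0 M - U) (T h)"
    unfolding uniform_resolvent_def by blast
  with M(2) show ?thesis
  proof eventually_elim
    case (elim h)
    have "l \<in> cball 0 M" if "l \<in> sp (T h)" for l
      using norm_le_in_sp[OF _ M(1) _ that] elim(1) by simp
    then show ?case using elim(2) by (auto simp: resolvent_bounded_def)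
  qed
qed

lemma eventually_hfc_domain:
  assumes "open Om" "fam_sp T \<subseteq> Om"
  shows "\<forall>\<^sub>F h in at_right 0. hfc_domain (T h) Om"
  using family_eventually_bounded_clinear eventually_sp_subset[OF assms]
  by eventually_elim (use assms(1) in \<open>simp add: hfc_domain_def\<close>)

lemma eventually_norm_hfc_le:
  assumes Om: "open Om" "fam_sp T \<subseteq> Om" and f: "f holomorphic_on Om"
  obtains B where "B \<ge> 0" "\<forall>\<^sub>F h in at_right 0. \<forall>x. norm (hfc Om f (T h) x) \<le> B * norm x"
proof -
  obtain \<Gamma> where \<Gamma>: "polynomial_paths \<Gamma>" "admissible_cycle Om (fam_sp T) \<Gamma>"
    using polynomial_admissible_cycle[OF compact_fam_sp Om] .
  have null: "null_homologous Om \<Gamma>" using \<Gamma>(2) by (rule admissible_cycle_null_homologous)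
  then have cycle: "is_cycle Om \<Gamma>" by (simp add: null_homologous_def)
  have "fam_sp T \<subseteq> cycle_inside \<Gamma>" using \<Gamma>(2) by (simp add: admissible_cycle_iff)
  from eventually_sp_subset[OF open_cycle_inside[OF cycle] this]
  have admissible: "\<forall>\<^sub>F h in at_right 0. admissible_cycle Om (sp (T h)) \<Gamma>"
    by eventually_elim (simp add: admissible_cycle_iff null)
  have "uniform_resolvent T (cycle_image \<Gamma>)"
    using admissible_cycle_image[OF \<Gamma>(2)]
    by (intro uniform_resolvent_of_compact compact_cycle_image[OF cycle]) auto
  then obtain C where C: "C \<ge> 0" "\<forall>\<^sub>F h in at_right 0. resolvent_bounded C (cycle_image \<Gamma>) (T h)"
    unfolding uniform_resolvent_def by blast
  obtain L where L: "L \<ge> 0" "\<And>(S :: 'a \<Rightarrow> 'a) C x. hfc_domain S Om \<Longrightarrow> admissible_cycle Om (sp S) \<Gamma> \<Longrightarrow> C \<ge> 0 \<Longrightarrow>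
      resolvent_bounded C (cycle_image \<Gamma>) S \<Longrightarrow> norm (hfc Om f S x) \<le> L * C * norm x"
    using norm_hfc_le[OF \<Gamma>(1) cycle f] by blast
  from eventually_hfc_domain[OF Om] admissible C(2)
  have "\<forall>\<^sub>F h in at_right 0. \<forall>x. norm (hfc Om f (T h) x) \<le> L * C * norm x"
    by eventually_elim (intro allI L(2) C(1))
  then show ?thesis using L(1) C(1) by (intro that[of "L * C"]) auto
qed

lemma fam_resolvent_set_hfc_iff:
  assumes "open Om" "fam_sp T \<subseteq> Om" and f: "f holomorphic_on Om"
  shows "\<mu> \<in> fam_resolvent_set (\<lambda>h. hfc Om f (T h)) \<longleftrightarrow> uniform_resolvent (\<lambda>h. hfc Om f (T h)) {\<mu>}"
proof (rule fam_resolvent_set_iff_uniform_resolvent)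
  show "\<forall>\<^sub>F h in at_right 0. bounded_clinear (hfc Om f (T h))"
    using eventually_hfc_domain[OF assms(1,2)] by eventually_elim (rule hfc_domain.bounded_clinear_hfc[OF _ f])
qed

theorem fam_sp_hfc_subset:
  assumes Om: "open Om" "fam_sp T \<subseteq> Om" and f: "f holomorphic_on Om"
  shows "fam_sp (\<lambda>h. hfc Om f (T h)) \<subseteq> f ` fam_sp T"
proof -
  have "\<mu> \<in> fam_resolvent_set (\<lambda>h. hfc Om f (T h))" if \<mu>: "\<mu> \<notin> f ` fam_sp T" for \<mu>
  proof -
    define Om' where "Om' = {w \<in> Om. f w \<noteq> \<mu>}"
    have "open (Om \<inter> f -` (- {\<mu>}))"
      by (rule continuous_open_preimage[OF holomorphic_on_imp_continuous_on[OF f] Om(1)]) auto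
    moreover have "Om' = Om \<inter> f -` (- {\<mu>})" by (auto simp: Om'_def)
    ultimately have Om': "open Om'" "fam_sp T \<subseteq> Om'" "Om' \<subseteq> Om"
      using \<mu> Om(2) by (auto simp: Om'_def)
    have f': "f holomorphic_on Om'" using f Om'(3) by (rule holomorphic_on_subset)
    define g where "g w = 1 / (\<mu> - f w)" for w
    have "g holomorphic_on Om'"
      unfolding g_def by (intro holomorphic_intros f') (auto simp: Om'_def)
    then obtain B where B: "B \<ge> 0" "\<forall>\<^sub>F h in at_right 0. \<forall>x. norm (hfc Om' g (T h) x) \<le> B * norm x"
      using eventually_norm_hfc_le[OF Om'(1,2)] by blast
    from eventually_hfc_domain[OF Om'(1,2)] B(2)
    have "\<forall>\<^sub>F h in at_right 0. resolvent_bounded B {\<mu>} (hfc Om f (T h))"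
    proof eventually_elim
      case (elim h)
      then interpret hfc_domain "T h" Om' by blast
      have "is_resolvent \<mu> (hfc Om' f (T h)) (hfc Om' g (T h))"
        unfolding g_def by (rule is_resolvent_hfc_inverse[OF f']) (auto simp: Om'_def)
      moreover have "hfc Om' f (T h) = hfc Om f (T h)"
        by (intro ext hfc_subdomain Om(1) Om'(3) f)
      ultimately show ?case using elim(2) by (intro resolvent_bounded_singletonI) auto
    qed
    then show ?thesis
      using B(1) unfolding fam_resolvent_set_hfc_iff[OF Om f] uniform_resolvent_def by blast
  qed
  then show ?thesis by (auto simp: fam_sp_def)
qed

theorem image_fam_sp_subset:
  assumes Om: "open Om" "fam_sp T \<subseteq> Om" and f: "f holomorphic_on Om"
  shows "f ` fam_sp T \<subseteq> fam_sp (\<lambda>h. hfc Om f (T h))"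
proof -
  have "l \<in> fam_resolvent_set T" if l: "l \<in> Om" "f l \<in> fam_resolvent_set (\<lambda>h. hfc Om f (T h))" for l
  proof -
    define k where "k w = (if w = l then deriv f l else (f w - f l) / (w - l))" for w
    have k: "k holomorphic_on Om"
      unfolding k_def by (rule pole_lemma[OF f]) (use l(1) Om(1) in \<open>simp add: interior_open\<close>)
    have factor: "f l - f w = (l - w) * k w" for w
      by (auto simp: k_def field_simps)
    obtain B where B: "B \<ge> 0" "\<forall>\<^sub>F h in at_right 0. \<forall>x. norm (hfc Om k (T h) x) \<le> B * norm x"
      using eventually_norm_hfc_le[OF Om k] .
    obtain C where C: "C \<ge> 0" "\<forall>\<^sub>F h in at_right 0. resolvent_bounded C {f l} (hfc Om f (T h))"
      using l(2) unfolding fam_resolvent_set_hfc_iff[OF Om f] uniform_resolvent_def by blast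
    from eventually_hfc_domain[OF Om] B(2) C(2)
    have "\<forall>\<^sub>F h in at_right 0. resolvent_bounded (B * C) {l} (T h)"
    proof eventually_elim
      case (elim h)
      then interpret hfc_domain "T h" Om by blast
      define Q where "Q = resolv (f l) (hfc Om f (T h))"
      have "is_resolvent l (T h) (\<lambda>x. hfc Om k (T h) (Q x))"
        unfolding Q_def
        by (rule is_resolvent_hfc_factor[OF f k factor resolvent_boundedD(1)[OF elim(3) singletonI]])
      moreover have "norm (hfc Om k (T h) (Q x)) \<le> B * C * norm x" for x
      proof -
        have "norm (hfc Om k (T h) (Q x)) \<le> B * norm (Q x)" using elim(2) by blast
        also have "\<dots> \<le> B * (C * norm x)"
          unfolding Q_def by (intro mult_left_mono resolvent_boundedD(2)[OF elim(3)] B(1)) simp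
        finally show ?thesis by (simp add: mult.assoc)
      qed
      ultimately show ?case by (rule resolvent_bounded_singletonI)
    qed
    then show ?thesis
      using B(1) C(1) unfolding fam_resolvent_set_iff uniform_resolvent_def by (intro exI[of _ "B * C"]) auto
  qed
  then show ?thesis using Om(2) by (auto simp: fam_sp_def)
qed

end

theorem theorem27:
  fixes T :: "real \<Rightarrow> 'a::complex_banach \<Rightarrow> 'a"
    and Om :: "complex set" and f :: "complex \<Rightarrow> complex"
  assumes "bounded_family T"
    and "open Om"
    and "(\<Union>h\<in>{0<..1}. sp (T h)) \<subseteq> Om"
    and "fam_sp T \<subseteq> Om"
    and "f analytic_on Om"
  shows "fam_sp (\<lambda>h. hfc Om f (T h)) = f ` fam_sp T"
proof -
  have f: "f holomorphic_on Om" using assms(5) by (rule analytic_imp_holomorphic)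
  show ?thesis
    using fam_sp_hfc_subset[OF assms(1,2,4) f] image_fam_sp_subset[OF assms(1,2,4) f] by (rule antisym)
qed

end
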